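(* Let $N\in\mathbb{N}$, $\alpha\in(0,2)$. Let $D_0,D_1\subset\mathbb{R}^N$ be bounded open starshaped sets such that $0\in D_1$, $\overline{D}_1\subset D_0$, $D_0\setminus\overline{D}_1$ satisfies a uniform exterior cone condition, and $D_0\setminus\overline{D}_1$ is a $C^{1,1}$ domain. Let $f:(D_0\setminus\overline{D}_1)\times[0,1]\to\mathbb{R}$ be a function such that: - $t^{\alpha}f(tx,u)\ge f(x,u)$ for every $t\ge1$ and $(x,u)\in(D_0\setminus\overline{D}_1)\times[0,1]$ such that $tx\in D_0\setminus\overline{D}_1$; - there exists $C>0$ such that $|f(x,u_1)-f(x,u_2)|\le C|u_1-u_2|$ for all $x\in D_0\setminus\overline{D}_1$ and $u_1,u_2\in[0,1]$; - $f(x,u_1)\le f(x,u_2)$ for all $x\in D_0\setminus\overline{D}_1$ and $u_1,u_2\in[0,1]$ with $u_1<u_2$; - $f$ is bounded and continuous on $(D_0\setminus\overline{D}_1)\times[0,1]$ and $f(x,0)=0$ for every $x\in D_0\setminus\overline{D}_1$. Then there exists a unique solution $u$ of $$(P)\qquad -(-\Delta)^{\alpha/2}u=f(x,u)\ \text{ in } D_0\setminus\overline{D}_1,\qquad u=0\ \text{ in }\mathbb{R}^N\setminus D_0,\qquad u=1\ \text{ in }\overline{D}_1 .$$ It satisfies $0<u<1$ on $D_0\setminus\overline{D}_1$, and all superlevel sets $U(\ell)=\{x\in\mathbb{R}^N:u(x)\ge\ell\}$, $\ell\in(0,1)$, are starshaped. If moreover $D_0$ and $D_1$ are strictly starshaped,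 then all $U(\ell)$, $\ell\in(0,1)$, are strictly starshaped.
   Context: Let $\mathcal{L}^1_\alpha$ be the space of Borel functions $u:\mathbb{R}^N\to\mathbb{R}\cup\{\infty\}$ with $\int_{\mathbb{R}^N}\frac{|u(x)|}{(1+|x|)^{N+\alpha}}\,dx<\infty$. For $u\in\mathcal{L}^1_\alpha$ and $x\in\mathbb{R}^N$, the fractional Laplacian is $$(-\Delta)^{\alpha/2}u(x)=c_{N,\alpha}\lim_{\varepsilon\downarrow0}\int_{|x-y|>\varepsilon}\frac{u(x)-u(y)}{|x-y|^{N+\alpha}}\,dy$$ whenever the limit exists, with $c_{N,\alpha}=2^{\alpha-2}\pi^{-N/2}\alpha(2-\alpha)\Gamma(\frac{N+\alpha}{2})/\Gamma(2-\frac{\alpha}{2})$. It exists everywhere for functions in $C_c^2(\mathbb{R}^N)$. For $u\in\mathcal{L}^1_\alpha$ the distribution $(-\Delta)^{\alpha/2}u$ is defined by $\langle(-\Delta)^{\alpha/2}u,\varphi\rangle=\int_{\mathbb{R}^N}u\,(-\Delta)^{\alpha/2}\varphi\,dx$ for $\varphi\in C_c^\infty(\mathbb{R}^N)$. A solution of $(P)$ is a function $u$ that is continuous and bounded on $\mathbb{R}^N$, with $u=0$ in $\mathbb{R}^N\setminus D_0$, $u=1$ in $\overline{D}_1$, and $-(-\Delta)^{\alpha/2}u=f(x,u)$ as distributions in $D_0\setminus\overline{D}_1$, i.e. $\langle-(-\Delta)^{\alpha/2}u,\varphi\rangle=\int f(x,u(x))\varphi(x)\,dx$ for all $\varphi\in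 C_c^\infty(D_0\setminus\overline{D}_1)$. Since $f(x,\cdot)$ is defined only on $[0,1]$, a solution is understood to take values in $[0,1]$. A set $A\subset\mathbb{R}^N$ is starshaped (with respect to $0$) if $sA\subseteq A$ for every $s\in[0,1]$. It is strictly starshaped if $0$ is in the interior of $A$ and any ray starting from $0$ intersects the boundary of $A$ in only one point. *)

theory Defs
  imports "HOL-Analysis.Analysis"
begin

text \<open>
  The space is an arbitrary Euclidean space \<open>'a\<close>, and \<open>N\<close> is \<open>DIM('a)\<close>.
\<close>

section \<open>Starshaped sets\<close>

definition starshaped :: "'a::real_vector set \<Rightarrow> bool" where
  "starshaped A \<longleftrightarrow> (\<forall>s\<in>{0..1}. (\<lambda>x. s *\<^sub>R x) ` A \<subseteq> A)"

definition ray :: "'a::real_vector \<Rightarrow> 'a set" where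
  "ray v = {t *\<^sub>R v | t. 0 \<le> t}"

text \<open>
  ``Only one point'' is read as exactly one point. For a bounded set with \<open>0\<close> in its interior every
  ray meets the frontier, so for such sets this is the same as at most one point.
\<close>

definition strictly_starshaped :: "'a::real_normed_vector set \<Rightarrow> bool" where
  "strictly_starshaped A \<longleftrightarrow>
     0 \<in> interior A \<and> (\<forall>v. v \<noteq> 0 \<longrightarrow> (\<exists>!p. p \<in> ray v \<and> p \<in> frontier A))"

section \<open>Regularity of the domain\<close>

text \<open>
  The closed finite right circular cone with vertex \<open>z\<close>, axis in the direction of the unit
  vector \<open>e\<close>, half-angle \<open>arccos \<kappa>\<close> and height \<open>h\<close>.
\<close>

definition finite_cone :: "real \<Rightarrow> real \<Rightarrow> 'a::euclidean_space \<Rightarrow> 'a \<Rightarrow> 'a set" where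
  "finite_cone \<kappa> h e z = {x. \<kappa> * norm (x - z) \<le> (x - z) \<bullet> e \<and> (x - z) \<bullet> e \<le> h}"

definition uniform_exterior_cone_condition :: "'a::euclidean_space set \<Rightarrow> bool" where
  "uniform_exterior_cone_condition D \<longleftrightarrow>
     (\<exists>\<kappa> h. 0 < \<kappa> \<and> \<kappa> < 1 \<and> 0 < h \<and>
       (\<forall>z\<in>frontier D. \<exists>e. norm e = 1 \<and> finite_cone \<kappa> h e z \<inter> closure D = {z}))"

definition C11_function :: "('a::euclidean_space \<Rightarrow> real) \<Rightarrow> bool" where
  "C11_function \<phi> \<longleftrightarrow> (\<exists>g L. (\<forall>x. GDERIV \<phi> x :> g x) \<and> L-lipschitz_on UNIV g)"

text \<open>
  Near each boundary point, \<open>D\<close> is the set above the graph of a \<open>C\<^sup>1\<^sup>,\<^sup>1\<close> function over the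
  hyperplane orthogonal to a unit vector \<open>e\<close>. A function on that hyperplane is represented by
  one on the whole space that is evaluated at orthogonal projections only. Connectedness is not
  part of the notion: in dimension one, the ring between two intervals is disconnected.
\<close>

definition C11_domain :: "'a::euclidean_space set \<Rightarrow> bool" where
  "C11_domain D \<longleftrightarrow> open D \<and>
     (\<forall>z\<in>frontier D. \<exists>r e \<phi>. 0 < r \<and> norm e = 1 \<and> C11_function \<phi> \<and>
        D \<inter> ball z r = {x \<in> ball z r. \<phi> (x - (x \<bullet> e) *\<^sub>R e) < x \<bullet> e})"

section \<open>Test functions\<close>

primrec Ck :: "nat \<Rightarrow> ('a::euclidean_space \<Rightarrow> real) \<Rightarrow> bool" where
  "Ck 0 \<phi> \<longleftrightarrow> continuous_on UNIV \<phi>"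
| "Ck (Suc k) \<phi> \<longleftrightarrow> \<phi> differentiable_on UNIV \<and>
     (\<forall>b\<in>Basis. Ck k (\<lambda>x. frechet_derivative \<phi> (at x) b))"

definition test_functions :: "'a::euclidean_space set \<Rightarrow> ('a \<Rightarrow> real) set" where
  "test_functions D = {\<phi>. (\<forall>k. Ck k \<phi>) \<and>
     compact (closure {x. \<phi> x \<noteq> 0}) \<and> closure {x. \<phi> x \<noteq> 0} \<subseteq> D}"

section \<open>The fractional Laplacian\<close>

definition frac_const :: "real \<Rightarrow> real \<Rightarrow> real" where
  "frac_const N \<alpha> = 2 powr (\<alpha> - 2) * pi powr (- N / 2) * \<alpha> * (2 - \<alpha>) *
     Gamma ((N + \<alpha>) / 2) / Gamma (2 - \<alpha> / 2)"

text \<open>The value is meaningful only where the limit exists, as it does everywhere for test functions.\<close>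

definition frac_laplacian :: "real \<Rightarrow> ('a::euclidean_space \<Rightarrow> real) \<Rightarrow> 'a \<Rightarrow> real" where
  "frac_laplacian \<alpha> u x = frac_const (real DIM('a)) \<alpha> *
     Lim (at_right 0) (\<lambda>\<epsilon>. LINT y:{y. \<epsilon> < dist x y}|lborel.
       (u x - u y) / dist x y powr (real DIM('a) + \<alpha>))"

text \<open>
  The pairing of the distribution \<open>(-\<Delta>)\<^bsup>\<alpha>/2\<^esup> u\<close> with a test function. It requires
  \<open>u\<close> to be integrable against the weight \<open>(1 + |x|)\<^bsup>- N - \<alpha>\<^esup>\<close>, which holds for the
  bounded continuous functions considered below.
\<close>

definition frac_laplacian_distr ::
    "real \<Rightarrow> ('a::euclidean_space \<Rightarrow> real) \<Rightarrow> ('a \<Rightarrow> real) \<Rightarrow> real" where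
  "frac_laplacian_distr \<alpha> u \<phi> = (LINT x|lborel. u x * frac_laplacian \<alpha> \<phi> x)"

section \<open>The boundary value problem\<close>

definition is_solution ::
    "real \<Rightarrow> 'a::euclidean_space set \<Rightarrow> 'a set \<Rightarrow> ('a \<Rightarrow> real \<Rightarrow> real) \<Rightarrow> ('a \<Rightarrow> real) \<Rightarrow> bool" where
  "is_solution \<alpha> D0 D1 f u \<longleftrightarrow>
     continuous_on UNIV u \<and> bounded (range u) \<and> (\<forall>x. u x \<in> {0..1}) \<and>
     (\<forall>x. x \<notin> D0 \<longrightarrow> u x = 0) \<and> (\<forall>x\<in>closure D1. u x = 1) \<and>
     (\<forall>\<phi>\<in>test_functions (D0 - closure D1).
        - frac_laplacian_distr \<alpha> u \<phi> = (LINT x:D0 - closure D1|lborel. f x (u x) * \<phi> x))"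

definition superlevel :: "('a \<Rightarrow> real) \<Rightarrow> real \<Rightarrow> 'a set" where
  "superlevel u l = {x. l \<le> u x}"

end

theory Submission
  imports Defs "HOL-Complex_Analysis.Great_Picard"
begin

text \<open>
  Existence comes from removing the jumps of length at most \<open>\<delta>\<close>. The truncated equation is solved by
  monotone iteration. Barriers built from the exterior cones bound its solutions \<open>u\<^sub>\<delta>\<close> near the boundary
  uniformly in \<open>\<delta>\<close>, and comparing \<open>u\<^sub>\<delta>\<close> with its translates carries this modulus of continuity to the
  interior. A subsequence therefore converges to a continuous function, which satisfies the
  equation as a distribution because the truncated kernel is symmetric.

  All qualitative statements follow from one maximum principle for distributional subsolutions,
  proved by mollification. Applied to the difference of two solutions it gives uniqueness. Applied to
  \<open>x \<mapsto> u (t x) - u x\<close> with \<open>t \<ge> 1\<close>, which is a subsolution where it is positive by the scaling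
  hypothesis on \<open>f\<close>, it shows that \<open>u\<close> decreases along rays. Its strong form gives
  \<open>0 < u < 1\<close> and strict decrease along rays in the ring. Since a boundary point of
  \<open>U(\<ell>)\<close> lies in the ring and satisfies \<open>u = \<ell>\<close>, each ray contains only one.
\<close>

text \<open>With short jumps removed the kernel has finite mass, so \<open>gen \<delta>\<close> acts
  pointwise on bounded Borel functions and the iteration needs no regularity theory. The price is
  that approximants are only measurable, so suprema need not be attained, and that every estimate
  must survive \<delta> \<rightarrow> 0. Both are met by killing: from each point of
  \<open>D0\<close> the jumps into a fixed set outside \<open>D0\<close> have rate at least
  \<open>k\<close>, uniformly in \<delta>. At an almost maximal point well above the outside values
  these jumps cost more than the equation allows. The limit equation holds only against test
  functions and cannot be evaluated at a maximum of \<open>w\<close>. Tested with a bump function,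
  however, it is an equation for a mollification of \<open>w\<close> at one point, where the
  argument above applies again. Near the frontier nothing is known about \<open>f\<close> beyond its
  bounds, so the barriers there absorb a constant source; uniform continuity of \<open>f\<close> in
  \<open>x\<close> enters only on compact subsets of the ring.\<close>

section \<open>Changes of variables and integrability of power weights\<close>

lemma integral_lborel_affine:
  fixes f :: "'a::euclidean_space \<Rightarrow> real"
  assumes c: "c \<noteq> 0"
  shows "(LBINT x. f x) = \<bar>c\<bar> ^ DIM('a) * (LBINT x. f (t + c *\<^sub>R x))"
    and "integrable lborel (\<lambda>x. f (t + c *\<^sub>R x)) \<longleftrightarrow> integrable lborel f"
proof -
  have *: "integrable lborel (\<lambda>x. g (t + c *\<^sub>R x))" if g: "integrable lborel g" "c \<noteq> 0"
    for g :: "'a \<Rightarrow> real" and t c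
  proof -
    have [measurable]: "g \<in> borel_measurable borel" using g by (auto dest: borel_measurable_integrable)
    have "integrable (density (distr lborel borel (\<lambda>x. t + c *\<^sub>R x)) (\<lambda>_. \<bar>c\<bar>^DIM('a))) g"
      using g lborel_affine[of c t] by simp
    then have "integrable lborel (\<lambda>x. \<bar>c\<bar>^DIM('a) * g (t + c *\<^sub>R x))"
      by (subst (asm) integrable_density) (auto simp: integrable_distr_eq)
    then show ?thesis using g by simp
  qed
  show iff: "integrable lborel (\<lambda>x. f (t + c *\<^sub>R x)) \<longleftrightarrow> integrable lborel f"
  proof
    assume "integrable lborel (\<lambda>x. f (t + c *\<^sub>R x))"
    from *[OF this, of "inverse c" "- (inverse c *\<^sub>R t)"] c
    show "integrable lborel f" by (simp add: algebra_simps)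
  qed (use * c in auto)
  show "(LBINT x. f x) = \<bar>c\<bar> ^ DIM('a) * (LBINT x. f (t + c *\<^sub>R x))"
  proof (cases "integrable lborel f")
    case True
    then have [measurable]: "f \<in> borel_measurable borel" by (auto dest: borel_measurable_integrable)
    show ?thesis
      using c by (subst lborel_affine[of c t]) (auto simp: integral_density integral_distr)
  next
    \<comment> \<open>Both integrals are then 0 by convention, so the identity needs no
      integrability assumption and can be used as a rewriting step.\<close>
    case False
    with iff show ?thesis by (simp add: not_integrable_integral_eq)
  qed
qed

lemma integrable_mult_bounded:
  fixes g h :: "'a \<Rightarrow> real"
  assumes g: "integrable M g" and [measurable]: "h \<in> borel_measurable M" and h: "\<And>x. \<bar>h x\<bar> \<le> c"
  shows "integrable M (\<lambda>x. g x * h x)"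
proof (rule Bochner_Integration.integrable_bound[OF integrable_mult_right[OF g, of c]])
  have "0 \<le> c" using h[of undefined] by linarith
  then show "AE x in M. norm (g x * h x) \<le> norm (c * g x)"
    using h by (auto simp: abs_mult mult.commute[of c] intro!: AE_I2 mult_left_mono)
  show "(\<lambda>x. g x * h x) \<in> borel_measurable M" using g by measurable
qed

lemma bounded_compact_support:
  fixes w :: "'a::euclidean_space \<Rightarrow> real"
  assumes cont: "continuous_on UNIV w" and supp: "\<And>x. R < norm x \<Longrightarrow> w x = 0"
  obtains B where "\<And>x. \<bar>w x\<bar> \<le> B"
proof -
  have "compact (w ` cball 0 R)"
    using cont by (intro compact_continuous_image) (auto intro: continuous_on_subset)
  then obtain B where "\<forall>y\<in>w ` cball 0 R. norm y \<le> B" using compact_imp_bounded bounded_iff by blast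
  then have "\<bar>w x\<bar> \<le> max 0 B" for x using supp by (cases "norm x \<le> R") force+
  then show thesis using that by blast
qed

text \<open>The applications cut space into dyadic shells, but each shell is replaced by the whole
  ball of its outer radius. For geometric radii this costs a constant factor only, and volumes of
  balls are explicit.\<close>

lemma integrable_by_shells:
  fixes g :: "'a::euclidean_space \<Rightarrow> real" and S :: "nat \<Rightarrow> 'a set" and r :: "nat \<Rightarrow> real"
  assumes S: "\<And>y. g y \<noteq> 0 \<Longrightarrow> \<exists>k. norm y < r k \<and> g y \<le> a k"
    and a: "\<And>k. 0 \<le> a k" "\<And>k. 0 \<le> r k" and summ: "summable (\<lambda>k. a k * r k ^ DIM('a))"
    and [measurable]: "g \<in> borel_measurable borel" and g: "\<And>y. 0 \<le> g y"
  shows "integrable lborel g"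
proof (rule integrableI_nonneg)
  have "(\<integral>\<^sup>+ y. ennreal (g y) \<partial>lborel) \<le> (\<integral>\<^sup>+ y. (\<Sum>k. ennreal (a k) * indicator (ball (0::'a) (r k)) y) \<partial>lborel)"
  proof (rule nn_integral_mono)
    fix y :: 'a
    show "ennreal (g y) \<le> (\<Sum>k. ennreal (a k) * indicator (ball 0 (r k)) y)"
    proof (cases "g y = 0")
      case False
      with S obtain k where k: "norm y < r k" "g y \<le> a k" by blast
      have "ennreal (g y) \<le> ennreal (a k) * indicator (ball 0 (r k)) y"
        using k by (auto simp: ennreal_leI indicator_def)
      also have "\<dots> = (\<Sum>i\<in>{k}. ennreal (a i) * indicator (ball 0 (r i)) y)"
        by (simp only: sum.insert finite.emptyI empty_iff not_False_eq_True sum.empty add_0_right)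
      also have "\<dots> \<le> (\<Sum>k. ennreal (a k) * indicator (ball 0 (r k)) y)"
        by (rule sum_le_suminf) auto
      finally show ?thesis .
    qed simp
  qed
  also have "\<dots> = (\<Sum>k. ennreal (a k) * emeasure lborel (ball (0::'a) (r k)))"
    by (subst nn_integral_suminf, measurable) (auto simp: nn_integral_cmult_indicator)
  also have "\<dots> = (\<Sum>k. ennreal (unit_ball_vol (DIM('a)) * (a k * r k ^ DIM('a))))"
    using a by (simp add: emeasure_ball ennreal_mult'[symmetric] mult_ac)
  also have "\<dots> < \<infinity>"
    using summ a by (subst suminf_ennreal2) (auto intro!: summable_mult)
  finally show "(\<integral>\<^sup>+ y. ennreal (g y) \<partial>lborel) < \<infinity>" .
qed (use g in auto)

lemma powr_norm_eq:
  fixes y :: "'a::real_normed_vector"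
  assumes "y \<noteq> 0" shows "1 / norm y powr (real n + s) = norm y powr (- s) / norm y ^ n"
  using assms by (simp add: powr_add powr_minus powr_realpow field_simps)

text \<open>Weight times volume on the shell between radii \<delta> 2^k and \<delta> 2^(k+1) is of
  order (\<delta> 2^k)^(-s), a geometric series of ratio 2^(-s).\<close>

lemma integrable_norm_powr_outside:
  fixes s \<delta> :: real
  assumes s: "0 < s" and d: "0 < \<delta>"
  shows "integrable lborel (\<lambda>y::'a::euclidean_space.
            if \<delta> < norm y then 1 / norm y powr (real DIM('a) + s) else 0)"
proof (rule integrable_by_shells[where
      r = "\<lambda>k. \<delta> * 2 ^ (k+1)" and a = "\<lambda>k. (\<delta> * 2 ^ k) powr (- s) / (\<delta> * 2 ^ k) ^ DIM('a)"])
  fix y :: 'a assume "(if \<delta> < norm y then 1 / norm y powr (real DIM('a) + s) else 0) \<noteq> 0"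
  then have y: "\<delta> < norm y" by (auto split: if_splits)
  then have y0: "y \<noteq> 0" using d by auto
  have "\<exists>k. norm y < \<delta> * 2 ^ k"
    using real_arch_pow[of 2 "norm y / \<delta>"] d by (auto simp: field_simps)
  then obtain k where k: "norm y < \<delta> * 2 ^ k" "\<And>j. j < k \<Longrightarrow> \<not> norm y < \<delta> * 2 ^ j"
    using exists_least_iff[of "\<lambda>k. norm y < \<delta> * 2 ^ k"] by blast
  have "k \<noteq> 0" using k y by (metis less_asym mult.right_neutral power_0)
  then obtain j where j: "k = Suc j" by (cases k) auto
  with k have le: "\<delta> * 2 ^ j \<le> norm y" by force
  have pos: "0 < \<delta> * 2 ^ j" using d by simp
  have "norm y powr (- s) / norm y ^ DIM('a) \<le> (\<delta> * 2 ^ j) powr (- s) / (\<delta> * 2 ^ j) ^ DIM('a)"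
    using le pos s y0 by (intro frac_le powr_mono2' power_mono zero_less_power) auto
  then show "\<exists>k. norm y < \<delta> * 2 ^ (k+1) \<and> (if \<delta> < norm y then 1 / norm y powr (real DIM('a) + s) else 0)
           \<le> (\<delta> * 2 ^ k) powr (- s) / (\<delta> * 2 ^ k) ^ DIM('a)"
    using k j y powr_norm_eq[OF y0] by (intro exI[of _ j]) auto
next
  have eq: "(\<delta> * 2 ^ k) powr (- s) / (\<delta> * 2 ^ k) ^ DIM('a) * (\<delta> * 2 ^ (k+1)) ^ DIM('a)
      = \<delta> powr (- s) * 2 ^ DIM('a) * (2 powr (- s)) ^ k" for k
    using d by (simp add: powr_mult power_mult_distrib powr_power powr_realpow[symmetric] powr_powr
        mult.commute field_simps)
  show "summable (\<lambda>k. (\<delta> * 2 ^ k) powr (- s) / (\<delta> * 2 ^ k) ^ DIM('a) * (\<delta> * 2 ^ (k+1)) ^ DIM('a))"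
    unfolding eq using s by (intro summable_mult summable_geometric) (auto simp: powr_less_one)
qed (use d in auto)

text \<open>On each shell the numerator is bounded at the outer radius and the denominator at the
  inner one, which is why two different powers of 2 occur. The loss is the factor
  \<open>2 ^ DIM('a)\<close>; the ratio remains 2^(-s).\<close>

lemma integrable_norm_powr_inside:
  fixes s :: real
  assumes s: "0 < s"
  shows "integrable lborel (\<lambda>y::'a::euclidean_space.
            if norm y < 1 then norm y powr s / norm y ^ DIM('a) else 0)"
proof (rule integrable_by_shells[where
      r = "\<lambda>k. 1 / 2 ^ k" and a = "\<lambda>k. (1 / 2 ^ k) powr s / (1 / 2 ^ (k+1)) ^ DIM('a)"])
  fix y :: 'a assume "(if norm y < 1 then norm y powr s / norm y ^ DIM('a) else 0) \<noteq> 0"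
  then have y: "norm y < 1" "y \<noteq> 0" by (auto split: if_splits)
  have "\<exists>k. 1 / 2 ^ k \<le> norm y"
  proof -
    obtain k where "1 / norm y < 2 ^ k" using real_arch_pow[of 2 "1 / norm y"] by auto
    then show ?thesis using y by (intro exI[of _ k]) (auto simp: field_simps)
  qed
  then obtain k where k: "1 / 2 ^ k \<le> norm y" "\<And>j. j < k \<Longrightarrow> \<not> 1 / 2 ^ j \<le> norm y"
    using exists_least_iff[of "\<lambda>k. 1 / 2 ^ k \<le> norm y"] by blast
  have "k \<noteq> 0" using k y by (cases k) auto
  then obtain j where j: "k = Suc j" by (cases k) auto
  with k have le: "norm y < 1 / 2 ^ j" by force
  have "norm y powr s / norm y ^ DIM('a) \<le> (1 / 2 ^ j) powr s / (1 / 2 ^ (j+1)) ^ DIM('a)"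
    using le k j s y by (intro frac_le powr_mono2 power_mono zero_less_power) auto
  then show "\<exists>k. norm y < 1 / 2 ^ k \<and> (if norm y < 1 then norm y powr s / norm y ^ DIM('a) else 0)
           \<le> (1 / 2 ^ k) powr s / (1 / 2 ^ (k+1)) ^ DIM('a)"
    using le y by (intro exI[of _ j]) auto
next
  have eq: "(1 / 2 ^ k) powr s / (1 / 2 ^ (k+1)) ^ DIM('a) * (1 / 2 ^ k) ^ DIM('a)
      = 2 ^ DIM('a) * (2 powr (- s)) ^ k" for k
    by (simp add: powr_divide power_mult_distrib powr_power powr_realpow[symmetric] powr_powr
        powr_minus power_divide mult.commute field_simps)
  show "summable (\<lambda>k. (1 / 2 ^ k) powr s / (1 / 2 ^ (k+1)) ^ DIM('a) * (1 / 2 ^ k) ^ DIM('a))"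
    unfolding eq using s by (intro summable_mult summable_geometric) (auto simp: powr_less_one)
qed auto

section \<open>The truncated generator\<close>

lemma lborel_reflect:
  fixes f :: "'a::euclidean_space \<Rightarrow> real"
  shows "(LBINT y. f (- y)) = (LBINT y. f y)"
    and "integrable lborel (\<lambda>y. f (- y)) \<longleftrightarrow> integrable lborel f"
  using integral_lborel_affine[of "-1" f 0] by simp_all

lemma lborel_shift:
  fixes f :: "'a::euclidean_space \<Rightarrow> real"
  shows "(LBINT y. f (t + y)) = (LBINT y. f y)"
    and "integrable lborel (\<lambda>y. f (t + y)) \<longleftrightarrow> integrable lborel f"
  using integral_lborel_affine[of 1 f t] by simp_all

locale fractional =
  fixes \<alpha> :: real
  assumes alpha_pos: "0 < \<alpha>" and alpha_less: "\<alpha> < 2"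
begin

text \<open>For \<delta> = 0 this is the full jump density of the fractional Laplacian, set to 0 at
  the origin. It is not integrable there and is therefore used against functions of order
  |y|^2.\<close>

definition kern :: "real \<Rightarrow> 'a::euclidean_space \<Rightarrow> real" where
  "kern \<delta> y = (if \<delta> < norm y
     then frac_const (real DIM('a)) \<alpha> / norm y powr (real DIM('a) + \<alpha>) else 0)"

text \<open>The sign is that of \<open>-(-\<Delta>)\<^bsup>\<alpha>/2\<^esup>\<close>, so subsolutions satisfy \<open>gen \<delta> u \<ge> \<dots>\<close>.\<close>

definition gen :: "real \<Rightarrow> ('a::euclidean_space \<Rightarrow> real) \<Rightarrow> 'a \<Rightarrow> real" where
  "gen \<delta> u x = (LBINT y. kern \<delta> y * (u (x + y) - u x))"

lemma kern_measurable[measurable]: "kern \<delta> \<in> borel_measurable borel"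
  unfolding kern_def by measurable

lemma kern_minus[simp]: "kern \<delta> (- y) = kern \<delta> y"
  by (simp add: kern_def)

lemma frac_const_pos: "0 \<le> n \<Longrightarrow> 0 < frac_const n \<alpha>"
  using alpha_pos alpha_less unfolding frac_const_def by (auto intro!: mult_pos_pos divide_pos_pos Gamma_real_pos)

lemma kern_nonneg[simp]: "0 \<le> kern \<delta> y"
  using frac_const_pos[of "real DIM('a)"] by (auto simp: kern_def)

lemma kern_antimono: "\<delta> \<le> \<delta>' \<Longrightarrow> kern \<delta>' y \<le> kern \<delta> y"
  using kern_nonneg[of \<delta> y] by (auto simp: kern_def)

lemma kern_integrable:
  assumes "0 < \<delta>" shows "integrable lborel (kern \<delta> :: 'a::euclidean_space \<Rightarrow> real)"
proof -
  have "integrable lborel (\<lambda>y::'a. frac_const (real DIM('a)) \<alpha> *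
            (if \<delta> < norm y then 1 / norm y powr (real DIM('a) + \<alpha>) else 0))"
    using assms alpha_pos by (intro integrable_mult_right integrable_norm_powr_outside)
  moreover have "(\<lambda>y::'a. frac_const (real DIM('a)) \<alpha> *
            (if \<delta> < norm y then 1 / norm y powr (real DIM('a) + \<alpha>) else 0)) = kern \<delta>"
    by (auto simp: kern_def fun_eq_iff)
  ultimately show ?thesis by simp
qed

text \<open>Quadratic vanishing at the origin compensates the singularity because \<alpha> < 2, and
  growth of order \<beta> < \<alpha> is compensated by the decay at infinity.\<close>

lemma kern_growth_integrable:
  fixes h :: "'a::euclidean_space \<Rightarrow> real"
  assumes [measurable]: "h \<in> borel_measurable borel" and h: "\<And>y. 0 \<le> h y"
    and h1: "\<And>y. norm y < 1 \<Longrightarrow> h y \<le> A * (norm y)\<^sup>2"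
    and h2: "\<And>y. 1 \<le> norm y \<Longrightarrow> h y \<le> B * norm y powr \<beta>" and \<beta>: "\<beta> < \<alpha>"
  shows "integrable lborel (\<lambda>y. h y * kern 0 y)"
proof -
  define n where "n = DIM('a)"
  define c where "c = frac_const (real n) \<alpha>"
  have c: "0 < c" unfolding c_def by (rule frac_const_pos) simp
  let ?g1 = "\<lambda>y::'a. A * c * (if norm y < 1 then norm y powr (2 - \<alpha>) / norm y ^ n else 0)"
  \<comment> \<open>The sphere \<open>norm y = 1\<close> belongs to the outer regime, while the
    integrability lemma cuts strictly; the threshold 1/2 leaves room.\<close>
  let ?g2 = "\<lambda>y::'a. B * c * (if 1/2 < norm y then 1 / norm y powr (real n + (\<alpha> - \<beta>)) else 0)"
  \<comment> \<open>No sign of \<open>A\<close> is assumed; it is forced by \<open>0 \<le> h\<close>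
    as soon as some relevant \<open>y\<close> exists.\<close>
  have A1: "0 \<le> ?g1 y" for y
  proof (cases "norm y < 1 \<and> y \<noteq> 0")
    case True
    then have "0 \<le> A * (norm y)\<^sup>2" using h[of y] h1[of y] by linarith
    then have "0 \<le> A" using True by (simp add: zero_le_mult_iff)
    then show ?thesis using c by auto
  qed auto
  obtain b :: 'a where b: "b \<in> Basis" using nonempty_Basis by blast
  have "0 \<le> B" using h[of b] h2[of b] b by auto
  then have B1: "0 \<le> ?g2 y" for y using c by auto
  have "integrable lborel (\<lambda>y. ?g1 y + ?g2 y)"
    using alpha_less \<beta> unfolding n_def
    by (intro Bochner_Integration.integrable_add integrable_mult_right integrable_norm_powr_inside
        integrable_norm_powr_outside) auto
  moreover have "(\<lambda>y. h y * kern 0 y) \<in> borel_measurable lborel" by measurable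
  moreover have "AE y in lborel. norm (h y * kern 0 y) \<le> norm (?g1 y + ?g2 y)"
  proof (rule AE_I2)
    fix y :: 'a
    have "h y * kern 0 y \<le> ?g1 y + ?g2 y"
    proof (cases "y = 0")
      case True then show ?thesis using A1[of y] B1[of y] by (simp add: kern_def)
    next
      case y0: False
      have k: "kern 0 y = c * (norm y powr (- \<alpha>) / norm y ^ n)"
        unfolding powr_norm_eq[OF y0, of n \<alpha>, symmetric] using y0 by (simp add: kern_def c_def n_def)
      show ?thesis
      proof (cases "norm y < 1")
        case True
        have e: "(norm y)\<^sup>2 * norm y powr (- \<alpha>) = norm y powr (2 - \<alpha>)"
          using y0 by (simp add: powr_diff powr_minus powr_realpow field_simps)
        have "h y * kern 0 y \<le> (A * (norm y)\<^sup>2) * kern 0 y"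
          using h1[OF True] by (intro mult_right_mono) auto
        also have "\<dots> = A * c * ((norm y)\<^sup>2 * norm y powr (- \<alpha>)) / norm y ^ n"
          unfolding k by simp
        also have "\<dots> = ?g1 y" unfolding e using True by simp
        finally show ?thesis using B1[of y] by simp
      next
        case False
        have "h y * kern 0 y \<le> (B * norm y powr \<beta>) * kern 0 y"
          using h2[of y] False by (intro mult_right_mono) auto
        also have "\<dots> = B * c * (norm y powr (- (\<alpha> - \<beta>)) / norm y ^ n)"
          unfolding k by (simp add: powr_add[symmetric])
        also have "\<dots> = ?g2 y" using False powr_norm_eq[OF y0, of n "\<alpha> - \<beta>"] by simp
        finally show ?thesis using A1[of y] by simp
      qed
    qed
    then show "norm (h y * kern 0 y) \<le> norm (?g1 y + ?g2 y)"
      using h[of y] A1[of y] B1[of y] by (simp add: abs_mult)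
  qed
  ultimately show ?thesis by (rule Bochner_Integration.integrable_bound)
qed

lemma kern_min_sq_integrable:
  "integrable lborel (\<lambda>y::'a::euclidean_space. min 1 ((norm y)\<^sup>2) * kern 0 y)"
  using alpha_pos by (intro kern_growth_integrable[where A=1 and B=1 and \<beta>=0]) auto

lemma kern_mult_integrable:
  fixes u :: "'a::euclidean_space \<Rightarrow> real"
  assumes "0 < \<delta>" and [measurable]: "u \<in> borel_measurable borel" and u: "\<And>x. \<bar>u x\<bar> \<le> B"
  shows "integrable lborel (\<lambda>y. kern \<delta> y * u y)"
  by (rule integrable_mult_bounded[OF kern_integrable[OF assms(1)] _ u]) measurable

context
  fixes u :: "'a::euclidean_space \<Rightarrow> real" and \<delta> B :: real
  assumes \<delta>: "0 < \<delta>" and um[measurable]: "u \<in> borel_measurable borel" and ub: "\<And>x. \<bar>u x\<bar> \<le> B"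
begin

lemma kern_shift_integrable: "integrable lborel (\<lambda>y. kern \<delta> y * u (x + y))"
  by (rule kern_mult_integrable[where B=B]) (use \<delta> ub in auto)

lemma gen_integrable: "integrable lborel (\<lambda>y. kern \<delta> y * (u (x + y) - u x))"
  using kern_shift_integrable[of x] kern_integrable[OF \<delta>, where 'a='a] by (simp add: right_diff_distrib)

lemma gen_eq: "gen \<delta> u x = (LBINT y. kern \<delta> y * u (x + y)) - u x * (LBINT y. kern \<delta> (y::'a))"
  using kern_shift_integrable[of x] kern_integrable[OF \<delta>, where 'a='a] unfolding gen_def
  by (simp add: right_diff_distrib mult.commute)

lemma gen_measurable[measurable]: "gen \<delta> u \<in> borel_measurable borel"
proof -
  have "(\<lambda>x. LBINT y. kern \<delta> y * (u (x + y) - u x)) \<in> borel_measurable borel"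
    by (rule lborel.borel_measurable_lebesgue_integral) measurable
  then show ?thesis by (simp add: gen_def[abs_def])
qed

lemma gen_bound: "\<bar>gen \<delta> u x\<bar> \<le> 2 * B * (LBINT y. kern \<delta> (y::'a))"
proof -
  have "\<bar>gen \<delta> u x\<bar> \<le> (LBINT y. norm (kern \<delta> y * (u (x + y) - u x)))"
    unfolding gen_def using integral_norm_bound[of lborel "\<lambda>y. kern \<delta> y * (u (x + y) - u x)"] by simp
  also have "\<dots> \<le> (LBINT y. 2 * B * kern \<delta> (y::'a))"
  proof (rule integral_mono)
    fix y show "norm (kern \<delta> y * (u (x + y) - u x)) \<le> 2 * B * kern \<delta> y"
      using ub[of "x+y"] ub[of x] mult_left_mono[of "\<bar>u (x + y) - u x\<bar>" "2 * B" "kern \<delta> y"]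
      by (simp add: abs_mult mult.commute)
  qed (use gen_integrable kern_integrable[OF \<delta>, where 'a='a] in auto)
  finally show ?thesis by simp
qed

text \<open>Averaging the integrand with its reflection uses that \<open>kern \<delta>\<close> is
  even. In this form the integrand is of order |y|^2 near 0 for smooth functions, so \<delta> can be
  sent to 0.\<close>

lemma gen_second_difference:
  "integrable lborel (\<lambda>y. kern \<delta> y * (u (x + y) + u (x - y) - 2 * u x))"
  "gen \<delta> u x = (LBINT y. kern \<delta> y * (u (x + y) + u (x - y) - 2 * u x)) / 2"
proof -
  have r: "integrable lborel (\<lambda>y. kern \<delta> y * (u (x - y) - u x))"
    "(LBINT y. kern \<delta> y * (u (x - y) - u x)) = gen \<delta> u x"
    using lborel_reflect[of "\<lambda>y. kern \<delta> y * (u (x + y) - u x)"] gen_integrable[of x]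
    by (simp_all add: gen_def)
  have e: "kern \<delta> y * (u (x + y) + u (x - y) - 2 * u x) =
      kern \<delta> y * (u (x + y) - u x) + kern \<delta> y * (u (x - y) - u x)" for y
    by (simp add: algebra_simps)
  show "integrable lborel (\<lambda>y. kern \<delta> y * (u (x + y) + u (x - y) - 2 * u x))"
    unfolding e using r(1) gen_integrable[of x] by simp
  show "gen \<delta> u x = (LBINT y. kern \<delta> y * (u (x + y) + u (x - y) - 2 * u x)) / 2"
    unfolding e using r gen_integrable[of x]
    by (subst Bochner_Integration.integral_add) (auto simp: gen_def)
qed

context
  fixes \<phi> :: "'a \<Rightarrow> real"
  assumes phi: "integrable lborel \<phi>"
begin

lemma prod_integrable:
  assumes [measurable]: "h \<in> borel_measurable (borel \<Otimes>\<^sub>M borel)" and h: "\<And>p. \<bar>h p\<bar> \<le> B'"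
  shows "integrable (lborel \<Otimes>\<^sub>M lborel) (\<lambda>(x::'a, y::'a). \<phi> x * kern \<delta> y * h (x, y))"
proof -
  have [measurable]: "\<phi> \<in> borel_measurable borel" using phi by (auto dest: borel_measurable_integrable)
  have i1: "integrable (lborel \<Otimes>\<^sub>M lborel) (\<lambda>(x::'a, y::'a). \<phi> x * kern \<delta> y)"
  proof (rule lborel_pair.Fubini_integrable)
    show "integrable lborel (\<lambda>x. LBINT y. norm (case (x, y) of (x, y) \<Rightarrow> \<phi> x * kern \<delta> (y::'a)))"
      using phi by (simp add: abs_mult)
    show "AE x in lborel. integrable lborel (\<lambda>y. case (x, y) of (x, y) \<Rightarrow> \<phi> x * kern \<delta> (y::'a))"
      using kern_integrable[OF \<delta>, where 'a='a] by auto
  qed measurable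
  have "integrable (lborel \<Otimes>\<^sub>M lborel) (\<lambda>p. (case p of (x::'a, y::'a) \<Rightarrow> \<phi> x * kern \<delta> y) * h p)"
    by (rule integrable_mult_bounded[OF i1 _ h]) measurable
  then show ?thesis by (simp add: split_beta')
qed

text \<open>Testing the generator against \<phi> gives the generator, at \<open>y = 0\<close>, of
  the averaged function that maps \<open>y\<close> to the integral of
  \<open>\<phi> x * u (x + y)\<close>. This passage from a weak to a pointwise statement drives the
  maximum principle.\<close>

lemma gen_Fubini:
  shows "(LBINT x. \<phi> x * gen \<delta> u x) =
      (LBINT y. kern \<delta> y * ((LBINT x. \<phi> x * u (x + y)) - (LBINT x. \<phi> x * u x)))"
    and "integrable lborel (\<lambda>y. kern \<delta> y * ((LBINT x. \<phi> x * u (x + y)) - (LBINT x. \<phi> x * u x)))"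
proof -
  have [measurable]: "\<phi> \<in> borel_measurable borel" using phi by (auto dest: borel_measurable_integrable)
  let ?h = "\<lambda>(x, y). u (x + y) - u x"
  have "integrable (lborel \<Otimes>\<^sub>M lborel) (\<lambda>(x, y). \<phi> x * kern \<delta> y * ?h (x, y))"
  proof (rule prod_integrable)
    fix p :: "'a \<times> 'a" show "\<bar>?h p\<bar> \<le> 2 * B"
      using ub[of "fst p + snd p"] ub[of "fst p"] by (auto simp: split_beta)
  qed measurable
  then have I: "integrable (lborel \<Otimes>\<^sub>M lborel) (\<lambda>(x, y). \<phi> x * kern \<delta> y * (u (x + y) - u x))"
    by simp
  have int: "integrable lborel (\<lambda>x. \<phi> x * u (x + y))" for y
    by (rule integrable_mult_bounded[OF phi _ ub]) measurable
  have e: "(LBINT x. \<phi> x * kern \<delta> y * (u (x + y) - u x)) =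
      kern \<delta> y * ((LBINT x. \<phi> x * u (x + y)) - (LBINT x. \<phi> x * u x))" for y
  proof -
    have "(LBINT x. \<phi> x * kern \<delta> y * (u (x + y) - u x)) =
       (LBINT x. kern \<delta> y * (\<phi> x * u (x + y) - \<phi> x * u x))"
      by (intro Bochner_Integration.integral_cong) (auto simp: algebra_simps)
    also have "\<dots> = kern \<delta> y * (LBINT x. \<phi> x * u (x + y) - \<phi> x * u x)" by simp
    finally show ?thesis using int[of y] int[of 0] by simp
  qed
  have "(LBINT x. \<phi> x * gen \<delta> u x) =
     (LBINT x. LBINT y. \<phi> x * kern \<delta> y * (u (x + y) - u x))"
    unfolding gen_def integral_mult_right_zero[symmetric] by (simp only: mult.assoc)
  also have "\<dots> = (LBINT y. LBINT x. \<phi> x * kern \<delta> y * (u (x + y) - u x))"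
    by (rule lborel_pair.Fubini_integral[symmetric, OF I])
  also have "\<dots> = (LBINT y. kern \<delta> y * ((LBINT x. \<phi> x * u (x + y)) - (LBINT x. \<phi> x * u x)))"
    by (simp only: e)
  finally show "(LBINT x. \<phi> x * gen \<delta> u x) =
      (LBINT y. kern \<delta> y * ((LBINT x. \<phi> x * u (x + y)) - (LBINT x. \<phi> x * u x)))" .
  show "integrable lborel (\<lambda>y. kern \<delta> y * ((LBINT x. \<phi> x * u (x + y)) - (LBINT x. \<phi> x * u x)))"
    using lborel_pair.integrable_snd[OF I] by (simp only: e)
qed

end

text \<open>Symmetry of the truncated generator. As \<open>u\<close> is only bounded, integrability
  comes from \<phi>: the jump part is written as a double integral, translated in \<open>x\<close>,
  reflected in \<open>y\<close>, and the multiplication part is symmetric by itself.\<close>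

lemma gen_dual:
  assumes phi: "integrable lborel \<phi>" and phib: "\<And>x. \<bar>\<phi> x\<bar> \<le> B'"
  shows "(LBINT x. \<phi> x * gen \<delta> u x) = (LBINT x. u x * gen \<delta> \<phi> x)"
proof -
  have [measurable]: "\<phi> \<in> borel_measurable borel" using phi by (auto dest: borel_measurable_integrable)
  have r: "gen \<delta> \<phi> x = (LBINT y. kern \<delta> y * \<phi> (x + y)) - \<phi> x * (LBINT y. kern \<delta> (y::'a))" for x
    using kern_mult_integrable[of \<delta> "\<lambda>y. \<phi> (x + y)" B'] \<delta> phib kern_integrable[OF \<delta>, where 'a='a]
    unfolding gen_def by (simp add: right_diff_distrib mult.commute)
  let ?K = "LBINT y. kern \<delta> (y::'a)"
  have um': "u \<in> borel_measurable lborel" by simp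
  let ?P = "\<lambda>(x, y). \<phi> x * kern \<delta> y * u (x + y)"
  have I: "integrable (lborel \<Otimes>\<^sub>M lborel) ?P"
    using prod_integrable[OF phi, of "\<lambda>(x, y). u (x + y)" B] ub by (auto simp: split_beta)
  have Pe: "(LBINT y. \<phi> x * kern \<delta> y * u (x + y)) = \<phi> x * (LBINT y. kern \<delta> y * u (x + y))" for x
    by (simp add: mult.assoc)
  have A1: "integrable lborel (\<lambda>x. \<phi> x * (LBINT y. kern \<delta> y * u (x + y)))"
    using lborel_pair.integrable_fst[OF I] by (simp only: Pe prod.case)
  have A2: "integrable lborel (\<lambda>x. \<phi> x * u x)" by (rule integrable_mult_bounded[OF phi um' ub])
  have S: "(LBINT x. \<phi> x * kern \<delta> y * u (x + y)) = (LBINT x. \<phi> (x - y) * kern \<delta> y * u x)" for y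
    using lborel_shift(1)[of "\<lambda>x. \<phi> (x - y) * kern \<delta> y * u x" y] by (simp add: add.commute)
  let ?Q = "\<lambda>(x, y). \<phi> (x - y) * kern \<delta> y * u x"
  \<comment> \<open>Integrating in \<open>x\<close> first is essential: for fixed \<open>y\<close>
    the translate of \<phi> keeps its norm, which leaves a constant multiple of
    \<open>kern \<delta> y\<close>.\<close>
  have IQ: "integrable (lborel \<Otimes>\<^sub>M lborel) ?Q"
  proof -
    have ia: "integrable lborel (\<lambda>x. \<phi> (x - y))" for y
      using phi lborel_shift(2)[of \<phi> "-y"] by simp
    have "integrable (lborel \<Otimes>\<^sub>M lborel) (\<lambda>(y, x). ?Q (x, y))"
    proof (rule lborel_pair.Fubini_integrable)
      show "AE y in lborel. integrable lborel (\<lambda>x. case (y, x) of (y, x) \<Rightarrow> ?Q (x, y))"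
        using integrable_mult_bounded[OF integrable_mult_left[OF ia] um' ub] by auto
      let ?N = "LBINT x. \<bar>\<phi> x\<bar>"
      show "integrable lborel (\<lambda>y. LBINT x. norm (case (y, x) of (y, x) \<Rightarrow> ?Q (x, y)))"
      proof (rule Bochner_Integration.integrable_bound[OF integrable_mult_right[OF kern_integrable[OF \<delta>], of "?N * B"]])
        show "(\<lambda>y. LBINT x. norm (case (y, x) of (y, x) \<Rightarrow> ?Q (x, y))) \<in> borel_measurable lborel"
          by measurable
        have "(LBINT x. \<bar>\<phi> (x - y) * kern \<delta> y * u x\<bar>) \<le> ?N * B * kern \<delta> y" for y
        proof -
          have "(LBINT x. \<bar>\<phi> (x - y) * kern \<delta> y * u x\<bar>) \<le> (LBINT x. \<bar>\<phi> (x - y)\<bar> * (B * kern \<delta> y))"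
          proof (rule integral_mono)
            show "integrable lborel (\<lambda>x. \<bar>\<phi> (x - y) * kern \<delta> y * u x\<bar>)"
              using integrable_mult_bounded[OF integrable_mult_left[OF ia] um' ub] by auto
            show "integrable lborel (\<lambda>x. \<bar>\<phi> (x - y)\<bar> * (B * kern \<delta> y))" using ia[of y] by auto
            fix x show "\<bar>\<phi> (x - y) * kern \<delta> y * u x\<bar> \<le> \<bar>\<phi> (x - y)\<bar> * (B * kern \<delta> y)"
              using mult_left_mono[OF ub[of x], of "\<bar>\<phi> (x - y)\<bar> * kern \<delta> y"] by (simp add: abs_mult mult_ac)
          qed
          also have "\<dots> = ?N * (B * kern \<delta> y)"
            using lborel_shift(1)[of "\<lambda>x. \<bar>\<phi> x\<bar>" "-y"] by simp
          finally show ?thesis by (simp add: mult_ac)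
        qed
        then show "AE y in lborel. norm (LBINT x. norm (case (y, x) of (y, x) \<Rightarrow> ?Q (x, y))) \<le> norm (?N * B * kern \<delta> y)"
          by (auto intro!: AE_I2 order_trans[OF _ abs_ge_self])
      qed
    qed measurable
    then show ?thesis using lborel_pair.integrable_product_swap_iff[of ?Q] by simp
  qed
  have Qe: "(LBINT y. \<phi> (x - y) * kern \<delta> y * u x) = u x * (LBINT y. kern \<delta> y * \<phi> (x + y))" for x
  proof -
    have "(LBINT y. \<phi> (x - y) * kern \<delta> y * u x) = (LBINT y. u x * (kern \<delta> y * \<phi> (x - y)))"
      by (intro Bochner_Integration.integral_cong) auto
    also have "\<dots> = u x * (LBINT y. kern \<delta> y * \<phi> (x + y))"
      using lborel_reflect(1)[of "\<lambda>y. kern \<delta> y * \<phi> (x + y)"] by simp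
    finally show ?thesis .
  qed
  have A3: "integrable lborel (\<lambda>x. u x * (LBINT y. kern \<delta> y * \<phi> (x + y)))"
    using lborel_pair.integrable_fst[OF IQ] by (simp only: Qe prod.case)
  have "(LBINT x. \<phi> x * gen \<delta> u x) = (LBINT x. \<phi> x * (LBINT y. kern \<delta> y * u (x + y)) - \<phi> x * u x * ?K)"
    by (simp only: gen_eq right_diff_distrib mult.assoc)
  also have "\<dots> = (LBINT x. \<phi> x * (LBINT y. kern \<delta> y * u (x + y))) - (LBINT x. \<phi> x * u x) * ?K"
    using A1 A2 by simp
  also have "(LBINT x. \<phi> x * (LBINT y. kern \<delta> y * u (x + y))) = (LBINT x. LBINT y. ?P (x, y))"
    by (simp only: Pe prod.case)
  also have "\<dots> = (LBINT y. LBINT x. ?P (x, y))"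
    using lborel_pair.Fubini_integral[of "\<lambda>x y. ?P (x, y)"] I by simp
  also have "\<dots> = (LBINT y. LBINT x. ?Q (x, y))" by (simp add: S)
  also have "\<dots> = (LBINT x. LBINT y. ?Q (x, y))"
    using lborel_pair.Fubini_integral[of "\<lambda>x y. ?Q (x, y)"] IQ by simp
  also have "\<dots> = (LBINT x. u x * (LBINT y. kern \<delta> y * \<phi> (x + y)))" by (simp only: Qe prod.case)
  also have "\<dots> - (LBINT x. \<phi> x * u x) * ?K =
     (LBINT x. u x * (LBINT y. kern \<delta> y * \<phi> (x + y)) - \<phi> x * u x * ?K)"
    using A3 A2 by simp
  also have "\<dots> = (LBINT x. u x * gen \<delta> \<phi> x)"
    by (intro Bochner_Integration.integral_cong) (auto simp: r algebra_simps)
  finally show ?thesis .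
qed

end

end

section \<open>Comparison and barriers for the truncated generator\<close>

context fractional
begin

lemma kern_ball_lower:
  fixes x p :: "'a::euclidean_space"
  assumes \<delta>: "0 < \<delta>" and r: "0 \<le> r" and R: "0 < R"
    and ball: "\<And>z. z \<in> ball p r \<Longrightarrow> \<delta> < norm (z - x) \<and> norm (z - x) \<le> R"
  shows "frac_const (real DIM('a)) \<alpha> / R powr (real DIM('a) + \<alpha>) * (unit_ball_vol (DIM('a)) * r ^ DIM('a))
     \<le> (LBINT y. kern \<delta> y * indicator (ball p r) (x + y))"
proof -
  let ?c = "frac_const (real DIM('a)) \<alpha> / R powr (real DIM('a) + \<alpha>)"
  have c: "0 < frac_const (real DIM('a)) \<alpha>" by (rule frac_const_pos) simp
  have "?c * (unit_ball_vol (DIM('a)) * r ^ DIM('a)) = (LBINT y. ?c * indicator (ball p r) (x + y))"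
    using r lborel_shift(1)[of "indicator (ball p r) :: 'a \<Rightarrow> real" x] by (simp add: content_ball)
  also have "\<dots> \<le> (LBINT y. kern \<delta> y * indicator (ball p r) (x + y))"
  proof (rule integral_mono)
    show "integrable lborel (\<lambda>y. ?c * indicator (ball p r) (x + y))"
      using r lborel_shift(2)[where t=x and f="indicator (ball p r) :: 'a \<Rightarrow> real"]
      by (intro integrable_mult_right) (simp add: emeasure_ball)
    show "integrable lborel (\<lambda>y. kern \<delta> y * indicator (ball p r) (x + y))"
      by (rule kern_shift_integrable[where B=1]) (use \<delta> in \<open>auto simp: indicator_def\<close>)
    fix y
    show "?c * indicator (ball p r) (x + y) \<le> kern \<delta> y * indicator (ball p r) (x + y)"
    proof (cases "x + y \<in> ball p r")
      case True
      then have y: "\<delta> < norm y" "norm y \<le> R" using ball[of "x + y"] by auto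
      then have "?c \<le> frac_const (real DIM('a)) \<alpha> / norm y powr (real DIM('a) + \<alpha>)"
        using c \<delta> alpha_pos by (intro divide_left_mono powr_mono2 mult_pos_pos) auto
      with True y show ?thesis by (simp add: kern_def)
    qed auto
  qed
  finally show ?thesis .
qed

text \<open>One \<open>k\<close> serves all truncations below \<delta>, because \<open>S\<close>
  lies beyond jump length \<delta> from \<open>G\<close> and so is never cut off. This uniformity
  lets the comparison estimates survive \<delta> \<rightarrow> 0.\<close>

lemma kern_set_lower:
  fixes S :: "'a::euclidean_space set"
  assumes \<delta>: "0 < \<delta>" and S: "open S" "S \<noteq> {}" and R: "\<And>z x. z \<in> S \<Longrightarrow> x \<in> G \<Longrightarrow> \<delta> < norm (z - x)"
    and bd: "bounded S" "bounded G"
  obtains k where "0 < k" "\<And>x \<delta>'. x \<in> G \<Longrightarrow> 0 < \<delta>' \<Longrightarrow> \<delta>' \<le> \<delta> \<Longrightarrow> k \<le> (LBINT y. kern \<delta>' y * indicator S (x + y))"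
proof -
  obtain p where "p \<in> S" using S by blast
  then obtain r where r: "0 < r" "ball p r \<subseteq> S" using S(1) open_contains_ball by blast
  obtain R1 R2 where R12: "\<forall>z\<in>S. norm z \<le> R1" "\<forall>x\<in>G. norm x \<le> R2" using bd unfolding bounded_iff by blast
  let ?R = "max 1 (R1 + R2)"
  let ?k = "frac_const (real DIM('a)) \<alpha> / ?R powr (real DIM('a) + \<alpha>) * (unit_ball_vol (DIM('a)) * r ^ DIM('a))"
  have "0 < ?k" using r frac_const_pos[of "real DIM('a)"] by (intro mult_pos_pos divide_pos_pos) auto
  moreover have "?k \<le> (LBINT y. kern \<delta>' y * indicator S (x + y))"
    if "x \<in> G" "0 < \<delta>'" "\<delta>' \<le> \<delta>" for x \<delta>'
  proof -
    have "?k \<le> (LBINT y. kern \<delta>' y * indicator (ball p r) (x + y))"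
    proof (rule kern_ball_lower)
      fix z assume "z \<in> ball p r"
      then have z: "z \<in> S" using r by auto
      have "norm (z - x) \<le> norm z + norm x" by (rule norm_triangle_ineq4)
      then show "\<delta>' < norm (z - x) \<and> norm (z - x) \<le> ?R" using R12 z R[OF z that(1)] that by force
    qed (use that r in auto)
    also have "\<dots> \<le> (LBINT y. kern \<delta>' y * indicator S (x + y))"
    proof (rule integral_mono)
      have [measurable]: "S \<in> sets borel" using S by simp
      show "integrable lborel (\<lambda>y. kern \<delta>' y * indicator (ball p r) (x + y))"
        by (rule kern_shift_integrable[where B=1]) (use that in \<open>auto simp: indicator_def\<close>)
      show "integrable lborel (\<lambda>y. kern \<delta>' y * indicator S (x + y))"
        by (rule kern_shift_integrable[where B=1]) (use that in \<open>auto split: split_indicator\<close>)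
    qed (use r in \<open>auto intro!: mult_left_mono simp: indicator_def\<close>)
    finally show ?thesis .
  qed
  ultimately show thesis using that by blast
qed

text \<open>At a point where \<open>w\<close> is within \<eta> of its supremum, jumps raise the
  generator by at most \<eta> times the mass of the kernel, while jumps into \<open>S\<close>, where
  \<open>w \<le> m0\<close>, lower it by at least \<open>(w x - m0) * k\<close>. Balancing this
  against \<open>- e\<close> gives the additive error \<open>e / k\<close>.\<close>

lemma comparison:
  fixes w :: "'a::euclidean_space \<Rightarrow> real"
  assumes \<delta>: "0 < \<delta>" and [measurable]: "w \<in> borel_measurable borel" and wb: "\<And>x. \<bar>w x\<bar> \<le> B"
    and out: "\<And>x. x \<notin> G \<Longrightarrow> w x \<le> m0"
    and ineq: "\<And>x. x \<in> G \<Longrightarrow> m0 < w x \<Longrightarrow> - e \<le> gen \<delta> w x"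
    and S: "S \<in> sets borel" "S \<inter> G = {}"
    and k: "0 < k" "\<And>x. x \<in> G \<Longrightarrow> k \<le> (LBINT y. kern \<delta> y * indicator S (x + y))" and e: "0 \<le> e"
  shows "w x \<le> m0 + e / k"
proof -
  define M where "M = Sup (range w)"
  have bdd: "bdd_above (range w)" using wb by (auto intro!: bdd_aboveI[of _ B] simp: abs_le_iff)
  have wM: "w x \<le> M" for x unfolding M_def using bdd by (auto intro: cSup_upper)
  define \<Lambda> where "\<Lambda> = (LBINT y. kern \<delta> (y::'a))"
  have \<Lambda>: "0 \<le> \<Lambda>" unfolding \<Lambda>_def by simp
  have "M \<le> m0 + e / k"
  proof (rule ccontr)
    assume "\<not> ?thesis"
    then have M: "m0 + e / k < M" by simp
    define D where "D = (M - m0) * k - e"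
    have D: "0 < D" using M k by (simp add: D_def field_simps)
    \<comment> \<open>\<open>D\<close> is the slack in the claimed bound. The kernel mass \<Lambda>
      blows up as \<delta> tends to 0, so \<eta> is adapted to it; \<Lambda> does not enter the
      conclusion.\<close>
    define \<eta> where "\<eta> = min ((M - m0) / 2) (D / (2 * (k + \<Lambda>)))"
    have mm: "m0 < M" using M k e by (smt (verit) divide_nonneg_pos)
    have \<eta>0: "0 < \<eta>" using mm D k \<Lambda> by (auto simp: \<eta>_def intro!: divide_pos_pos)
    have \<eta>: "0 < \<eta>" "\<eta> < M - m0" using mm \<eta>0 min.cobounded1[of "(M - m0) / 2" "D / (2 * (k + \<Lambda>))", folded \<eta>_def]
      by auto
    have "\<eta> * (k + \<Lambda>) \<le> D / (2 * (k + \<Lambda>)) * (k + \<Lambda>)"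
      using k \<Lambda> by (intro mult_right_mono) (auto simp: \<eta>_def)
    also have "\<dots> = D / 2" using k \<Lambda> by (simp add: field_simps)
    finally have \<eta>D: "\<eta> * (k + \<Lambda>) < D" using D by simp
    obtain x where x: "M - \<eta> < w x"
      using less_cSup_iff[OF _ bdd, of "M - \<eta>"] \<eta> unfolding M_def[symmetric] by auto
    then have xG: "x \<in> G" using out[of x] \<eta> by force
    have "m0 < w x" using x \<eta> by linarith
    then have "- e \<le> gen \<delta> w x" using ineq xG by blast
    also have "\<dots> \<le> (LBINT y. \<eta> * kern \<delta> y - (w x - m0) * (kern \<delta> y * indicator S (x + y)))"
      unfolding gen_def
    proof (rule integral_mono)
      show "integrable lborel (\<lambda>y. kern \<delta> y * (w (x + y) - w x))"
        by (rule gen_integrable) (use \<delta> wb in auto)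
      show "integrable lborel (\<lambda>y. \<eta> * kern \<delta> y - (w x - m0) * (kern \<delta> y * indicator S (x + y)))"
        using kern_integrable[OF \<delta>, where 'a='a] S
        by (intro Bochner_Integration.integrable_diff integrable_mult_right kern_shift_integrable[where B=1])
           (use \<delta> in \<open>auto simp: indicator_def\<close>)
      fix y
      have "w (x + y) - w x \<le> \<eta> - (w x - m0) * indicator S (x + y)"
        using x wM[of "x + y"] out[of "x+y"] S(2) \<eta> by (auto simp: indicator_def disjoint_iff)
      then have "kern \<delta> y * (w (x + y) - w x) \<le> kern \<delta> y * (\<eta> - (w x - m0) * indicator S (x + y))"
        by (intro mult_left_mono) auto
      then show "kern \<delta> y * (w (x + y) - w x) \<le> \<eta> * kern \<delta> y - (w x - m0) * (kern \<delta> y * indicator S (x + y))"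
        by (simp add: algebra_simps)
    qed
    also have "\<dots> = \<eta> * \<Lambda> - (w x - m0) * (LBINT y. kern \<delta> y * indicator S (x + y))"
      using kern_integrable[OF \<delta>, where 'a='a] S \<delta>
      by (subst Bochner_Integration.integral_diff)
         (auto simp: \<Lambda>_def intro!: integrable_mult_right kern_shift_integrable[where B=1] simp: indicator_def)
    also have "\<dots> \<le> \<eta> * \<Lambda> - (w x - m0) * k"
      using k(2)[OF xG] \<open>m0 < w x\<close> by (intro diff_left_mono mult_left_mono) auto
    also have "\<dots> \<le> \<eta> * \<Lambda> - (M - \<eta> - m0) * k"
      using x k by (intro diff_left_mono mult_right_mono) auto
    finally show False using \<eta>D by (simp add: D_def algebra_simps)
  qed
  then show ?thesis using wM[of x] by linarith
qed

text \<open>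
  By concavity of the power, the second differences of \<open>(|x - z|\<^sup>2 + \<delta>\<^sup>2)\<^bsup>\<beta>/2\<^esup>\<close> at \<open>x\<close> are at most
  \<open>2 \<rho>\<^sup>\<beta> ((1 + |y|\<^sup>2/\<rho>\<^sup>2)\<^bsup>\<beta>/2\<^esup> - 1)\<close> with \<open>\<rho>\<^sup>2 = |x - z|\<^sup>2 + \<delta>\<^sup>2\<close>. Their contribution to the generator
  vanishes relative to \<open>\<rho>\<^bsup>\<beta> - \<alpha>\<^esup>\<close> as \<open>\<beta> \<rightarrow> 0\<close>, whereas setting the function to \<open>0\<close> on the cone contributes
  at most \<open>- c \<rho>\<^bsup>\<beta> - \<alpha>\<^esup>\<close> with \<open>c\<close> independent of \<open>\<beta>\<close>. The cut-off at \<open>1\<close> only serves integrability.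
\<close>

definition barrier :: "real \<Rightarrow> real \<Rightarrow> 'a::euclidean_space set \<Rightarrow> 'a \<Rightarrow> 'a \<Rightarrow> real" where
  "barrier \<beta> \<delta> C z x = (if x \<in> C then 0 else min 1 (((norm (x - z))\<^sup>2 + \<delta>\<^sup>2) powr (\<beta> / 2)))"

section \<open>Concavity of powers, scaling of the kernel, and the barrier estimate\<close>

lemma powr_Bernoulli:
  fixes A \<theta> :: real
  assumes "0 < A" "0 \<le> \<theta>" "\<theta> \<le> 1"
  shows "A powr \<theta> \<le> 1 + \<theta> * (A - 1)"
  using Youngs_inequality_0[of \<theta> "1 - \<theta>" A 1] assms by (simp add: algebra_simps)

text \<open>After division by the midpoint both powers lie below the tangent line at 1, and the two
  linear terms cancel.\<close>

lemma powr_midpoint_concave: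
  fixes a b p :: real
  assumes "0 < a" "0 < b" "0 \<le> p" "p \<le> 1"
  shows "a powr p + b powr p \<le> 2 * ((a + b) / 2) powr p"
proof -
  let ?m = "(a + b) / 2"
  have m: "0 < ?m" using assms by simp
  have "(a / ?m) powr p + (b / ?m) powr p \<le> (1 + p * (a / ?m - 1)) + (1 + p * (b / ?m - 1))"
    using assms m by (intro add_mono powr_Bernoulli) auto
  also have "\<dots> = 2 + p * ((a + b) / ?m - 2)" by (simp add: add_divide_distrib algebra_simps)
  also have "\<dots> = 2"
  proof -
    have "q / (q / 2) = 2" if "0 < q" for q :: real using that by simp
    from this[of "a + b"] show ?thesis using m by simp
  qed
  finally have "(a powr p + b powr p) / ?m powr p \<le> 2"
    using assms m by (simp add: powr_divide add_divide_distrib)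
  then show ?thesis using m by (simp add: pos_divide_le_eq)
qed

lemma growth_function_integrable:
  assumes "0 < \<beta>" "\<beta> < \<alpha>"
  shows "integrable lborel (\<lambda>y::'a::euclidean_space. ((1 + (norm y)\<^sup>2) powr (\<beta> / 2) - 1) * kern 0 y)"
proof (rule kern_growth_integrable[where A=1 and B=2 and \<beta>=\<beta>])
  fix y :: 'a
  show "0 \<le> (1 + (norm y)\<^sup>2) powr (\<beta> / 2) - 1" using assms by (simp add: ge_one_powr_ge_zero)
  have \<beta>: "\<beta> / 2 \<le> 1" using assms alpha_less by simp
  have "(1 + (norm y)\<^sup>2) powr (\<beta> / 2) \<le> 1 + \<beta> / 2 * (norm y)\<^sup>2"
    using powr_Bernoulli[of "1 + (norm y)\<^sup>2" "\<beta> / 2"] assms \<beta> by (simp add: add_pos_nonneg)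
  also have "\<dots> \<le> 1 + 1 * (norm y)\<^sup>2" using \<beta> by (intro add_mono mult_right_mono) auto
  finally show "(1 + (norm y)\<^sup>2) powr (\<beta> / 2) - 1 \<le> 1 * (norm y)\<^sup>2" by simp
  assume y: "1 \<le> norm y"
  then have y1: "1 \<le> (norm y)\<^sup>2" by simp
  have "(1 + (norm y)\<^sup>2) powr (\<beta> / 2) \<le> (2 * (norm y)\<^sup>2) powr (\<beta> / 2)"
    using assms y1 by (intro powr_mono2) auto
  also have "\<dots> = 2 powr (\<beta> / 2) * norm y powr \<beta>"
    using y by (simp add: powr_mult powr_powr flip: powr_numeral)
  also have "\<dots> \<le> 2 powr 1 * norm y powr \<beta>" using \<beta> by (intro mult_right_mono powr_mono) auto
  finally show "(1 + (norm y)\<^sup>2) powr (\<beta> / 2) - 1 \<le> 2 * norm y powr \<beta>" by simp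
qed (use assms in auto)

lemma kern_scale:
  fixes y :: "'a::euclidean_space"
  assumes "0 < \<rho>" shows "kern (\<rho> * \<delta>) (\<rho> *\<^sub>R y) = \<rho> powr (- \<alpha>) / \<rho> ^ DIM('a) * kern \<delta> y"
proof -
  have "\<rho> powr (real DIM('a) + \<alpha>) = \<rho> ^ DIM('a) * \<rho> powr \<alpha>"
    using assms by (simp add: powr_add powr_realpow)
  then show ?thesis
    using assms by (simp add: kern_def powr_mult powr_minus field_simps)
qed

text \<open>Homogeneity of degree -N-\<alpha> against the Jacobian of degree N leaves the power
  -\<alpha>, and the truncation length scales along. The same identity normalises the barrier
  estimate to unit size and produces the factor \<open>t powr \<alpha>\<close> matching the
  hypothesis on \<open>f\<close>.\<close>

lemma integral_kern_scale:
  fixes g :: "'a::euclidean_space \<Rightarrow> real"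
  assumes "0 < \<rho>"
  shows "(LBINT y. kern (\<rho> * \<delta>) y * g y) = \<rho> powr (- \<alpha>) * (LBINT y. kern \<delta> y * g (\<rho> *\<^sub>R y))"
    and "integrable lborel (\<lambda>y. kern (\<rho> * \<delta>) y * g y) \<longleftrightarrow> integrable lborel (\<lambda>y. kern \<delta> y * g (\<rho> *\<^sub>R y))"
proof -
  have *: "kern (\<rho> * \<delta>) (0 + \<rho> *\<^sub>R y) * g (0 + \<rho> *\<^sub>R y) =
      \<rho> powr (- \<alpha>) / \<rho> ^ DIM('a) * (kern \<delta> y * g (\<rho> *\<^sub>R y))" for y
    using assms by (simp add: kern_scale)
  note aff = integral_lborel_affine[of \<rho> "\<lambda>y. kern (\<rho> * \<delta>) y * g y" 0, unfolded *]
  show "(LBINT y. kern (\<rho> * \<delta>) y * g y) = \<rho> powr (- \<alpha>) * (LBINT y. kern \<delta> y * g (\<rho> *\<^sub>R y))"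
    using aff(1) assms by simp
  have "\<rho> powr (- \<alpha>) / \<rho> ^ DIM('a) \<noteq> 0" using assms by simp
  then show "integrable lborel (\<lambda>y. kern (\<rho> * \<delta>) y * g y) \<longleftrightarrow> integrable lborel (\<lambda>y. kern \<delta> y * g (\<rho> *\<^sub>R y))"
    using aff(2) assms integrable_mult_left_iff[of lborel "\<rho> powr (- \<alpha>) / \<rho> ^ DIM('a)"
      "\<lambda>y. kern \<delta> y * g (\<rho> *\<^sub>R y)"] by (metis less_irrefl)
qed

lemma barrier_supersolution:
  fixes \<kappa> h :: real
  assumes \<kappa>: "0 < \<kappa>" "\<kappa> < 1" and h: "0 < h"
  obtains \<beta> r c where "0 < \<beta>" "0 < r" "0 < c"
    "\<And>(z::'a::euclidean_space) e \<delta> x. norm e = 1 \<Longrightarrow> 0 < \<delta> \<Longrightarrow> \<delta> < r \<Longrightarrow> norm (x - z) < r \<Longrightarrow>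
      x \<notin> finite_cone \<kappa> h e z \<Longrightarrow> gen \<delta> (barrier \<beta> \<delta> (finite_cone \<kappa> h e z) z) x \<le> - c"
proof -
  \<comment> \<open>Relative radius of a ball that fits into the cone around the axis point at
    height 5/2. The third inequality below is the fitting condition, and \<open>t < 1 / 2\<close>
    keeps the ball between distances 2 and 3 from the vertex.\<close>
  define t where "t = (1 - \<kappa>) / 2"
  have t: "0 < t" "t < 1 / 2" "\<kappa> * (5/2 + t) \<le> 5/2 - t"
  proof -
    have "t * (1 + \<kappa>) \<le> t * 2" using \<kappa> by (intro mult_left_mono) (auto simp: t_def)
    moreover have "t * 2 = 1 - \<kappa>" by (simp add: t_def)
    ultimately show "\<kappa> * (5/2 + t) \<le> 5/2 - t" using \<kappa> by (simp add: algebra_simps)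
  qed (use \<kappa> in \<open>auto simp: t_def\<close>)
  \<comment> \<open>Lower bound for the jump rate into that ball at unit scale; 4 bounds the
    distance from \<open>x\<close> to its points. The constant does not involve \<beta>, so \<beta>
    may be chosen after it.\<close>
  define c1 where "c1 = frac_const (real DIM('a)) \<alpha> / 4 powr (real DIM('a) + \<alpha>) * (unit_ball_vol (DIM('a)) * t ^ DIM('a))"
  have c1: "0 < c1" using t frac_const_pos[of "real DIM('a)"] unfolding c1_def
    by (intro mult_pos_pos divide_pos_pos) auto
  define \<beta>0 where "\<beta>0 = \<alpha> / 2"
  have \<beta>0: "0 < \<beta>0" "\<beta>0 < \<alpha>" "\<beta>0 / 2 \<le> 1" using alpha_pos alpha_less by (auto simp: \<beta>0_def)
  define E where "E = (\<lambda>\<beta>. LBINT y. ((1 + (norm y)\<^sup>2) powr (\<beta> / 2) - 1) * kern 0 (y::'a))"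
  have E0: "0 \<le> E \<beta>0" unfolding E_def
    using \<beta>0 by (intro integral_nonneg_AE AE_I2 mult_nonneg_nonneg) (auto simp: ge_one_powr_ge_zero)
  \<comment> \<open>The Bernoulli inequality with exponent \<theta> gives
    \<open>E (\<theta> * \<beta>0) \<le> \<theta> * E \<beta>0\<close>, so this \<theta> brings the
    growth contribution below half of \<open>c1\<close>. The summand 1 guards against
    \<open>E \<beta>0 = 0\<close>.\<close>
  define \<theta> where "\<theta> = min 1 (c1 / (2 * (E \<beta>0 + 1)))"
  have \<theta>: "0 < \<theta>" "\<theta> \<le> 1" using c1 E0 by (auto simp: \<theta>_def)
  define \<beta> where "\<beta> = \<theta> * \<beta>0"
  have \<beta>: "0 < \<beta>" "\<beta> < \<alpha>" "\<beta> / 2 \<le> 1"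
  proof -
    have "\<theta> * \<beta>0 \<le> 1 * \<beta>0" using \<theta> \<beta>0 by (intro mult_right_mono) auto
    then have "\<beta> \<le> \<beta>0" unfolding \<beta>_def by (simp only: mult_1)
    then show "\<beta> < \<alpha>" "\<beta> / 2 \<le> 1" using \<beta>0 by linarith+
  qed (use \<theta> \<beta>0 in \<open>simp add: \<beta>_def\<close>)
  have E\<beta>: "E \<beta> \<le> c1 / 2"
  proof -
    have "E \<beta> \<le> (LBINT y. \<theta> * (((1 + (norm y)\<^sup>2) powr (\<beta>0 / 2) - 1) * kern 0 (y::'a)))"
      unfolding E_def
    proof (rule integral_mono)
      show "integrable lborel (\<lambda>y::'a. ((1 + (norm y)\<^sup>2) powr (\<beta> / 2) - 1) * kern 0 y)"
        "integrable lborel (\<lambda>y::'a. \<theta> * (((1 + (norm y)\<^sup>2) powr (\<beta>0 / 2) - 1) * kern 0 y))"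
        using \<beta> \<beta>0 by (auto intro!: integrable_mult_right growth_function_integrable)
      fix y :: 'a
      have "((1 + (norm y)\<^sup>2) powr (\<beta>0 / 2)) powr \<theta> \<le> 1 + \<theta> * ((1 + (norm y)\<^sup>2) powr (\<beta>0 / 2) - 1)"
        using \<theta> add_pos_nonneg[of 1 "(norm y)\<^sup>2"] by (intro powr_Bernoulli) auto
      then have "(1 + (norm y)\<^sup>2) powr (\<beta> / 2) - 1 \<le> \<theta> * ((1 + (norm y)\<^sup>2) powr (\<beta>0 / 2) - 1)"
        by (simp add: powr_powr \<beta>_def mult.commute)
      then show "((1 + (norm y)\<^sup>2) powr (\<beta> / 2) - 1) * kern 0 y
          \<le> \<theta> * (((1 + (norm y)\<^sup>2) powr (\<beta>0 / 2) - 1) * kern 0 y)"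
        by (simp add: mult_right_mono flip: mult.assoc)
    qed
    also have "\<dots> = \<theta> * E \<beta>0" by (simp add: E_def)
    also have "\<dots> \<le> c1 / (2 * (E \<beta>0 + 1)) * E \<beta>0"
      using E0 by (intro mult_right_mono) (auto simp: \<theta>_def)
    also have "\<dots> \<le> c1 / (2 * (E \<beta>0 + 1)) * (E \<beta>0 + 1)"
      using E0 c1 by (intro mult_left_mono) auto
    also have "\<dots> = c1 / 2" using E0 by (simp add: field_simps)
    finally show ?thesis .
  qed
  \<comment> \<open>Since \<rho> < 2 r, this ensures \<rho> < 1, so that the cut-off at 1 is
    inactive at \<open>x\<close>, and 3 \<rho> \<le> h, so that the ball fits below the top of the
    cone.\<close>
  define r where "r = min (1 / 2) (h / 6)"
  have r: "0 < r" "2 * r \<le> 1" "6 * r \<le> h" using h by (auto simp: r_def)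
  have "gen \<delta> (barrier \<beta> \<delta> (finite_cone \<kappa> h e z) z) x \<le> - (c1 / 2)"
    if e: "norm e = 1" and \<delta>: "0 < \<delta>" "\<delta> < r" and x: "norm (x - z) < r" "x \<notin> finite_cone \<kappa> h e z"
    for z e x :: 'a and \<delta>
  proof -
    define C where "C = finite_cone \<kappa> h e z"
    have C[measurable]: "C \<in> sets borel"
      unfolding C_def finite_cone_def by measurable
    \<comment> \<open>Including \<delta> makes the working scale at least the truncation length:
      sets at distance comparable to \<rho> are then seen by \<open>kern \<delta>\<close> however
      close \<open>x\<close> is to the vertex.\<close>
    define \<rho> where "\<rho> = sqrt ((norm (x - z))\<^sup>2 + \<delta>\<^sup>2)"
    have \<rho>2: "\<rho>\<^sup>2 = (norm (x - z))\<^sup>2 + \<delta>\<^sup>2" by (simp add: \<rho>_def)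
    have \<rho>pos: "0 < \<rho>" using \<delta> by (auto simp: \<rho>_def intro: add_nonneg_pos)
    have \<delta>\<rho>: "\<delta> \<le> \<rho>" "norm (x - z) \<le> \<rho>" using \<delta> by (auto simp: \<rho>_def intro: real_le_rsqrt)
    have "\<rho> \<le> norm (x - z) + \<delta>"
      unfolding \<rho>_def using \<delta> by (intro real_le_lsqrt) (auto simp: power2_eq_square algebra_simps)
    then have \<rho>1: "\<rho> < 1" "3 * \<rho> \<le> h" using x \<delta> r by auto
    define P where "P = (\<lambda>y. min 1 (((norm (y - z))\<^sup>2 + \<delta>\<^sup>2) powr (\<beta> / 2)))"
    have [measurable]: "P \<in> borel_measurable borel" unfolding P_def by measurable
    have P01: "0 \<le> P y" "P y \<le> 1" "\<bar>P y\<bar> \<le> 1" for y by (auto simp: P_def)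
    have sq: "(s\<^sup>2) powr (\<beta> / 2) = s powr \<beta>" if "0 < s" for s :: real
      using that by (simp add: powr_powr flip: powr_numeral)
    have \<rho>\<beta>1: "\<rho> powr \<beta> \<le> 1" using \<rho>1 \<rho>pos \<beta> by (intro powr_le1) auto
    have Px: "P x = \<rho> powr \<beta>" unfolding P_def \<rho>2[symmetric] sq[OF \<rho>pos] using \<rho>\<beta>1 by simp
    have b_eq: "barrier \<beta> \<delta> C z y = P y - P y * indicator C y" for y
      by (simp add: barrier_def P_def indicator_def)
    have P_int: "integrable lborel (\<lambda>y. kern \<delta> y * (P (x + y) - P x))"
      by (rule gen_integrable[where B=1]) (use \<delta> P01 in auto)
    have PC_int: "integrable lborel (\<lambda>y. kern \<delta> y * (P (x + y) * indicator C (x + y)))"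
      by (rule kern_shift_integrable[where B=1 and u="\<lambda>y. P y * indicator C y"])
         (use \<delta> P01 in \<open>auto split: split_indicator\<close>)
    have "gen \<delta> (barrier \<beta> \<delta> C z) x =
       (LBINT y. kern \<delta> y * (P (x + y) - P x) - kern \<delta> y * (P (x + y) * indicator C (x + y)))"
      unfolding gen_def b_eq using x(2) by (auto simp: C_def algebra_simps intro!: Bochner_Integration.integral_cong)
    also have "\<dots> = gen \<delta> P x - (LBINT y. kern \<delta> y * (P (x + y) * indicator C (x + y)))"
      using P_int PC_int by (simp add: gen_def)
    finally have gen_b: "gen \<delta> (barrier \<beta> \<delta> C z) x =
       gen \<delta> P x - (LBINT y. kern \<delta> y * (P (x + y) * indicator C (x + y)))" .
    have "gen \<delta> P x \<le> \<rho> powr \<beta> * (\<rho> powr (- \<alpha>) * E \<beta>)"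
    proof -
      let ?g = "\<lambda>y::'a. (1 + (norm y)\<^sup>2) powr (\<beta> / 2) - 1"
      have g0: "0 \<le> ?g y" for y using \<beta> by (simp add: ge_one_powr_ge_zero)
      have int: "integrable lborel (\<lambda>y. kern 0 y * ?g (y /\<^sub>R \<rho>))"
        using integral_kern_scale(2)[OF \<rho>pos, of 0 "\<lambda>y. ?g (y /\<^sub>R \<rho>)"] \<rho>pos
          growth_function_integrable[OF \<beta>(1,2), where 'a='a] by (simp add: mult.commute)
      have "(LBINT y. kern \<delta> y * (P (x + y) + P (x - y) - 2 * P x)) \<le>
          (LBINT y. 2 * \<rho> powr \<beta> * (kern 0 y * ?g (y /\<^sub>R \<rho>)))"
      proof (rule integral_mono)
        show "integrable lborel (\<lambda>y. kern \<delta> y * (P (x + y) + P (x - y) - 2 * P x))"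
          by (rule gen_second_difference(1)[where B=1]) (use \<delta> P01 in auto)
        show "integrable lborel (\<lambda>y. 2 * \<rho> powr \<beta> * (kern 0 y * ?g (y /\<^sub>R \<rho>)))"
          using int by (intro integrable_mult_right)
        fix y
        let ?a = "(norm (x + y - z))\<^sup>2 + \<delta>\<^sup>2" and ?b = "(norm (x - y - z))\<^sup>2 + \<delta>\<^sup>2"
        have mid: "(?a + ?b) / 2 = \<rho>\<^sup>2 * (1 + (norm (y /\<^sub>R \<rho>))\<^sup>2)"
        proof -
          have "(norm (x + y - z))\<^sup>2 + (norm (x - y - z))\<^sup>2 = 2 * (norm (x - z))\<^sup>2 + 2 * (norm y)\<^sup>2"
            by (simp add: power2_norm_eq_inner algebra_simps inner_commute)
          moreover have "\<rho>\<^sup>2 * (1 + (norm (y /\<^sub>R \<rho>))\<^sup>2) = \<rho>\<^sup>2 + (norm y)\<^sup>2"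
            using \<rho>pos by (simp add: field_simps power2_eq_square)
          ultimately show ?thesis using \<rho>2 by simp
        qed
        have "P (x + y) + P (x - y) \<le> ?a powr (\<beta> / 2) + ?b powr (\<beta> / 2)"
          unfolding P_def by (intro add_mono) auto
        also have "\<dots> \<le> 2 * ((?a + ?b) / 2) powr (\<beta> / 2)"
          using \<delta> \<beta> by (intro powr_midpoint_concave) (auto intro: add_nonneg_pos)
        also have "\<dots> = 2 * \<rho> powr \<beta> * (1 + (norm (y /\<^sub>R \<rho>))\<^sup>2) powr (\<beta> / 2)"
          unfolding mid using \<rho>pos by (subst powr_mult) (auto simp: sq)
        finally have "P (x + y) + P (x - y) - 2 * P x \<le> 2 * \<rho> powr \<beta> * ?g (y /\<^sub>R \<rho>)"
          by (simp add: Px algebra_simps)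
        then have "kern \<delta> y * (P (x + y) + P (x - y) - 2 * P x) \<le> kern \<delta> y * (2 * \<rho> powr \<beta> * ?g (y /\<^sub>R \<rho>))"
          by (intro mult_left_mono) auto
        \<comment> \<open>Restoring the short jumps is legitimate because the bound, unlike the
          second difference itself, is nonnegative. Without truncation the integral scales exactly
          in \<rho>.\<close>
        also have "\<dots> \<le> kern 0 y * (2 * \<rho> powr \<beta> * ?g (y /\<^sub>R \<rho>))"
          using \<delta> g0[of "y /\<^sub>R \<rho>"] by (intro mult_right_mono kern_antimono mult_nonneg_nonneg) auto
        finally show "kern \<delta> y * (P (x + y) + P (x - y) - 2 * P x) \<le> 2 * \<rho> powr \<beta> * (kern 0 y * ?g (y /\<^sub>R \<rho>))"
          by (simp add: mult_ac)
      qed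
      also have "\<dots> = 2 * \<rho> powr \<beta> * (LBINT y. kern 0 y * ?g (y /\<^sub>R \<rho>))" by simp
      also have "(LBINT y. kern 0 y * ?g (y /\<^sub>R \<rho>)) = \<rho> powr (- \<alpha>) * E \<beta>"
        using integral_kern_scale(1)[OF \<rho>pos, of 0 "\<lambda>y. ?g (y /\<^sub>R \<rho>)"] \<rho>pos
        by (simp add: E_def mult.commute)
      finally show ?thesis
        using gen_second_difference(2)[of \<delta> P 1 x] \<delta> P01 by simp
    qed
    also have "\<dots> \<le> \<rho> powr \<beta> * (\<rho> powr (- \<alpha>) * (c1 / 2))"
      using E\<beta> by (intro mult_left_mono) auto
    finally have g1: "gen \<delta> P x \<le> \<rho> powr \<beta> * (\<rho> powr (- \<alpha>) * (c1 / 2))" .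
    \<comment> \<open>The ball around this point is at distance between 2 \<rho> and 3 \<rho> from
      \<open>z\<close>, hence farther than \<rho> \<ge> \<delta> from \<open>x\<close>, and
      \<open>P\<close> is at least \<open>\<rho> powr \<beta>\<close> on it.\<close>
    let ?p = "z + (5/2 * \<rho>) *\<^sub>R e"
    have ball: "y \<in> C \<and> 2 * \<rho> < norm (y - z) \<and> norm (y - z) \<le> 3 * \<rho>" if "y \<in> ball ?p (t * \<rho>)" for y
    proof -
      define v where "v = y - ?p"
      have v: "norm v < t * \<rho>" using that by (simp add: v_def dist_norm norm_minus_commute)
      have yz: "y - z = (5/2 * \<rho>) *\<^sub>R e + v" by (simp add: v_def)
      have ve: "\<bar>v \<bullet> e\<bar> < t * \<rho>" using Cauchy_Schwarz_ineq2[of v e] e v by simp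
      have ip: "(y - z) \<bullet> e = 5/2 * \<rho> + v \<bullet> e"
        using e by (simp add: yz inner_add_left power2_norm_eq_inner[symmetric])
      have n1: "norm (y - z) \<le> 5/2 * \<rho> + norm v"
        unfolding yz using norm_triangle_ineq[of "(5/2 * \<rho>) *\<^sub>R e" v] e \<rho>pos by simp
      have t\<rho>: "t * \<rho> < 1 / 2 * \<rho>" using t \<rho>pos by (intro mult_strict_right_mono) auto
      have n2: "(y - z) \<bullet> e \<le> norm (y - z)" using Cauchy_Schwarz_ineq2[of "y - z" e] e by simp
      have "\<kappa> * norm (y - z) \<le> \<kappa> * (5/2 * \<rho> + t * \<rho>)" using n1 v \<kappa> by (intro mult_left_mono) auto
      also have "\<dots> = (\<kappa> * (5/2 + t)) * \<rho>" by (simp add: algebra_simps)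
      also have "\<dots> \<le> (5/2 - t) * \<rho>" using t \<rho>pos by (intro mult_right_mono) auto
      also have "\<dots> \<le> (y - z) \<bullet> e" using ip ve by (simp add: algebra_simps)
      finally have "\<kappa> * norm (y - z) \<le> (y - z) \<bullet> e" .
      then show ?thesis using n1 n2 v t\<rho> ip ve \<rho>1 by (auto simp: C_def finite_cone_def)
    qed
    have "\<rho> powr \<beta> * (\<rho> powr (- \<alpha>) * c1) \<le>
        \<rho> powr \<beta> * (LBINT y. kern \<delta> y * indicator (ball ?p (t * \<rho>)) (x + y))"
    proof (rule mult_left_mono)
      have "\<rho> powr (- \<alpha>) * c1 = frac_const (real DIM('a)) \<alpha> / (4 * \<rho>) powr (real DIM('a) + \<alpha>) * (unit_ball_vol (DIM('a)) * (t * \<rho>) ^ DIM('a))"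
        using \<rho>pos by (simp add: c1_def powr_mult powr_add powr_realpow powr_minus power_mult_distrib field_simps)
      also have "\<dots> \<le> (LBINT y. kern \<delta> y * indicator (ball ?p (t * \<rho>)) (x + y))"
      proof (rule kern_ball_lower)
        fix y assume "y \<in> ball ?p (t * \<rho>)"
        from ball[OF this] have "2 * \<rho> < norm (y - z)" "norm (y - z) \<le> 3 * \<rho>" by auto
        moreover have "norm (y - z) \<le> norm (y - x) + norm (x - z)" "norm (y - x) \<le> norm (y - z) + norm (x - z)"
          using norm_triangle_ineq[of "y - x" "x - z"] norm_triangle_ineq4[of "y - z" "x - z"] by auto
        ultimately show "\<delta> < norm (y - x) \<and> norm (y - x) \<le> 4 * \<rho>" using \<delta>\<rho> by linarith
      qed (use \<delta> t \<rho>pos in auto)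
      finally show "\<rho> powr (- \<alpha>) * c1 \<le> (LBINT y. kern \<delta> y * indicator (ball ?p (t * \<rho>)) (x + y))" .
    qed auto
    also have "\<dots> = (LBINT y. \<rho> powr \<beta> * (kern \<delta> y * indicator (ball ?p (t * \<rho>)) (x + y)))" by simp
    also have "\<dots> \<le> (LBINT y. kern \<delta> y * (P (x + y) * indicator C (x + y)))"
    proof (rule integral_mono)
      show "integrable lborel (\<lambda>y. \<rho> powr \<beta> * (kern \<delta> y * indicator (ball ?p (t * \<rho>)) (x + y)))"
        by (intro integrable_mult_right kern_shift_integrable[where B=1] borel_measurable_indicator)
           (use \<delta> in \<open>auto split: split_indicator\<close>)
      fix y
      show "\<rho> powr \<beta> * (kern \<delta> y * indicator (ball ?p (t * \<rho>)) (x + y))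
          \<le> kern \<delta> y * (P (x + y) * indicator C (x + y))"
      proof (cases "x + y \<in> ball ?p (t * \<rho>)")
        case True
        note b = ball[OF True]
        have "\<rho>\<^sup>2 \<le> (norm (x + y - z))\<^sup>2 + \<delta>\<^sup>2" using b \<rho>pos by (intro order_trans[OF power_mono[of \<rho> "norm (x + y - z)"]]) auto
        then have "\<rho> powr \<beta> \<le> ((norm (x + y - z))\<^sup>2 + \<delta>\<^sup>2) powr (\<beta> / 2)"
          using \<rho>pos \<beta> by (subst sq[symmetric]) (auto intro!: powr_mono2)
        then have "\<rho> powr \<beta> \<le> P (x + y)" using \<rho>\<beta>1 by (simp add: P_def)
        then have "kern \<delta> y * \<rho> powr \<beta> \<le> kern \<delta> y * P (x + y)" by (intro mult_left_mono) auto
        then show ?thesis using True b by (simp add: mult.commute)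
      qed (use P01 in auto)
    qed (use PC_int in auto)
    finally have "gen \<delta> (barrier \<beta> \<delta> C z) x \<le> - (\<rho> powr \<beta> * (\<rho> powr (- \<alpha>) * (c1 / 2)))"
      using g1 by (simp add: gen_b algebra_simps)
    \<comment> \<open>The estimate becomes stronger as \<rho> decreases, since \<beta> < \<alpha>; a
      constant bound, valid because \<rho> < 1, is enough to absorb a bounded source.\<close>
    moreover have "1 \<le> \<rho> powr \<beta> * \<rho> powr (- \<alpha>)"
    proof -
      have "\<rho> powr 0 \<le> \<rho> powr (\<beta> - \<alpha>)" using \<rho>1 \<rho>pos \<beta> by (intro powr_mono') auto
      then show ?thesis using \<rho>pos by (simp flip: powr_add)
    qed
    then have "1 * (c1 / 2) \<le> (\<rho> powr \<beta> * \<rho> powr (- \<alpha>)) * (c1 / 2)"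
      using c1 by (intro mult_right_mono) auto
    ultimately show ?thesis by (simp add: C_def mult.assoc)
  qed
  moreover have "0 < c1 / 2" using c1 by simp
  ultimately show thesis using that[of \<beta> r "c1 / 2", OF \<beta>(1) r(1)] by simp
qed

end

section \<open>Solutions for the truncated kernel\<close>

context fractional
begin

lemma gen_diff_scaled:
  fixes u v :: "'a::euclidean_space \<Rightarrow> real"
  assumes "0 < \<delta>" "u \<in> borel_measurable borel" "\<And>x. \<bar>u x\<bar> \<le> B" "v \<in> borel_measurable borel" "\<And>x. \<bar>v x\<bar> \<le> B'"
  shows "gen \<delta> (\<lambda>x. u x - A * v x) x = gen \<delta> u x - A * gen \<delta> v x"
proof -
  have "gen \<delta> (\<lambda>x. u x - A * v x) x =
     (LBINT y. kern \<delta> y * (u (x + y) - u x) - A * (kern \<delta> y * (v (x + y) - v x)))"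
    unfolding gen_def by (intro Bochner_Integration.integral_cong) (auto simp: algebra_simps)
  also have "\<dots> = gen \<delta> u x - A * gen \<delta> v x"
    using gen_integrable[OF assms(1-3), of x] gen_integrable[OF assms(1,4,5), of x]
    by (simp add: gen_def)
  finally show ?thesis .
qed

lemma gen_one_minus: "gen \<delta> (\<lambda>x. 1 - u x) x = - gen \<delta> u x"
proof -
  have "gen \<delta> (\<lambda>x. 1 - u x) x = (LBINT y. - (kern \<delta> y * (u (x + y) - u x)))"
    unfolding gen_def by (intro Bochner_Integration.integral_cong) (auto simp: algebra_simps)
  then show ?thesis by (simp add: gen_def)
qed

lemma gen_translate: "gen \<delta> (\<lambda>x. u (x + h)) x = gen \<delta> u (x + h)"
  by (simp add: gen_def add_ac)

end

section \<open>Geometry of the ring and solvability of the truncated problem\<close>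

lemma frontier_crossing:
  fixes x y :: "'a::euclidean_space"
  assumes "x \<in> D" "y \<notin> D"
  obtains z where "z \<in> frontier D" "dist x z \<le> dist x y" "dist y z \<le> dist x y"
proof -
  have "closed_segment x y \<inter> frontier D \<noteq> {}"
    using assms by (intro connected_Int_frontier) auto
  then obtain z where "z \<in> closed_segment x y" "z \<in> frontier D" by blast
  then show thesis using that dist_in_closed_segment[of z x y] by (auto simp: dist_commute)
qed

locale ring_problem = fractional +
  fixes D0 D1 D :: "'a::euclidean_space set" and f :: "'a \<Rightarrow> real \<Rightarrow> real"
  assumes D_def: "D = D0 - closure D1"
    and open_D0: "open D0" and bounded_D0: "bounded D0" and star_D0: "starshaped D0"
    and open_D1: "open D1" and star_D1: "starshaped D1" and zero_D1: "0 \<in> D1"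
    and closure_D1: "closure D1 \<subseteq> D0"
    and cone_D: "uniform_exterior_cone_condition D"
    and f_scale: "\<And>t x v. 1 \<le> t \<Longrightarrow> x \<in> D \<Longrightarrow> t *\<^sub>R x \<in> D \<Longrightarrow> v \<in> {0..1} \<Longrightarrow> f x v \<le> t powr \<alpha> * f (t *\<^sub>R x) v"
    and f_Lipschitz: "\<exists>C>0. \<forall>x\<in>D. \<forall>v1\<in>{0..1}. \<forall>v2\<in>{0..1}. \<bar>f x v1 - f x v2\<bar> \<le> C * \<bar>v1 - v2\<bar>"
    and f_mono: "\<And>x v1 v2. x \<in> D \<Longrightarrow> v1 \<in> {0..1} \<Longrightarrow> v2 \<in> {0..1} \<Longrightarrow> v1 \<le> v2 \<Longrightarrow> f x v1 \<le> f x v2"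
    and f_bounded: "bounded ((\<lambda>(x, v). f x v) ` (D \<times> {0..1}))"
    and f_cont: "continuous_on (D \<times> {0..1}) (\<lambda>(x, v). f x v)"
    and f_zero: "\<And>x. x \<in> D \<Longrightarrow> f x 0 = 0"
begin

lemma open_D: "open D" unfolding D_def using open_D0 by (intro open_Diff) auto
lemma bounded_D: "bounded D" using bounded_D0 bounded_subset unfolding D_def by blast
lemma D_sets[measurable]: "D \<in> sets borel" using open_D by simp
lemma frontier_not_D: "z \<in> frontier D \<Longrightarrow> z \<notin> D"
  using open_D by (simp add: frontier_def interior_open)

lemma f_nonneg: "x \<in> D \<Longrightarrow> v \<in> {0..1} \<Longrightarrow> 0 \<le> f x v"
  using f_mono[of x 0 v] f_zero[of x] by auto

lemma f_upper: obtains F where "0 < F" "\<And>x v. x \<in> D \<Longrightarrow> v \<in> {0..1} \<Longrightarrow> f x v \<le> F"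
proof -
  obtain B where "\<forall>p\<in>(\<lambda>(x, v). f x v) ` (D \<times> {0..1}). norm p \<le> B"
    using f_bounded unfolding bounded_iff by blast
  then have "f x v \<le> max 1 B" if "x \<in> D" "v \<in> {0..1}" for x v
    using that by (force simp: abs_le_iff)
  then show thesis using that[of "max 1 B"] by auto
qed

text \<open>Continuity of \<open>f\<close> is available only on the Borel set
  \<open>D \<times> {0..1}\<close>, so measurability is derived for the extension by 0.\<close>

lemma f_comp_measurable:
  assumes [measurable]: "u \<in> borel_measurable borel" and u: "\<And>x. u x \<in> {0..1}"
  shows "(\<lambda>x. indicator D x * f x (u x)) \<in> borel_measurable borel"
proof -
  have [measurable]: "(\<lambda>p. indicator (D \<times> {0..1}) p *\<^sub>R (case p of (x, v) \<Rightarrow> f x v)) \<in> borel_measurable borel"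
    using f_cont by (intro borel_measurable_continuous_on_indicator) (auto simp: borel_prod[symmetric])
  have "(\<lambda>x. (\<lambda>p. indicator (D \<times> {0..1}) p *\<^sub>R (case p of (x, v) \<Rightarrow> f x v)) (x, u x)) \<in> borel_measurable borel"
    by measurable
  moreover have "indicator (D \<times> {0..1}) (x, u x) = (indicator D x :: real)" for x
    using u by (auto simp: indicator_def)
  ultimately show ?thesis by simp
qed

lemma gap: obtains d where "0 < d" "\<And>x y. x \<in> closure D1 \<Longrightarrow> y \<notin> D0 \<Longrightarrow> d \<le> dist x y"
proof -
  have "compact (closure D1)"
    using bounded_subset[OF bounded_D0 closure_D1] by (simp add: compact_eq_bounded_closed)
  moreover have "closed (- D0)" using open_D0 by auto
  ultimately obtain d where "d > 0" "\<forall>x\<in>closure D1. \<forall>y\<in>- D0. d \<le> dist x y"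
    using separate_compact_closed[of "closure D1" "- D0"] closure_D1 by blast
  then show thesis using that by auto
qed

text \<open>An exterior cone of the ring avoids \<open>D\<close> but might reach from one
  complementary piece into the other. Cutting it shorter than the gap between
  \<open>closure D1\<close> and the complement of \<open>D0\<close> forces it to stay in the piece
  of its vertex, where the boundary value is constant.\<close>

lemma exterior_cones:
  obtains \<kappa> h where "0 < \<kappa>" "\<kappa> < 1" "0 < h"
    "\<And>z. z \<in> frontier D \<Longrightarrow> \<exists>e. norm e = 1 \<and> (z \<notin> D0 \<longrightarrow> finite_cone \<kappa> h e z \<inter> D0 = {}) \<and>
       (z \<in> D0 \<longrightarrow> z \<in> closure D1 \<and> finite_cone \<kappa> h e z \<subseteq> closure D1)"
proof -
  obtain \<kappa> h where \<kappa>: "0 < \<kappa>" "\<kappa> < 1" "0 < h"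
    and cone: "\<forall>z\<in>frontier D. \<exists>e. norm e = 1 \<and> finite_cone \<kappa> h e z \<inter> closure D = {z}"
    using cone_D unfolding uniform_exterior_cone_condition_def by blast
  obtain d where d: "0 < d" "\<And>x y. x \<in> closure D1 \<Longrightarrow> y \<notin> D0 \<Longrightarrow> d \<le> dist x y" using gap by blast
  \<comment> \<open>Points of the cone satisfy \<open>\<kappa> * norm (x - z) \<le> h'\<close>, so a
    height below \<kappa> d keeps them within distance less than \<open>d\<close> of the
    vertex.\<close>
  define h' where "h' = min h (\<kappa> * d / 2)"
  have h': "0 < h'" "h' \<le> h" "h' < \<kappa> * d" using \<kappa> d by (auto simp: h'_def min_def)
  have "\<exists>e. norm e = 1 \<and> (z \<notin> D0 \<longrightarrow> finite_cone \<kappa> h' e z \<inter> D0 = {}) \<and>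
       (z \<in> D0 \<longrightarrow> z \<in> closure D1 \<and> finite_cone \<kappa> h' e z \<subseteq> closure D1)" if z: "z \<in> frontier D" for z
  proof -
    obtain e where e: "norm e = 1" "finite_cone \<kappa> h e z \<inter> closure D = {z}" using cone z by blast
    have out: "x \<notin> D \<and> dist z x < d" if "x \<in> finite_cone \<kappa> h' e z" for x
    proof
      have "x \<in> finite_cone \<kappa> h e z" using that h' by (auto simp: finite_cone_def)
      then have "x \<in> closure D \<Longrightarrow> x = z" using e(2) by blast
      then show "x \<notin> D" using frontier_not_D[OF z] closure_subset[of D] by auto
      have "\<kappa> * norm (x - z) < \<kappa> * d" using that h' by (auto simp: finite_cone_def)
      then show "dist z x < d" using \<kappa> by (simp add: dist_norm norm_minus_commute)
    qed
    have zD: "z \<notin> D" by (rule frontier_not_D[OF z])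
    show ?thesis
    proof (intro exI[of _ e] conjI impI)
      assume "z \<notin> D0"
      then show "finite_cone \<kappa> h' e z \<inter> D0 = {}"
        using out d(2)[of _ z] by (fastforce simp: D_def dist_commute)
    next
      assume "z \<in> D0"
      then show "z \<in> closure D1" using zD by (simp add: D_def)
      then show "finite_cone \<kappa> h' e z \<subseteq> closure D1"
        using out d(2)[of z] by (fastforce simp: D_def)
    qed (use e in simp)
  qed
  then show thesis using that[of \<kappa> h'] \<kappa> h' by blast
qed

text \<open>The source of every comparison constant: a ball outside \<open>D0\<close>, placed so far
  away that jumps of length at most 1 cannot reach it from \<open>D0\<close>. Its rate
  \<open>k\<close> is therefore the same for all \<delta> \<le> 1.\<close>

lemma killing_set:
  obtains S k where "S \<in> sets borel" "S \<inter> D0 = {}" "0 < k"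
    "\<And>x \<delta>. x \<in> D0 \<Longrightarrow> 0 < \<delta> \<Longrightarrow> \<delta> \<le> 1 \<Longrightarrow> k \<le> (LBINT y. kern \<delta> y * indicator S (x + y))"
proof -
  obtain R where R: "\<forall>x\<in>D0. norm x \<le> R" using bounded_D0 unfolding bounded_iff by blast
  obtain b :: 'a where b: "b \<in> Basis" using nonempty_Basis by blast
  let ?S = "ball ((\<bar>R\<bar> + 3) *\<^sub>R b) 1"
  have far: "\<bar>R\<bar> + 2 < norm z" if "z \<in> ?S" for z
    using that norm_triangle_ineq2[of "(\<bar>R\<bar> + 3) *\<^sub>R b" z] b by (auto simp: dist_norm)
  obtain k where k: "0 < k" "\<And>x \<delta>'. x \<in> D0 \<Longrightarrow> 0 < \<delta>' \<Longrightarrow> \<delta>' \<le> 1 \<Longrightarrow> k \<le> (LBINT y. kern \<delta>' y * indicator ?S (x + y))"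
  proof (rule kern_set_lower[of 1 ?S D0])
    fix z x assume "z \<in> ?S" "x \<in> D0"
    then show "1 < norm (z - x)" using far[of z] R norm_triangle_ineq2[of z x] by force
  qed (use bounded_D0 in auto)
  have "?S \<inter> D0 = {}" using far R by force
  then show thesis using that[of ?S k] k by auto
qed

text \<open>The truncated equation is imposed pointwise, which makes sense for bounded measurable
  functions; continuity is recovered only in the limit.\<close>

definition is_approx :: "real \<Rightarrow> ('a \<Rightarrow> real) \<Rightarrow> bool" where
  "is_approx \<delta> u \<longleftrightarrow> u \<in> borel_measurable borel \<and> (\<forall>x. u x \<in> {0..1}) \<and> (\<forall>x. x \<notin> D0 \<longrightarrow> u x = 0) \<and>
     (\<forall>x\<in>closure D1. u x = 1) \<and> (\<forall>x\<in>D. gen \<delta> u x = f x (u x))"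

text \<open>Monotone iteration: adding \<open>C * u\<close> to both sides, with the Lipschitz
  constant \<open>C\<close>, makes the right-hand side of the fixed-point equation nondecreasing in
  \<open>u\<close>. The iterates increase and stay in [0,1], and dominated convergence identifies
  their limit as a fixed point.\<close>

lemma approx_exists:
  assumes \<delta>: "0 < \<delta>" shows "\<exists>u. is_approx \<delta> u"
proof -
  obtain C where C: "0 < C" and fL: "\<And>x v1 v2. x \<in> D \<Longrightarrow> v1 \<in> {0..1} \<Longrightarrow> v2 \<in> {0..1} \<Longrightarrow> \<bar>f x v1 - f x v2\<bar> \<le> C * \<bar>v1 - v2\<bar>"
    using f_Lipschitz by blast
  define \<Lambda> where "\<Lambda> = (LBINT y. kern \<delta> (y::'a))"
  have \<Lambda>: "0 \<le> \<Lambda>" unfolding \<Lambda>_def by simp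
  define I where "I = (\<lambda>(u :: 'a \<Rightarrow> real) x. LBINT y. kern \<delta> y * u (x + y))"
  \<comment> \<open>Solving \<open>I u x - \<Lambda> * u x = f x (u x)\<close> for the diagonal term
    after adding \<open>C * u x\<close>. The values off \<open>D\<close> are the prescribed
    ones.\<close>
  define T where "T = (\<lambda>u x. if x \<in> D then (I u x + C * u x - f x (u x)) / (\<Lambda> + C) else indicator (closure D1) x)"
  define good where "good = (\<lambda>u :: 'a \<Rightarrow> real. u \<in> borel_measurable borel \<and> (\<forall>x. u x \<in> {0..1}))"
  have I_int: "integrable lborel (\<lambda>y. kern \<delta> y * u (x + y))" if "good u" for u x
    by (rule kern_shift_integrable[where B=1]) (use that \<delta> in \<open>auto simp: good_def\<close>)
  have I_mono: "I u x \<le> I v x" if "good u" "good v" "\<And>x. u x \<le> v x" for u v x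
    unfolding I_def using that by (intro integral_mono I_int mult_left_mono) auto
  have I01: "0 \<le> I u x" "I u x \<le> \<Lambda>" if "good u" for u x
  proof -
    show "0 \<le> I u x" unfolding I_def using that by (intro integral_nonneg_AE AE_I2) (auto simp: good_def)
    show "I u x \<le> \<Lambda>" unfolding I_def \<Lambda>_def
      using that by (intro integral_mono I_int kern_integrable \<delta> mult_left_le) (auto simp: good_def)
  qed
  have s_mono: "C * v1 - f x v1 \<le> C * v2 - f x v2" if "x \<in> D" "v1 \<in> {0..1}" "v2 \<in> {0..1}" "v1 \<le> v2" for x v1 v2
    using fL[OF that(1-3)] that(4) by (simp add: algebra_simps abs_if split: if_splits)
  have T_mono: "T u x \<le> T v x" if "good u" "good v" "\<And>x. u x \<le> v x" for u v x
  proof (cases "x \<in> D")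
    case True
    have "I u x + (C * u x - f x (u x)) \<le> I v x + (C * v x - f x (v x))"
      using that True by (intro add_mono I_mono s_mono) (auto simp: good_def)
    then show ?thesis using True \<Lambda> C by (simp add: T_def divide_right_mono)
  qed (simp add: T_def)
  have T_good: "good (T u)" if "good u" for u
  proof -
    have [measurable]: "u \<in> borel_measurable borel" using that by (simp add: good_def)
    have [measurable]: "I u \<in> borel_measurable borel"
      unfolding I_def by (rule lborel.borel_measurable_lebesgue_integral) measurable
    have [measurable]: "(\<lambda>x. indicator D x * f x (u x)) \<in> borel_measurable borel"
      using that by (intro f_comp_measurable) (auto simp: good_def)
    have "T u = (\<lambda>x. if x \<in> D then (I u x + C * u x - indicator D x * f x (u x)) / (\<Lambda> + C) else indicator (closure D1) x)"
      by (auto simp: T_def fun_eq_iff)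
    also have "\<dots> \<in> borel_measurable borel" by measurable
    finally have "T u \<in> borel_measurable borel" .
    moreover have "T u x \<in> {0..1}" for x
    proof (cases "x \<in> D")
      case True
      have "0 \<le> C * u x - f x (u x)" using s_mono[OF True, of 0 "u x"] that f_zero[OF True] by (auto simp: good_def)
      moreover have "C * u x \<le> C" "0 \<le> f x (u x)"
        using that C f_nonneg[OF True, of "u x"] by (auto simp: good_def mult_left_le)
      moreover note I01[OF that, of x]
      ultimately have "0 \<le> I u x + C * u x - f x (u x)" "I u x + C * u x - f x (u x) \<le> \<Lambda> + C" by linarith+
      then show ?thesis using True \<Lambda> C by (simp add: T_def)
    qed (auto simp: T_def indicator_def)
    ultimately show ?thesis by (simp add: good_def)
  qed
  \<comment> \<open>The starting function has the prescribed values off \<open>D\<close> and the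
    least admissible value 0 on \<open>D\<close>, so its first iterate lies above it.\<close>
  define U where "U = (\<lambda>n. (T ^^ n) (indicator (closure D1)))"
  have U0: "good (U 0)" by (auto simp: U_def good_def indicator_def)
  have US: "U (Suc n) = T (U n)" for n by (simp add: U_def)
  have U_good: "good (U n)" for n by (induction n) (use U0 T_good US in auto)
  have U_inc: "U n x \<le> U (Suc n) x" for n x
  proof (induction n arbitrary: x)
    case 0
    have "0 \<le> U (Suc 0) x" using U_good[of "Suc 0"] by (auto simp: good_def)
    then show ?case by (auto simp: US T_def U_def indicator_def D_def)
  next
    case (Suc n)
    then show ?case unfolding US[of "Suc n"] US[of n] by (intro T_mono T_good U_good) (auto simp: US)
  qed
  define u where "u = (\<lambda>x. SUP n. U n x)"
  have U_lim: "(\<lambda>n. U n x) \<longlonglongrightarrow> u x" for x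
    unfolding u_def using U_inc U_good
    by (intro LIMSEQ_incseq_SUP incseq_SucI) (auto simp: good_def intro!: bdd_aboveI[of _ 1])
  have u01: "u x \<in> {0..1}" for x
    using U_lim[of x] U_good LIMSEQ_le_const[of "\<lambda>n. U n x" "u x" 0] LIMSEQ_le_const2[of "\<lambda>n. U n x" "u x" 1]
    by (auto simp: good_def)
  have um[measurable]: "u \<in> borel_measurable borel"
  proof (rule borel_measurable_LIMSEQ_real[where u=U])
    show "U n \<in> borel_measurable borel" for n using U_good[of n] by (simp add: good_def)
  qed (rule U_lim)
  have uout: "u x = indicator (closure D1) x" if "x \<notin> D" for x
  proof -
    have "U n x = indicator (closure D1) x" for n
      using that by (cases n) (auto simp: U_def T_def)
    then have "(\<lambda>n. U n x) \<longlonglongrightarrow> indicator (closure D1) x" by simp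
    then show ?thesis using LIMSEQ_unique[OF U_lim] by simp
  qed
  have "gen \<delta> u x = f x (u x)" if x: "x \<in> D" for x
  proof -
    have "(\<lambda>n. I (U n) x) \<longlonglongrightarrow> I u x"
      unfolding I_def
    proof (rule integral_dominated_convergence[where w="kern \<delta>"])
      show "AE y in lborel. (\<lambda>n. kern \<delta> y * U n (x + y)) \<longlonglongrightarrow> kern \<delta> y * u (x + y)"
        using U_lim by (auto intro!: tendsto_mult)
      show "\<And>n. AE y in lborel. norm (kern \<delta> y * U n (x + y)) \<le> kern \<delta> y"
        using U_good by (auto simp: good_def abs_mult intro!: mult_left_le)
      have "U n \<in> borel_measurable borel" for n using U_good by (auto simp: good_def)
      note this[measurable]
      show "(\<lambda>y. kern \<delta> y * U n (x + y)) \<in> borel_measurable lborel" for n by measurable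
    qed (use kern_integrable \<delta> in auto)
    moreover have "(\<lambda>n. f x (U n x)) \<longlonglongrightarrow> f x (u x)"
    proof -
      have "(\<lambda>n. C * \<bar>U n x - u x\<bar>) \<longlonglongrightarrow> C * \<bar>u x - u x\<bar>"
        by (intro tendsto_intros U_lim)
      then have lim0: "(\<lambda>n. C * \<bar>U n x - u x\<bar>) \<longlonglongrightarrow> 0" by (simp only: diff_self abs_zero mult_zero_right)
      have "norm (f x (U n x) - f x (u x)) \<le> C * \<bar>U n x - u x\<bar>" for n
        using fL[OF x, of "U n x" "u x"] U_good[of n] u01[of x] by (simp add: good_def)
      then have "(\<lambda>n. f x (U n x) - f x (u x)) \<longlonglongrightarrow> 0"
        by (intro Lim_null_comparison[OF _ lim0] always_eventually allI)
      then show ?thesis by (rule LIM_zero_cancel)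
    qed
    ultimately have "(\<lambda>n. (I (U n) x + C * U n x - f x (U n x)) / (\<Lambda> + C)) \<longlonglongrightarrow> (I u x + C * u x - f x (u x)) / (\<Lambda> + C)"
      using \<Lambda> C by (intro tendsto_divide tendsto_diff tendsto_add tendsto_mult tendsto_const U_lim) (assumption | linarith)+
    then have "(\<lambda>n. U (Suc n) x) \<longlonglongrightarrow> (I u x + C * u x - f x (u x)) / (\<Lambda> + C)"
      using x by (simp only: US T_def if_True)
    with LIMSEQ_Suc[OF U_lim[of x]] have "u x = (I u x + C * u x - f x (u x)) / (\<Lambda> + C)"
      using LIMSEQ_unique by blast
    then have "u x * (\<Lambda> + C) = I u x + C * u x - f x (u x)" using \<Lambda> C by (simp add: field_simps)
    moreover have "gen \<delta> u x = I u x - u x * \<Lambda>"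
      unfolding I_def \<Lambda>_def using u01 \<delta> by (intro gen_eq[where B=1]) auto
    ultimately show ?thesis by (simp add: algebra_simps)
  qed
  moreover have "u x = 0" if "x \<notin> D0" for x
  proof -
    have "x \<notin> D" "x \<notin> closure D1" using that closure_D1 by (auto simp: D_def)
    then show ?thesis using uout by simp
  qed
  moreover have "u x = 1" if "x \<in> closure D1" for x using uout[of x] that by (auto simp: D_def)
  ultimately have "is_approx \<delta> u" using u01 by (auto simp: is_approx_def)
  then show ?thesis by blast
qed

end

section \<open>Passing to the limit\<close>

context ring_problem
begin

text \<open>A multiple of the cone barrier dominates \<open>u\<close> near outer frontier points and
  \<open>1 - u\<close> near inner ones. Uniformity in \<delta> and in \<open>z\<close> comes from
  that of the cones and of the barrier constants.\<close>

lemma approx_boundary: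
  assumes \<eta>: "0 < \<eta>"
  obtains r where "0 < r"
    "\<And>\<delta> u x z. 0 < \<delta> \<Longrightarrow> \<delta> < r \<Longrightarrow> is_approx \<delta> u \<Longrightarrow> z \<in> frontier D \<Longrightarrow> norm (x - z) < r \<Longrightarrow>
      \<bar>u x - (if z \<in> D0 then 1 else 0)\<bar> \<le> \<eta>"
proof -
  obtain \<kappa> h where \<kappa>: "0 < \<kappa>" "\<kappa> < 1" "0 < h"
    and cones: "\<And>z. z \<in> frontier D \<Longrightarrow> \<exists>e. norm e = 1 \<and> (z \<notin> D0 \<longrightarrow> finite_cone \<kappa> h e z \<inter> D0 = {}) \<and>
       (z \<in> D0 \<longrightarrow> z \<in> closure D1 \<and> finite_cone \<kappa> h e z \<subseteq> closure D1)"
    using exterior_cones by metis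
  obtain \<beta> r0 c where \<beta>: "0 < \<beta>" and r0: "0 < r0" and c: "0 < c" and barrier:
    "\<And>(z::'a) e \<delta> x. norm e = 1 \<Longrightarrow> 0 < \<delta> \<Longrightarrow> \<delta> < r0 \<Longrightarrow> norm (x - z) < r0 \<Longrightarrow>
      x \<notin> finite_cone \<kappa> h e z \<Longrightarrow> gen \<delta> (barrier \<beta> \<delta> (finite_cone \<kappa> h e z) z) x \<le> - c"
    using barrier_supersolution[OF \<kappa>] by metis
  obtain d where d: "0 < d" "\<And>x y. x \<in> closure D1 \<Longrightarrow> y \<notin> D0 \<Longrightarrow> d \<le> dist x y" using gap by blast
  obtain F where F: "0 < F" "\<And>x v. x \<in> D \<Longrightarrow> v \<in> {0..1} \<Longrightarrow> f x v \<le> F" using f_upper by blast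
  obtain S k where S: "S \<in> sets borel" "S \<inter> D0 = {}" and k: "0 < k"
    "\<And>x \<delta>. x \<in> D0 \<Longrightarrow> 0 < \<delta> \<Longrightarrow> \<delta> \<le> 1 \<Longrightarrow> k \<le> (LBINT y. kern \<delta> y * indicator S (x + y))"
    using killing_set by blast
  define r1 where "r1 = min 1 (min r0 d)"
  have r1: "0 < r1" "r1 \<le> 1" "r1 \<le> r0" "r1 \<le> d" using r0 d by (auto simp: r1_def)
  \<comment> \<open>\<open>F \<le> A * c\<close> lets the barrier outweigh the source, and
    \<open>1 \<le> A * r1 powr \<beta>\<close> lets it dominate every function with values in [0,1]
    at distance at least \<open>r1\<close> from \<open>z\<close>.\<close>
  define A where "A = max (F / c) (1 / r1 powr \<beta>)"
  have A: "0 < A" "F \<le> A * c" "1 \<le> A * r1 powr \<beta>"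
  proof -
    have "F / c \<le> A" "1 / r1 powr \<beta> \<le> A" unfolding A_def by (rule max.cobounded1, rule max.cobounded2)
    moreover have "0 < F / c" using F c by simp
    ultimately have "0 < A" by linarith
    with \<open>F / c \<le> A\<close> \<open>1 / r1 powr \<beta> \<le> A\<close> show "0 < A" "F \<le> A * c" "1 \<le> A * r1 powr \<beta>"
      using c r1 by (simp_all add: pos_divide_le_eq)
  qed
  \<comment> \<open>Here \<open>v\<close> stands for \<open>u\<close> or for \<open>1 - u\<close>.
    It vanishes on the complementary piece containing \<open>z\<close>, and the other piece is at
    distance at least \<open>d\<close> and misses the cone.\<close>
  have key: "v x \<le> A * ((norm (x - z))\<^sup>2 + \<delta>\<^sup>2) powr (\<beta> / 2)"
    if \<delta>: "0 < \<delta>" "\<delta> < r1" and vm[measurable]: "v \<in> borel_measurable borel" and v01: "\<And>x. v x \<in> {0..1}"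
      and gv: "\<And>x. x \<in> D \<Longrightarrow> - F \<le> gen \<delta> v x" and e: "norm e = 1" and DC: "D \<inter> finite_cone \<kappa> h e z = {}"
      and out: "\<And>x. x \<notin> D \<Longrightarrow> v x = 0 \<or> (d \<le> norm (x - z) \<and> x \<notin> finite_cone \<kappa> h e z)"
    for v z x e \<delta>
  proof -
    let ?b = "barrier \<beta> \<delta> (finite_cone \<kappa> h e z) z"
    let ?G = "D \<inter> ball z r1"
    have [measurable]: "finite_cone \<kappa> h e z \<in> sets borel" unfolding finite_cone_def by measurable
    have bm[measurable]: "?b \<in> borel_measurable borel" unfolding barrier_def by measurable
    have b01: "0 \<le> ?b x" "?b x \<le> 1" for x by (auto simp: barrier_def)
    have "(v x - A * ?b x) \<le> 0 + 0 / k"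
    proof (rule comparison[where \<delta>=\<delta> and G="?G" and S=S and B="1 + A"])
      show "\<bar>v x - A * ?b x\<bar> \<le> 1 + A" for x
      proof -
        have "A * ?b x \<le> A" "0 \<le> A * ?b x" using b01[of x] A by (auto intro: mult_left_le)
        moreover have "0 \<le> v x" "v x \<le> 1" using v01[of x] by auto
        ultimately show ?thesis using A(1) unfolding abs_le_iff by linarith
      qed
      show "v x - A * ?b x \<le> 0" if "x \<notin> ?G" for x
      proof (cases "v x = 0")
        case True then show ?thesis using A b01[of x] by simp
      next
        case False
        have xc: "x \<notin> finite_cone \<kappa> h e z" "r1 \<le> norm (x - z)"
          using that out[of x] False DC r1 by (auto simp: dist_norm norm_minus_commute)
        have "(r1\<^sup>2) powr (\<beta> / 2) \<le> ((norm (x - z))\<^sup>2 + \<delta>\<^sup>2) powr (\<beta> / 2)"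
          using xc r1 \<beta> by (intro powr_mono2) (auto intro: order_trans[OF power_mono])
        moreover have "(r1\<^sup>2) powr (\<beta> / 2) = r1 powr \<beta>" using r1 by (simp add: powr_powr flip: powr_numeral)
        moreover have "r1 powr \<beta> \<le> 1" using r1 \<beta> by (intro powr_le1) auto
        ultimately have "r1 powr \<beta> \<le> ?b x" using xc by (simp add: barrier_def)
        then have "A * r1 powr \<beta> \<le> A * ?b x" using A by (intro mult_left_mono) auto
        then show ?thesis using A(3) v01[of x] by simp
      qed
      show "- 0 \<le> gen \<delta> (\<lambda>x. v x - A * ?b x) x" if "x \<in> ?G" for x
      proof -
        have "gen \<delta> (\<lambda>x. v x - A * ?b x) x = gen \<delta> v x - A * gen \<delta> ?b x"
          using v01 b01 by (intro gen_diff_scaled[OF \<delta>(1) vm _ bm, where B=1 and B'=1]) auto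
        moreover have "gen \<delta> ?b x \<le> - c"
          using that DC r1 \<delta> by (intro barrier e) (auto simp: dist_norm norm_minus_commute)
        then have "A * gen \<delta> ?b x \<le> A * (- c)" using A by (intro mult_left_mono) auto
        ultimately show ?thesis using gv[of x] that A(2) by simp
      qed
      show "k \<le> (LBINT y. kern \<delta> y * indicator S (x + y))" if "x \<in> ?G" for x
        using that \<delta> r1 by (intro k) (auto simp: D_def)
      show "S \<inter> ?G = {}" using S by (auto simp: D_def)
    qed (use \<delta> S k in auto)
    then have "v x \<le> A * ?b x" by simp
    also have "\<dots> \<le> A * ((norm (x - z))\<^sup>2 + \<delta>\<^sup>2) powr (\<beta> / 2)"
      using A by (intro mult_left_mono) (auto simp: barrier_def)
    finally show ?thesis .
  qed
  \<comment> \<open>Solves \<open>(2 * q) powr \<beta> = \<eta> / A\<close>; the factor 2 makes room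
    for \<delta>^2 beside |x - z|^2.\<close>
  define q where "q = (\<eta> / A) powr (1 / \<beta>) / 2"
  have q: "0 < q" using \<eta> A by (simp add: q_def)
  define r where "r = min r1 q"
  have r: "0 < r" "r \<le> r1" "r \<le> q" using r1 q by (auto simp: r_def)
  have small: "A * ((norm (x - z))\<^sup>2 + \<delta>\<^sup>2) powr (\<beta> / 2) \<le> \<eta>" if "0 < \<delta>" "\<delta> < r" "norm (x - z) < r" for x z :: 'a and \<delta>
  proof -
    have sqp: "(s\<^sup>2) powr (\<beta> / 2) = s powr \<beta>" if "0 < s" for s :: real
      using that by (simp add: powr_powr flip: powr_numeral)
    have "(norm (x - z))\<^sup>2 + \<delta>\<^sup>2 \<le> q\<^sup>2 + q\<^sup>2" using that r by (intro add_mono power_mono) auto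
    also have "\<dots> \<le> (2 * q)\<^sup>2" by (simp add: power2_eq_square)
    finally have "(norm (x - z))\<^sup>2 + \<delta>\<^sup>2 \<le> (2 * q)\<^sup>2" .
    then have "((norm (x - z))\<^sup>2 + \<delta>\<^sup>2) powr (\<beta> / 2) \<le> ((2 * q)\<^sup>2) powr (\<beta> / 2)"
      using \<beta> by (intro powr_mono2) auto
    also have "((2 * q)\<^sup>2) powr (\<beta> / 2) = (2 * q) powr \<beta>" using q by (intro sqp) simp
    also have "\<dots> = \<eta> / A" using \<eta> A \<beta> by (simp add: q_def powr_powr)
    finally have "A * ((norm (x - z))\<^sup>2 + \<delta>\<^sup>2) powr (\<beta> / 2) \<le> A * (\<eta> / A)"
      using A by (intro mult_left_mono) auto
    then show ?thesis using A by simp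
  qed
  have "\<bar>u x - (if z \<in> D0 then 1 else 0)\<bar> \<le> \<eta>"
    if \<delta>: "0 < \<delta>" "\<delta> < r" and u: "is_approx \<delta> u" and z: "z \<in> frontier D" and x: "norm (x - z) < r" for u x z \<delta>
  proof -
    obtain e where e: "norm e = 1" and C0: "z \<notin> D0 \<Longrightarrow> finite_cone \<kappa> h e z \<inter> D0 = {}" and
       C1: "z \<in> D0 \<Longrightarrow> z \<in> closure D1 \<and> finite_cone \<kappa> h e z \<subseteq> closure D1" using cones[OF z] by blast
    have um: "u \<in> borel_measurable borel" and u01: "\<And>x. u x \<in> {0..1}" and u0: "\<And>x. x \<notin> D0 \<Longrightarrow> u x = 0"
      and u1: "\<And>x. x \<in> closure D1 \<Longrightarrow> u x = 1" and ug: "\<And>x. x \<in> D \<Longrightarrow> gen \<delta> u x = f x (u x)"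
      using u by (auto simp: is_approx_def)
    have \<delta>1: "\<delta> < r1" using \<delta> r by simp
    show ?thesis
    proof (cases "z \<in> D0")
      case False
      have "u x \<le> A * ((norm (x - z))\<^sup>2 + \<delta>\<^sup>2) powr (\<beta> / 2)"
      proof (rule key[OF \<delta>(1) \<delta>1 um u01 _ e])
        show "- F \<le> gen \<delta> u x" if "x \<in> D" for x
          using ug[OF that] f_nonneg[OF that u01[of x]] F(1) by simp
        show "D \<inter> finite_cone \<kappa> h e z = {}" using C0[OF False] by (auto simp: D_def)
        fix x assume "x \<notin> D"
        then consider "x \<notin> D0" | "x \<in> closure D1" by (auto simp: D_def)
        then show "u x = 0 \<or> (d \<le> norm (x - z) \<and> x \<notin> finite_cone \<kappa> h e z)"
        proof cases
          case 2
          then have "x \<notin> finite_cone \<kappa> h e z" using C0[OF False] closure_D1 by auto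
          then show ?thesis using d(2)[OF 2 False] by (simp add: dist_norm)
        qed (use u0 in simp)
      qed
      then show ?thesis using small[OF \<delta> x] u01[of x] False by simp
    next
      case True
      have "1 - u x \<le> A * ((norm (x - z))\<^sup>2 + \<delta>\<^sup>2) powr (\<beta> / 2)"
      proof (rule key[OF \<delta>(1) \<delta>1 _ _ _ e])
        show "(\<lambda>x. 1 - u x) \<in> borel_measurable borel" using um by measurable
        show "1 - u x \<in> {0..1}" for x using u01[of x] by simp
        show "- F \<le> gen \<delta> (\<lambda>x. 1 - u x) x" if "x \<in> D" for x
          using ug[OF that] F(2)[OF that u01[of x]] by (simp add: gen_one_minus)
        show "D \<inter> finite_cone \<kappa> h e z = {}" using C1[OF True] by (auto simp: D_def)
        fix x assume "x \<notin> D"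
        then consider "x \<notin> D0" | "x \<in> closure D1" by (auto simp: D_def)
        then show "1 - u x = 0 \<or> (d \<le> norm (x - z) \<and> x \<notin> finite_cone \<kappa> h e z)"
        proof cases
          case 1
          then have "x \<notin> finite_cone \<kappa> h e z" using C1[OF True] closure_D1 by auto
          then show ?thesis using d(2)[of z x] C1[OF True] 1 by (simp add: dist_norm norm_minus_commute)
        qed (use u1 in simp)
      qed
      then show ?thesis using small[OF \<delta> x] u01[of x] True by simp
    qed
  qed
  then show thesis using that r by blast
qed

text \<open>Translation comparison: the boundary modulus of continuity propagates to the interior.\<close>

lemma approx_equicontinuous:
  assumes \<eta>: "0 < \<eta>"
  obtains r where "0 < r"
    "\<And>\<delta> u x h. 0 < \<delta> \<Longrightarrow> \<delta> < r \<Longrightarrow> is_approx \<delta> u \<Longrightarrow> norm h < r \<Longrightarrow> u (x + h) \<le> u x + \<eta>"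
proof -
  obtain r1 where r1: "0 < r1" and bdry: "\<And>\<delta> u x z. 0 < \<delta> \<Longrightarrow> \<delta> < r1 \<Longrightarrow> is_approx \<delta> u \<Longrightarrow> z \<in> frontier D \<Longrightarrow>
      norm (x - z) < r1 \<Longrightarrow> \<bar>u x - (if z \<in> D0 then 1 else 0)\<bar> \<le> \<eta> / 4"
    using approx_boundary[of "\<eta> / 4"] \<eta> by auto
  obtain d where d: "0 < d" "\<And>x y. x \<in> closure D1 \<Longrightarrow> y \<notin> D0 \<Longrightarrow> d \<le> dist x y" using gap by blast
  obtain S k where S: "S \<in> sets borel" "S \<inter> D0 = {}" and k: "0 < k"
    "\<And>x \<delta>. x \<in> D0 \<Longrightarrow> 0 < \<delta> \<Longrightarrow> \<delta> \<le> 1 \<Longrightarrow> k \<le> (LBINT y. kern \<delta> y * indicator S (x + y))"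
    using killing_set by blast
  \<comment> \<open>Two layers: a point of \<open>G\<close> shifted by less than r1/4 stays in
    \<open>D\<close> and at distance at least r1/4 from the frontier. Thus \<open>x\<close> and
    \<open>x + h\<close> both lie in the compact set \<open>K\<close> below, where \<open>f\<close>
    is uniformly continuous, although it need not be so up to the frontier.\<close>
  define G where "G = {x\<in>D. \<forall>z\<in>frontier D. r1 / 2 \<le> dist x z}"
  define K where "K = {x\<in>D. \<forall>z\<in>frontier D. r1 / 4 \<le> dist x z}"
  have "K = closure D \<inter> (\<Inter>z\<in>frontier D. {x. r1 / 4 \<le> dist x z})"
  proof (intro equalityI subsetI)
    fix x assume x: "x \<in> closure D \<inter> (\<Inter>z\<in>frontier D. {x. r1 / 4 \<le> dist x z})"
    have "x \<notin> frontier D"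
    proof
      assume "x \<in> frontier D"
      with x have "r1 / 4 \<le> dist x x" by blast
      then show False using r1 by simp
    qed
    then show "x \<in> K" using x by (auto simp: K_def frontier_def interior_open[OF open_D])
  qed (use closure_subset[of D] in \<open>auto simp: K_def\<close>)
  moreover have "closed {x. r1 / 4 \<le> dist x z}" for z :: 'a
    by (intro closed_Collect_le continuous_intros)
  ultimately have "compact K"
    using bounded_D by (auto simp: compact_eq_bounded_closed intro!: bounded_Int closed_Int closed_INT)
  then have "uniformly_continuous_on (K \<times> {0..1}) (\<lambda>(x, v). f x v)"
    by (intro compact_uniformly_continuous continuous_on_subset[OF f_cont] compact_Times) (auto simp: K_def)
  \<comment> \<open>\<open>comparison\<close> divides the error by \<open>k\<close>, so the interior
    contributes \<eta>/2. The frontier layer contributes \<eta>/4 for each of the two points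
    compared.\<close>
  moreover have "0 < k * \<eta> / 2" using k \<eta> by simp
  ultimately obtain r2 where r2: "0 < r2" and uc: "\<And>p q. p \<in> K \<times> {0..1} \<Longrightarrow> q \<in> K \<times> {0..1} \<Longrightarrow> dist q p < r2 \<Longrightarrow>
      dist (case q of (x, v) \<Rightarrow> f x v) (case p of (x, v) \<Rightarrow> f x v) < k * \<eta> / 2"
    unfolding uniformly_continuous_on_def by metis
  define r where "r = min (min 1 (r1 / 4)) (min d r2)"
  have r: "0 < r" "r \<le> 1" "r \<le> r1 / 4" "r \<le> d" "r \<le> r2" using r1 r2 d by (auto simp: r_def)
  have "u (x + h) \<le> u x + \<eta>" if \<delta>: "0 < \<delta>" "\<delta> < r" and u: "is_approx \<delta> u" and h: "norm h < r" for u x h \<delta>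
  proof -
    have um[measurable]: "u \<in> borel_measurable borel" and u01: "\<And>x. u x \<in> {0..1}" and u0: "\<And>x. x \<notin> D0 \<Longrightarrow> u x = 0"
      and u1: "\<And>x. x \<in> closure D1 \<Longrightarrow> u x = 1" and ug: "\<And>x. x \<in> D \<Longrightarrow> gen \<delta> u x = f x (u x)"
      using u by (auto simp: is_approx_def)
    have near: "u (x + h) \<le> u x + \<eta> / 2" if z: "z \<in> frontier D" "norm (x - z) < r1" "norm (x + h - z) < r1" for x z
    proof -
      have "\<delta> < r1" using \<delta> r r1 by linarith
      from bdry[OF \<delta>(1) this u z(1,2)] bdry[OF \<delta>(1) this u z(1,3)]
      show ?thesis unfolding abs_le_iff by linarith
    qed
    have out: "u (x + h) \<le> u x + \<eta> / 2" if xG: "x \<notin> G" for x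
    proof (cases "x \<in> D")
      case True
      then obtain z where z: "z \<in> frontier D" "dist x z < r1 / 2" using xG by (auto simp: G_def not_le)
      have "norm (x + h - z) \<le> norm (x - z) + norm h"
        using norm_triangle_ineq[of "x - z" h] by (simp add: algebra_simps)
      then show ?thesis using z h r r1 by (intro near[OF z(1)]) (auto simp: dist_norm)
    next
      case x: False
      show ?thesis
      proof (cases "x + h \<in> D")
        case True
        obtain z where "z \<in> frontier D" "dist (x + h) z \<le> dist (x + h) x" "dist x z \<le> dist (x + h) x"
          using frontier_crossing[OF True x] by blast
        then show ?thesis using h r r1 by (intro near[of z]) (auto simp: dist_norm)
      next
        case False
        show ?thesis
        proof (cases "x \<in> closure D1")
          case True
          then show ?thesis using u1[OF True] u01[of "x + h"] \<eta> by simp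
        next
          case x1: False
          then have "x \<notin> D0" using x by (simp add: D_def)
          then have "x + h \<notin> closure D1" using d(2)[of "x + h" x] h r by (auto simp: dist_norm)
          then have "u (x + h) = 0" using False u0 by (auto simp: D_def)
          then show ?thesis using u01[of x] \<eta> by simp
        qed
      qed
    qed
    have "u (x + h) - u x \<le> \<eta> / 2 + (k * \<eta> / 2) / k"
    proof (rule comparison[where \<delta>=\<delta> and G=G and S=S and B=1 and w="\<lambda>x. u (x + h) - u x"])
      show "\<bar>u (x + h) - u x\<bar> \<le> 1" for x using u01[of x] u01[of "x + h"] by auto
      show "u (x + h) - u x \<le> \<eta> / 2" if "x \<notin> G" for x using out[OF that] by simp
      show "S \<inter> G = {}" using S by (auto simp: G_def D_def)
      show "k \<le> (LBINT y. kern \<delta> y * indicator S (x + y))" if "x \<in> G" for x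
        using that \<delta> r by (intro k) (auto simp: G_def D_def)
      show "- (k * \<eta> / 2) \<le> gen \<delta> (\<lambda>x. u (x + h) - u x) x" if x: "x \<in> G" and w: "\<eta> / 2 < u (x + h) - u x" for x
      proof -
        have xD: "x \<in> D" "x \<in> K" using x r1 by (force simp: G_def K_def)+
        have far: "r1 / 4 \<le> dist (x + h) z" if "z \<in> frontier D" for z
        proof -
          have "r1 / 2 \<le> dist x z" using x that by (auto simp: G_def)
          also have "\<dots> \<le> dist (x + h) z + norm h"
            using dist_triangle[of x z "x + h"] by (simp add: dist_norm)
          finally show ?thesis using h r by simp
        qed
        have xhD: "x + h \<in> D"
        proof (rule ccontr)
          assume "x + h \<notin> D"
          then obtain z where "z \<in> frontier D" "dist x z \<le> dist x (x + h)" using frontier_crossing[OF xD(1)] by blast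
          then show False using x h r r1 by (fastforce simp: G_def dist_norm)
        qed
        then have xhK: "x + h \<in> K" using far by (auto simp: K_def)
        have "gen \<delta> (\<lambda>x. u (x + h) - 1 * u x) x = gen \<delta> (\<lambda>x. u (x + h)) x - 1 * gen \<delta> u x"
          using u01 by (intro gen_diff_scaled[OF \<delta>(1), where B=1 and B'=1]) auto
        then have "gen \<delta> (\<lambda>x. u (x + h) - u x) x = f (x + h) (u (x + h)) - f x (u x)"
          using ug[OF xD(1)] ug[OF xhD] by (simp add: gen_translate)
        \<comment> \<open>Only points with \<open>u x < u (x + h)\<close> matter. There monotonicity
          in the second argument lets both terms be compared at the common value \<open>u x\<close>,
          leaving just the modulus of \<open>f\<close> in \<open>x\<close>.\<close>
        moreover have "f (x + h) (u x) \<le> f (x + h) (u (x + h))"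
          using u01 w \<eta> by (intro f_mono[OF xhD]) auto
        moreover have "\<bar>f (x + h) (u x) - f x (u x)\<bar> < k * \<eta> / 2"
          using uc[of "(x, u x)" "(x + h, u x)"] xD xhK u01[of x] h r by (auto simp: dist_Pair_Pair dist_norm)
        ultimately show ?thesis by linarith
      qed
    qed (use \<delta> S k \<eta> in auto)
    then show ?thesis using k by (simp add: field_simps)
  qed
  then show thesis using that r by blast
qed

text \<open>The approximants are not known to be continuous, and their oscillation is controlled
  only once \<delta> is below the radius in question. The Arzela-Ascoli argument is therefore
  carried out directly: a subsequence converges on a countable dense set, and the asymptotic
  equicontinuity yields convergence everywhere and continuity of the limit.\<close>

lemma approx_limit:
  obtains \<delta> U u where "\<And>n. 0 < \<delta> n" "\<delta> \<longlonglongrightarrow> 0" "\<And>n. is_approx (\<delta> n) (U n)" "\<And>x. (\<lambda>n. U n x) \<longlonglongrightarrow> u x" "continuous_on UNIV u"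
proof -
  obtain Q :: "'a set" where Q: "countable Q" "\<And>X. open X \<Longrightarrow> X \<noteq> {} \<Longrightarrow> \<exists>q\<in>Q. q \<in> X"
    using countable_dense_setE by metis
  define \<delta>0 where "\<delta>0 = (\<lambda>n. inverse (real (Suc n)))"
  have "\<exists>V. \<forall>n. is_approx (\<delta>0 n) (V n)"
    using approx_exists by (intro choice) (auto simp: \<delta>0_def)
  then obtain V where V: "\<And>n. is_approx (\<delta>0 n) (V n)" by blast
  have V01: "V n x \<in> {0..1}" for n x using V by (auto simp: is_approx_def)
  obtain \<sigma> where \<sigma>: "strict_mono \<sigma>" "\<And>x. x \<in> Q \<Longrightarrow> \<exists>l. (\<lambda>n. V (\<sigma> n) x) \<longlonglongrightarrow> l"
  proof (rule function_convergent_subsequence[OF Q(1), of V 1])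
    show "norm (V n x) \<le> 1" for n x using V01[of n x] by auto
  qed blast
  define \<delta> where "\<delta> = \<delta>0 \<circ> \<sigma>"
  define U where "U = V \<circ> \<sigma>"
  have \<delta>pos: "0 < \<delta> n" for n by (simp add: \<delta>_def \<delta>0_def)
  have "\<delta>0 \<longlonglongrightarrow> 0" unfolding \<delta>0_def by (rule LIMSEQ_inverse_real_of_nat)
  then have \<delta>0: "\<delta> \<longlonglongrightarrow> 0" unfolding \<delta>_def using \<sigma>(1) by (rule LIMSEQ_subseq_LIMSEQ)
  have U: "is_approx (\<delta> n) (U n)" for n using V by (simp add: \<delta>_def U_def)
  have eq: "\<exists>r>0. \<exists>M. \<forall>n\<ge>M. \<forall>x y. dist x y < r \<longrightarrow> \<bar>U n x - U n y\<bar> \<le> \<eta>" if \<eta>: "0 < \<eta>" for \<eta>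
  proof -
    obtain r where r: "0 < r" "\<And>\<delta> u x h. 0 < \<delta> \<Longrightarrow> \<delta> < r \<Longrightarrow> is_approx \<delta> u \<Longrightarrow> norm h < r \<Longrightarrow> u (x + h) \<le> u x + \<eta>"
      using approx_equicontinuous[OF \<eta>] by blast
    obtain M where M: "\<And>n. n \<ge> M \<Longrightarrow> \<delta> n < r"
      using order_tendstoD(2)[OF \<delta>0 r(1)] by (auto simp: eventually_sequentially)
    have "\<bar>U n x - U n y\<bar> \<le> \<eta>" if "n \<ge> M" "dist x y < r" for n x y
      using r(2)[OF \<delta>pos M U, of n "x - y" y] r(2)[OF \<delta>pos M U, of n "y - x" x] that
      by (auto simp: dist_norm norm_minus_commute)
    then show ?thesis using r(1) by blast
  qed
  have conv: "convergent (\<lambda>n. U n x)" for x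
  proof -
    have "Cauchy (\<lambda>n. U n x)"
    proof (rule metric_CauchyI)
      fix e :: real assume e: "0 < e"
      then have "0 < e / 4" by simp
      from eq[OF this] obtain r M where r0: "0 < r" "\<forall>n\<ge>M. \<forall>x y. dist x y < r \<longrightarrow> \<bar>U n x - U n y\<bar> \<le> e / 4"
        by blast
      then have r: "0 < r" "\<And>n x y. n \<ge> M \<Longrightarrow> dist x y < r \<Longrightarrow> \<bar>U n x - U n y\<bar> \<le> e / 4" by blast+
      obtain q where q: "q \<in> Q" "q \<in> ball x r" using Q(2)[of "ball x r"] r by auto
      then obtain l where "(\<lambda>n. U n q) \<longlonglongrightarrow> l" using \<sigma>(2)[OF q(1)] by (auto simp: U_def)
      then have "Cauchy (\<lambda>n. U n q)" by (rule LIMSEQ_imp_Cauchy)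
      then obtain M' where M': "\<And>m n. m \<ge> M' \<Longrightarrow> n \<ge> M' \<Longrightarrow> dist (U m q) (U n q) < e / 4"
        using metric_CauchyD[of _ "e / 4"] e by (metis zero_less_divide_iff zero_less_numeral)
      have "dist (U m x) (U n x) < e" if "m \<ge> max M M'" "n \<ge> max M M'" for m n
      proof -
        have "\<bar>U m x - U m q\<bar> \<le> e / 4" "\<bar>U n x - U n q\<bar> \<le> e / 4" "\<bar>U m q - U n q\<bar> < e / 4"
          using r(2)[of m x q] r(2)[of n x q] M'[of m n] that q by (auto simp: dist_real_def)
        then show ?thesis using e unfolding dist_real_def abs_le_iff abs_less_iff by linarith
      qed
      then show "\<exists>M. \<forall>m\<ge>M. \<forall>n\<ge>M. dist (U m x) (U n x) < e" by blast
    qed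
    then show ?thesis by (simp add: Cauchy_convergent_iff)
  qed
  define u where "u = (\<lambda>x. lim (\<lambda>n. U n x))"
  have lim: "(\<lambda>n. U n x) \<longlonglongrightarrow> u x" for x using conv by (simp add: u_def convergent_LIMSEQ_iff)
  have "continuous_on UNIV u"
  proof (rule continuous_at_imp_continuous_on, intro ballI, unfold continuous_at_eps_delta, intro allI impI)
    fix x :: 'a and e :: real assume e: "0 < e"
    then have "0 < e / 2" by simp
    from eq[OF this] obtain r M where r0: "0 < r" "\<forall>n\<ge>M. \<forall>x y. dist x y < r \<longrightarrow> \<bar>U n x - U n y\<bar> \<le> e / 2"
      by blast
    then have r: "0 < r" "\<And>n x y. n \<ge> M \<Longrightarrow> dist x y < r \<Longrightarrow> \<bar>U n x - U n y\<bar> \<le> e / 2" by blast+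
    have "\<bar>u y - u x\<bar> \<le> e / 2" if "dist y x < r" for y
    proof (rule LIMSEQ_le_const2)
      show "(\<lambda>n. \<bar>U n y - U n x\<bar>) \<longlonglongrightarrow> \<bar>u y - u x\<bar>" by (intro tendsto_intros lim)
    qed (use r that in blast)
    then show "\<exists>d>0. \<forall>x'. dist x' x < d \<longrightarrow> dist (u x') (u x) < e"
      using r(1) e by (intro exI[of _ r]) (force simp: dist_real_def)
  qed
  then show thesis using that[of \<delta> U u] \<delta>pos \<delta>0 U lim by blast
qed

end

section \<open>Test functions and the distributional pairing\<close>

lemma frechet_derivative_zero_outside:
  fixes g :: "'a::euclidean_space \<Rightarrow> real"
  assumes g: "\<And>x. R < norm x \<Longrightarrow> g x = 0" and x: "R < norm x"
  shows "frechet_derivative g (at x) = (\<lambda>_. 0)"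
proof -
  have "(g has_derivative (\<lambda>_. 0)) (at x)"
  proof (rule has_derivative_transform_within_open[OF has_derivative_const])
    show "open {x::'a. R < norm x}" by (intro open_Collect_less continuous_intros)
  qed (use g x in auto)
  then show ?thesis by (metis frechet_derivative_at)
qed

lemma C1_compact_support_Lipschitz:
  fixes g :: "'a::euclidean_space \<Rightarrow> real"
  assumes g: "Ck 1 g" and supp: "\<And>x. R < norm x \<Longrightarrow> g x = 0"
  obtains M where "0 \<le> M" "\<And>x y. \<bar>g x - g y\<bar> \<le> M * norm (x - y)"
proof -
  have diff: "g differentiable_on UNIV" and cont: "\<And>b. b \<in> Basis \<Longrightarrow> continuous_on UNIV (\<lambda>x. frechet_derivative g (at x) b)"
    using g by auto
  let ?L = "\<lambda>x. frechet_derivative g (at x)"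
  have der: "(g has_derivative ?L x) (at x)" for x
    using diff by (simp add: differentiable_on_def frechet_derivative_works[symmetric])
  have "\<exists>B. \<forall>x. \<bar>?L x b\<bar> \<le> B" if b: "b \<in> Basis" for b
  proof (rule bounded_compact_support[OF cont[OF b], of R])
    show "?L x b = 0" if "R < norm x" for x
      using frechet_derivative_zero_outside[OF supp that] by simp
  qed blast
  then obtain B where B: "\<And>b x. b \<in> Basis \<Longrightarrow> \<bar>?L x b\<bar> \<le> B b" by metis
  let ?M = "\<Sum>b\<in>Basis. B b"
  have B0: "0 \<le> B b" if "b \<in> Basis" for b using B[OF that, of 0] by linarith
  have on: "onorm (?L x) \<le> ?M" for x
  proof (rule onorm_bound)
    show "0 \<le> ?M" using B0 by (rule sum_nonneg)
    fix v :: 'a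
    have lin: "linear (?L x)" using der has_derivative_linear by blast
    have "?L x v = ?L x (\<Sum>b\<in>Basis. (v \<bullet> b) *\<^sub>R b)" by (simp add: euclidean_representation)
    also have "\<dots> = (\<Sum>b\<in>Basis. (v \<bullet> b) * ?L x b)"
      using lin by (simp add: linear_sum linear_cmul)
    finally have "norm (?L x v) \<le> (\<Sum>b\<in>Basis. \<bar>v \<bullet> b\<bar> * \<bar>?L x b\<bar>)"
      using sum_abs[of "\<lambda>b. (v \<bullet> b) * ?L x b" Basis] by (simp add: abs_mult)
    also have "\<dots> \<le> (\<Sum>b\<in>Basis. norm v * B b)"
      using B by (intro sum_mono mult_mono) (auto simp: Basis_le_norm)
    finally show "norm (?L x v) \<le> ?M * norm v" by (simp add: sum_distrib_left mult.commute)
  qed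
  have "norm (g x - g y) \<le> ?M * norm (x - y)" for x y
    using der on by (intro differentiable_bound[of UNIV g ?L]) auto
  then show thesis using that[of ?M] B0 by (auto simp: sum_nonneg)
qed

definition sdiff :: "('a::real_vector \<Rightarrow> real) \<Rightarrow> 'a \<Rightarrow> 'a \<Rightarrow> real" where
  "sdiff \<phi> x y = \<phi> (x + y) + \<phi> (x - y) - 2 * \<phi> x"

text \<open>The mean value theorem along the segment turns the second difference into a difference
  of gradients at two points that are at most \<open>2 * norm y\<close> apart; the gradient is
  Lipschitz because its partial derivatives are bounded.\<close>

lemma sdiff_bound:
  fixes \<phi> :: "'a::euclidean_space \<Rightarrow> real"
  assumes ck: "Ck 2 \<phi>" and supp: "\<And>x. R < norm x \<Longrightarrow> \<phi> x = 0"
  obtains A where "0 \<le> A" "\<And>x y. \<bar>sdiff \<phi> x y\<bar> \<le> A * (norm y)\<^sup>2"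
proof -
  let ?L = "\<lambda>x. frechet_derivative \<phi> (at x)"
  have diff: "\<phi> differentiable_on UNIV" and c1: "\<And>b. b \<in> Basis \<Longrightarrow> Ck 1 (\<lambda>x. ?L x b)"
    using ck by (auto simp: numeral_2_eq_2)
  have der: "(\<phi> has_derivative ?L x) (at x)" for x
    using diff by (simp add: differentiable_on_def frechet_derivative_works[symmetric])
  have "\<exists>M. 0 \<le> M \<and> (\<forall>x y. \<bar>?L x b - ?L y b\<bar> \<le> M * norm (x - y))" if b: "b \<in> Basis" for b
  proof (rule C1_compact_support_Lipschitz[OF c1[OF b], of R])
    show "?L x b = 0" if "R < norm x" for x
      using frechet_derivative_zero_outside[OF supp that] by simp
    fix M assume "0 \<le> M" "\<And>x y. \<bar>?L x b - ?L y b\<bar> \<le> M * norm (x - y)"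
    then show ?thesis by blast
  qed
  then obtain M where M: "\<And>b. b \<in> Basis \<Longrightarrow> 0 \<le> M b" "\<And>b x y. b \<in> Basis \<Longrightarrow> \<bar>?L x b - ?L y b\<bar> \<le> M b * norm (x - y)"
    by metis
  let ?A = "2 * (\<Sum>b\<in>Basis. M b)"
  have "\<bar>sdiff \<phi> x y\<bar> \<le> ?A * (norm y)\<^sup>2" for x y
  proof -
    let ?p = "\<lambda>t. \<phi> (x + t *\<^sub>R y) + \<phi> (x - t *\<^sub>R y)"
    have D: "DERIV (\<lambda>t. \<phi> (x + t *\<^sub>R v)) t :> ?L (x + t *\<^sub>R v) v" for v t
    proof -
      have "((\<lambda>t. \<phi> (x + t *\<^sub>R v)) has_derivative (\<lambda>s. ?L (x + t *\<^sub>R v) (s *\<^sub>R v))) (at t)"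
        by (rule has_derivative_compose[OF _ der]) (auto intro!: derivative_eq_intros)
      moreover have "?L (x + t *\<^sub>R v) (s *\<^sub>R v) = ?L (x + t *\<^sub>R v) v * s" for s
        using has_derivative_linear[OF der] by (simp add: linear_cmul)
      ultimately show ?thesis by (simp add: has_field_derivative_def)
    qed
    have neg: "?L z (- y) = - ?L z y" for z using has_derivative_linear[OF der] by (simp add: linear_neg)
    have "DERIV ?p t :> ?L (x + t *\<^sub>R y) y - ?L (x - t *\<^sub>R y) y" for t
      using DERIV_add[OF D[of y t] D[of "- y" t]] by (simp add: neg)
    then obtain t where t: "0 < t" "t < 1" "?p 1 - ?p 0 = (1 - 0) * (?L (x + t *\<^sub>R y) y - ?L (x - t *\<^sub>R y) y)"
      using MVT2[of 0 1 ?p "\<lambda>t. ?L (x + t *\<^sub>R y) y - ?L (x - t *\<^sub>R y) y"] by auto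
    have exp: "?L z y = (\<Sum>b\<in>Basis. (y \<bullet> b) * ?L z b)" for z
    proof -
      have "?L z y = ?L z (\<Sum>b\<in>Basis. (y \<bullet> b) *\<^sub>R b)" by (simp add: euclidean_representation)
      also have "\<dots> = (\<Sum>b\<in>Basis. (y \<bullet> b) * ?L z b)"
        using has_derivative_linear[OF der] by (simp add: linear_sum linear_cmul)
      finally show ?thesis .
    qed
    have e: "sdiff \<phi> x y = (\<Sum>b\<in>Basis. (y \<bullet> b) * (?L (x + t *\<^sub>R y) b - ?L (x - t *\<^sub>R y) b))"
      using t(3) exp[of "x + t *\<^sub>R y"] exp[of "x - t *\<^sub>R y"]
      by (simp add: sdiff_def right_diff_distrib sum_subtractf)
    have "\<bar>sdiff \<phi> x y\<bar> \<le> (\<Sum>b\<in>Basis. \<bar>y \<bullet> b\<bar> * \<bar>?L (x + t *\<^sub>R y) b - ?L (x - t *\<^sub>R y) b\<bar>)"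
      unfolding e by (rule order_trans[OF sum_abs]) (simp only: abs_mult order_refl)
    also have "\<dots> \<le> (\<Sum>b\<in>Basis. norm y * (M b * (2 * norm y)))"
    proof (rule sum_mono)
      fix b :: 'a assume b: "b \<in> Basis"
      have d: "(x + t *\<^sub>R y) - (x - t *\<^sub>R y) = (2 * t) *\<^sub>R y"
        using scaleR_left.add[of t t y] by simp
      have n: "norm ((2 * t) *\<^sub>R y) \<le> 2 * norm y"
        using t mult_right_mono[of t 1 "norm y"] by simp
      have "\<bar>?L (x + t *\<^sub>R y) b - ?L (x - t *\<^sub>R y) b\<bar> \<le> M b * norm ((2 * t) *\<^sub>R y)"
        unfolding d[symmetric] by (rule M(2)[OF b])
      also have "\<dots> \<le> M b * (2 * norm y)"
        using n M(1)[OF b] by (rule mult_left_mono)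
      finally show "\<bar>y \<bullet> b\<bar> * \<bar>?L (x + t *\<^sub>R y) b - ?L (x - t *\<^sub>R y) b\<bar> \<le> norm y * (M b * (2 * norm y))"
        by (rule mult_mono[OF Basis_le_norm[OF b]]) auto
    qed
    also have "\<dots> = ?A * (norm y)\<^sup>2" by (simp add: sum_distrib_left sum_distrib_right power2_eq_square mult_ac)
    finally show ?thesis .
  qed
  moreover have "0 \<le> ?A" using M(1) by (simp add: sum_nonneg)
  ultimately show thesis using that by blast
qed

lemma test_function_bounds:
  fixes \<phi> :: "'a::euclidean_space \<Rightarrow> real"
  assumes "\<phi> \<in> test_functions D"
  obtains A B R where "0 \<le> A" "\<And>x y. \<bar>sdiff \<phi> x y\<bar> \<le> A * (norm y)\<^sup>2" "\<And>x. \<bar>\<phi> x\<bar> \<le> B" "\<And>x. R < norm x \<Longrightarrow> \<phi> x = 0"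
    "continuous_on UNIV \<phi>"
proof -
  have ck: "\<And>k. Ck k \<phi>" and comp: "compact (closure {x. \<phi> x \<noteq> 0})" using assms by (auto simp: test_functions_def)
  obtain R where R: "\<forall>x\<in>closure {x. \<phi> x \<noteq> 0}. norm x \<le> R" using compact_imp_bounded[OF comp] bounded_iff by blast
  then have R': "\<phi> x = 0" if "R < norm x" for x using that closure_subset[of "{x. \<phi> x \<noteq> 0}"] by force
  have cont: "continuous_on UNIV \<phi>" using ck[of 0] by simp
  obtain B where B: "\<And>x. \<bar>\<phi> x\<bar> \<le> B" using bounded_compact_support[OF cont R'] by blast
  show thesis
  proof (rule sdiff_bound[OF ck R'])
    fix A assume "0 \<le> A" "\<And>x y. \<bar>sdiff \<phi> x y\<bar> \<le> A * (norm y)\<^sup>2"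
    then show thesis by (rule that[OF _ _ B R' cont])
  qed
qed

lemma integrable_compact_support:
  fixes \<phi> :: "'a::euclidean_space \<Rightarrow> real"
  assumes [measurable]: "\<phi> \<in> borel_measurable borel" and B: "\<And>x. \<bar>\<phi> x\<bar> \<le> B" and R: "\<And>x. R < norm x \<Longrightarrow> \<phi> x = 0"
  shows "integrable lborel \<phi>"
proof (rule Bochner_Integration.integrable_bound[where f="\<lambda>x. B * indicator (cball 0 (max 0 R)) x"])
  show "integrable lborel (\<lambda>x::'a. B * indicator (cball 0 (max 0 R)) x)"
    by (intro integrable_mult_right) (simp add: emeasure_cball)
  have "\<bar>\<phi> x\<bar> \<le> B * indicator (cball 0 (max 0 R)) x" for x
    using B[of x] R[of x] by (auto simp: indicator_def not_le)
  then show "AE x in lborel. norm (\<phi> x) \<le> norm (B * indicator (cball 0 (max 0 R)) x)"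
    by (auto intro!: AE_I2 order_trans[OF _ abs_ge_self])
qed auto

section \<open>Removing the truncation on test functions\<close>

context fractional
begin

text \<open>For each \<epsilon> the two integrals differ by a translation and a nonzero factor, so
  they agree even when they take default values. Convergence is needed only to evaluate
  \<open>Lim\<close>.\<close>

lemma frac_laplacian_eq:
  fixes \<phi> :: "'a::euclidean_space \<Rightarrow> real"
  assumes "((\<lambda>\<delta>. gen \<delta> \<phi> x) \<longlongrightarrow> l) (at_right 0)"
  shows "frac_laplacian \<alpha> \<phi> x = - l"
proof -
  let ?c = "frac_const (real DIM('a)) \<alpha>"
  have c: "0 < ?c" by (rule frac_const_pos) simp
  have e: "(LINT y:{y. \<epsilon> < dist x y}|lborel. (\<phi> x - \<phi> y) / dist x y powr (real DIM('a) + \<alpha>)) = - (gen \<epsilon> \<phi> x / ?c)" for \<epsilon>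
  proof -
    let ?g = "\<lambda>y. indicator {y. \<epsilon> < dist x y} y *\<^sub>R ((\<phi> x - \<phi> y) / dist x y powr (real DIM('a) + \<alpha>))"
    have "(LINT y:{y. \<epsilon> < dist x y}|lborel. (\<phi> x - \<phi> y) / dist x y powr (real DIM('a) + \<alpha>)) = (LBINT y. ?g (x + y))"
      unfolding set_lebesgue_integral_def by (rule lborel_shift(1)[symmetric])
    also have "\<dots> = (LBINT y. (kern \<epsilon> y * (\<phi> (x + y) - \<phi> x)) * (- (1 / ?c)))"
    proof (rule Bochner_Integration.integral_cong)
      fix y :: 'a
      \<comment> \<open>No sign of \<epsilon> is assumed, so \<open>P\<close> may vanish, namely at
        \<open>y = 0\<close> for negative \<epsilon>; division by 0 then makes both sides 0.\<close>
      have q: "(a - b) / P = ?c / P * (b - a) * (- (1 / ?c))" for a b P :: real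
        using c by (cases "P = 0") (auto simp: field_simps)
      show "?g (x + y) = kern \<epsilon> y * (\<phi> (x + y) - \<phi> x) * (- (1 / ?c))"
      proof (cases "\<epsilon> < norm y")
        case True
        have "?g (x + y) = (\<phi> x - \<phi> (x + y)) / norm y powr (real DIM('a) + \<alpha>)"
          using True by (simp add: dist_norm)
        also have "\<dots> = ?c / norm y powr (real DIM('a) + \<alpha>) * (\<phi> (x + y) - \<phi> x) * (- (1 / ?c))"
          by (rule q)
        also have "?c / norm y powr (real DIM('a) + \<alpha>) = kern \<epsilon> y" using True by (simp add: kern_def)
        finally show ?thesis .
      next
        case False
        then show ?thesis by (simp add: kern_def dist_norm)
      qed
    qed simp
    also have "\<dots> = - (gen \<epsilon> \<phi> x / ?c)" unfolding integral_mult_left_zero by (simp add: gen_def)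
    finally show ?thesis .
  qed
  have "((\<lambda>\<epsilon>. - (gen \<epsilon> \<phi> x / ?c)) \<longlongrightarrow> - (l / ?c)) (at_right 0)"
    using assms c by (intro tendsto_intros) auto
  then have "Lim (at_right 0) (\<lambda>\<epsilon>. - (gen \<epsilon> \<phi> x / ?c)) = - (l / ?c)"
    by (intro tendsto_Lim) auto
  then show ?thesis using c unfolding frac_laplacian_def e by simp
qed

context
  fixes \<phi> :: "'a::euclidean_space \<Rightarrow> real" and A B R :: real
  assumes A: "0 \<le> A" "\<And>x y. \<bar>sdiff \<phi> x y\<bar> \<le> A * (norm y)\<^sup>2" and B: "\<And>x. \<bar>\<phi> x\<bar> \<le> B"
    and R: "\<And>x. R < norm x \<Longrightarrow> \<phi> x = 0" and cont: "continuous_on UNIV \<phi>"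
begin

lemma phi_measurable[measurable]: "\<phi> \<in> borel_measurable borel"
  using cont by (rule borel_measurable_continuous_onI)

lemma sdiff_integrable: "integrable lborel (\<lambda>y. \<bar>sdiff \<phi> x y\<bar> * kern 0 y)"
proof (rule kern_growth_integrable[where A=A and B="4 * B" and \<beta>=0])
  have [measurable]: "sdiff \<phi> x \<in> borel_measurable borel" unfolding sdiff_def[abs_def] by measurable
  show "(\<lambda>y. \<bar>sdiff \<phi> x y\<bar>) \<in> borel_measurable borel" by measurable
  fix y assume "1 \<le> norm (y::'a)"
  then show "\<bar>sdiff \<phi> x y\<bar> \<le> 4 * B * norm y powr 0"
    using B[of "x + y"] B[of "x - y"] B[of x] by (auto simp: sdiff_def abs_le_iff)
qed (use A alpha_pos in auto)

lemma gen_abs_le: assumes "0 < \<delta>" shows "\<bar>gen \<delta> \<phi> x\<bar> \<le> (LBINT y. \<bar>sdiff \<phi> x y\<bar> * kern 0 y) / 2"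
proof -
  have g: "gen \<delta> \<phi> x = (LBINT y. kern \<delta> y * sdiff \<phi> x y) / 2"
    and i: "integrable lborel (\<lambda>y. kern \<delta> y * sdiff \<phi> x y)"
    using gen_second_difference[OF assms phi_measurable B, of x] by (simp_all add: sdiff_def)
  have "\<bar>LBINT y. kern \<delta> y * sdiff \<phi> x y\<bar> \<le> (LBINT y. norm (kern \<delta> y * sdiff \<phi> x y))"
    using integral_norm_bound[of lborel "\<lambda>y. kern \<delta> y * sdiff \<phi> x y"] by simp
  also have "\<dots> \<le> (LBINT y. \<bar>sdiff \<phi> x y\<bar> * kern 0 y)"
  proof (rule integral_mono[OF integrable_norm[OF i] sdiff_integrable])
    fix y
    have "kern \<delta> y * \<bar>sdiff \<phi> x y\<bar> \<le> kern 0 y * \<bar>sdiff \<phi> x y\<bar>"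
      using assms by (intro mult_right_mono kern_antimono) auto
    then show "norm (kern \<delta> y * sdiff \<phi> x y) \<le> \<bar>sdiff \<phi> x y\<bar> * kern 0 y"
      by (simp add: abs_mult mult.commute)
  qed
  finally show ?thesis by (simp add: g)
qed

text \<open>Away from \<open>y = 0\<close> the truncated kernel eventually equals the full one, and
  the second difference times the full kernel is an integrable majorant.\<close>

lemma gen_tendsto: "((\<lambda>\<delta>. gen \<delta> \<phi> x) \<longlongrightarrow> (LBINT y. kern 0 y * sdiff \<phi> x y) / 2) (at_right 0)"
proof (rule tendsto_at_right_sequentially[of 0 1])
  fix S :: "nat \<Rightarrow> real" assume S: "\<And>n. 0 < S n" "S \<longlonglongrightarrow> 0"
  have [measurable]: "sdiff \<phi> x \<in> borel_measurable borel" unfolding sdiff_def[abs_def] by measurable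
  have "(\<lambda>n. LBINT y. kern (S n) y * sdiff \<phi> x y) \<longlonglongrightarrow> (LBINT y. kern 0 y * sdiff \<phi> x y)"
  proof (rule integral_dominated_convergence[OF _ _ sdiff_integrable[of x]])
    show "AE y in lborel. (\<lambda>n. kern (S n) y * sdiff \<phi> x y) \<longlonglongrightarrow> kern 0 y * sdiff \<phi> x y"
    proof (rule AE_I2)
      fix y :: 'a
      have "\<forall>\<^sub>F n in sequentially. kern (S n) y = kern 0 y"
      proof (cases "y = 0")
        case True then show ?thesis using S by (auto simp: kern_def not_less less_imp_le)
      next
        case False
        then have "\<forall>\<^sub>F n in sequentially. S n < norm y" using S by (intro order_tendstoD(2)) auto
        then show ?thesis by eventually_elim (use False in \<open>auto simp: kern_def\<close>)
      qed
      then have "(\<lambda>n. kern (S n) y) \<longlonglongrightarrow> kern 0 y" by (rule tendsto_eventually)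
      then show "(\<lambda>n. kern (S n) y * sdiff \<phi> x y) \<longlonglongrightarrow> kern 0 y * sdiff \<phi> x y"
        by (intro tendsto_intros)
    qed
    show "AE y in lborel. norm (kern (S n) y * sdiff \<phi> x y) \<le> \<bar>sdiff \<phi> x y\<bar> * kern 0 y" for n
    proof (rule AE_I2)
      fix y
      have "kern (S n) y * \<bar>sdiff \<phi> x y\<bar> \<le> kern 0 y * \<bar>sdiff \<phi> x y\<bar>"
        using S(1)[of n] by (intro mult_right_mono kern_antimono) auto
      then show "norm (kern (S n) y * sdiff \<phi> x y) \<le> \<bar>sdiff \<phi> x y\<bar> * kern 0 y"
        by (simp add: abs_mult mult.commute)
    qed
  qed measurable
  then have "(\<lambda>n. (LBINT y. kern (S n) y * sdiff \<phi> x y) / 2) \<longlonglongrightarrow> (LBINT y. kern 0 y * sdiff \<phi> x y) / 2"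
    by (intro tendsto_intros) auto
  moreover have "gen (S n) \<phi> x = (LBINT y. kern (S n) y * sdiff \<phi> x y) / 2" for n
    using gen_second_difference(2)[OF S(1) phi_measurable B, of n x] by (simp add: sdiff_def)
  ultimately show "(\<lambda>n. gen (S n) \<phi> x) \<longlonglongrightarrow> (LBINT y. kern 0 y * sdiff \<phi> x y) / 2"
    by (simp only:)
qed simp

lemma phi_integrable: "integrable lborel \<phi>"
  by (rule integrable_compact_support[OF phi_measurable B R])

text \<open>The solution is only bounded, so the majorant of the truncated generators of \<phi> must
  itself be integrable in \<open>x\<close>. Integrating in \<open>x\<close> first gives order |y|^2
  for small \<open>y\<close>, the support growing by at most 1, and four times the L1 norm of \<phi>
  otherwise; both are integrable against the kernel.\<close>

lemma sdiff_product_integrable: "integrable lborel (\<lambda>x. LBINT y. \<bar>sdiff \<phi> x y\<bar> * kern 0 y)"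
proof -
  have B0: "0 \<le> B" using B[of 0] by linarith
  have ix: "integrable lborel (\<lambda>x. \<bar>sdiff \<phi> x y\<bar>)" for y
    using phi_integrable lborel_shift(2)[of \<phi> y] lborel_shift(2)[of \<phi> "- y"]
    unfolding sdiff_def by (intro integrable_abs Bochner_Integration.integrable_add Bochner_Integration.integrable_diff)
      (simp_all add: add.commute)
  let ?N = "LBINT x. \<bar>\<phi> x\<bar>"
  let ?V = "measure lborel (cball (0::'a) (max 0 R + 1))"
  let ?h = "\<lambda>y. LBINT x. \<bar>sdiff \<phi> x y\<bar>"
  have h_int: "integrable lborel (\<lambda>y. ?h y * kern 0 y)"
  proof (rule kern_growth_integrable[where A="A * ?V" and B="4 * ?N" and \<beta>=0])
    have "(\<lambda>y. LBINT x. \<bar>sdiff \<phi> (fst (x, y)) (snd (x, y))\<bar>) \<in> borel_measurable borel"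
      unfolding sdiff_def by measurable
    then show "?h \<in> borel_measurable borel" by simp
    show "?h y \<le> A * ?V * (norm y)\<^sup>2" if y: "norm y < 1" for y
    proof -
      have "?h y \<le> (LBINT x. A * (norm y)\<^sup>2 * indicator (cball (0::'a) (max 0 R + 1)) x)"
      proof (rule integral_mono[OF ix])
        show "integrable lborel (\<lambda>x::'a. A * (norm y)\<^sup>2 * indicator (cball 0 (max 0 R + 1)) x)"
          by (intro integrable_mult_right) (simp add: emeasure_cball)
        fix x :: 'a
        show "\<bar>sdiff \<phi> x y\<bar> \<le> A * (norm y)\<^sup>2 * indicator (cball 0 (max 0 R + 1)) x"
        proof (cases "x \<in> cball 0 (max 0 R + 1)")
          case False
          then have "R + 1 < norm x" by auto
          then have "\<phi> x = 0" "\<phi> (x + y) = 0" "\<phi> (x - y) = 0"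
            using y norm_triangle_ineq2[of x y] norm_triangle_ineq2[of x "- y"] by (auto intro!: R)
          then show ?thesis using False by (simp add: sdiff_def)
        qed (use A in auto)
      qed
      also have "\<dots> = A * ?V * (norm y)\<^sup>2" by simp
      finally show ?thesis .
    qed
    show "?h y \<le> 4 * ?N * norm y powr 0" if "1 \<le> norm y" for y
    proof -
      have i: "integrable lborel (\<lambda>x. \<bar>\<phi> x\<bar>)" using phi_integrable by simp
      have s: "integrable lborel (\<lambda>x. \<bar>\<phi> (x + z)\<bar>)" "(LBINT x. \<bar>\<phi> (x + z)\<bar>) = ?N" for z
        using lborel_shift[of "\<lambda>x. \<bar>\<phi> x\<bar>" z] i by (simp_all add: add.commute)
      have "?h y \<le> (LBINT x. \<bar>\<phi> (x + y)\<bar> + \<bar>\<phi> (x + - y)\<bar> + 2 * \<bar>\<phi> x\<bar>)"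
      proof (rule integral_mono[OF ix])
        show "integrable lborel (\<lambda>x. \<bar>\<phi> (x + y)\<bar> + \<bar>\<phi> (x + - y)\<bar> + 2 * \<bar>\<phi> x\<bar>)"
          by (intro Bochner_Integration.integrable_add s integrable_mult_right i)
      qed (auto simp: sdiff_def)
      also have "\<dots> = 4 * ?N"
        using s[of y] s[of "- y"] i by simp
      finally show ?thesis using that by (cases "y = 0") auto
    qed
  qed (use alpha_pos in auto)
  let ?P = "\<lambda>(y, x). \<bar>sdiff \<phi> x y\<bar> * kern 0 y"
  have I: "integrable (lborel \<Otimes>\<^sub>M lborel) ?P"
  proof (rule lborel_pair.Fubini_integrable)
    show "?P \<in> borel_measurable (lborel \<Otimes>\<^sub>M lborel)" unfolding sdiff_def by measurable
    show "integrable lborel (\<lambda>y. LBINT x. norm (?P (y, x)))"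
      using h_int by (simp add: abs_mult)
    show "AE y in lborel. integrable lborel (\<lambda>x. ?P (y, x))" using ix by auto
  qed
  then show ?thesis by (rule lborel_pair.integrable_snd)
qed

text \<open>\<open>gen_dual\<close> puts the generator on \<phi>, where dominated convergence
  applies. Functions and truncation lengths vary together, as passing to the limit in the
  approximate equations requires.\<close>

lemma pairing_tendsto_aux:
  assumes U: "\<And>n. U n \<in> borel_measurable borel" "\<And>n x. \<bar>U n x\<bar> \<le> M" "\<And>x. (\<lambda>n. U n x) \<longlonglongrightarrow> u x"
    and S: "\<And>n. 0 < S n" "S \<longlonglongrightarrow> 0"
  shows "(\<lambda>n. LBINT x. \<phi> x * gen (S n) (U n) x) \<longlonglongrightarrow> - frac_laplacian_distr \<alpha> u \<phi>"
proof -
  have M: "0 \<le> M" using U(2)[of 0 0] by linarith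
  have um[measurable]: "u \<in> borel_measurable borel"
    by (rule borel_measurable_LIMSEQ_real[where u=U]) (rule U)+
  note U(1)[measurable]
  let ?H = "\<lambda>x. LBINT y. \<bar>sdiff \<phi> x y\<bar> * kern 0 y"
  let ?G = "\<lambda>x. (LBINT y. kern 0 y * sdiff \<phi> x y) / 2"
  have "(\<lambda>n. LBINT x. U n x * gen (S n) \<phi> x) \<longlonglongrightarrow> (LBINT x. u x * ?G x)"
  proof (rule integral_dominated_convergence)
    show "integrable lborel (\<lambda>x. M * (?H x / 2))" using sdiff_product_integrable by simp
    show "AE x in lborel. (\<lambda>n. U n x * gen (S n) \<phi> x) \<longlonglongrightarrow> u x * ?G x"
    proof (intro AE_I2 tendsto_mult U(3))
      fix x
      have "filterlim S (at_right 0) sequentially"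
        using S by (intro tendsto_imp_filterlim_at_right) auto
      then show "(\<lambda>n. gen (S n) \<phi> x) \<longlonglongrightarrow> ?G x" by (rule filterlim_compose[OF gen_tendsto])
    qed
    show "AE x in lborel. norm (U n x * gen (S n) \<phi> x) \<le> M * (?H x / 2)" for n
    proof (rule AE_I2)
      fix x
      have "\<bar>U n x\<bar> * \<bar>gen (S n) \<phi> x\<bar> \<le> M * (?H x / 2)"
        using U(2) M gen_abs_le[OF S(1)] by (intro mult_mono) auto
      then show "norm (U n x * gen (S n) \<phi> x) \<le> M * (?H x / 2)" by (simp only: real_norm_def abs_mult)
    qed
    show "(\<lambda>x. U n x * gen (S n) \<phi> x) \<in> borel_measurable lborel" for n
      using gen_measurable[OF S(1) phi_measurable B, of n] by measurable
    have "(\<lambda>x. LBINT y. kern 0 y * sdiff \<phi> x y) \<in> borel_measurable borel"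
      unfolding sdiff_def by measurable
    then show "(\<lambda>x. u x * ?G x) \<in> borel_measurable lborel" by measurable
  qed
  moreover have "(LBINT x. \<phi> x * gen (S n) (U n) x) = (LBINT x. U n x * gen (S n) \<phi> x)" for n
    by (rule gen_dual[OF S(1) U(1) U(2) phi_integrable B])
  moreover have "(LBINT x. u x * ?G x) = - frac_laplacian_distr \<alpha> u \<phi>"
    unfolding frac_laplacian_distr_def frac_laplacian_eq[OF gen_tendsto] by simp
  ultimately show ?thesis by simp
qed

end

lemma pairing_tendsto_sequence:
  fixes u :: "'a::euclidean_space \<Rightarrow> real"
  assumes \<phi>: "\<phi> \<in> test_functions D"
    and U: "\<And>n. U n \<in> borel_measurable borel" "\<And>n x. \<bar>U n x\<bar> \<le> M" "\<And>x. (\<lambda>n. U n x) \<longlonglongrightarrow> u x"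
    and S: "\<And>n. 0 < S n" "S \<longlonglongrightarrow> 0"
  shows "(\<lambda>n. LBINT x. \<phi> x * gen (S n) (U n) x) \<longlonglongrightarrow> - frac_laplacian_distr \<alpha> u \<phi>"
proof -
  obtain A B R where b: "0 \<le> A" "\<And>x y. \<bar>sdiff \<phi> x y\<bar> \<le> A * (norm y)\<^sup>2" "\<And>x. \<bar>\<phi> x\<bar> \<le> B" "\<And>x. R < norm x \<Longrightarrow> \<phi> x = 0"
    "continuous_on UNIV \<phi>"
    by (rule test_function_bounds[OF \<phi>], rule that)
  show ?thesis by (rule pairing_tendsto_aux[where A=A and B=B and R=R and M=M]) (fact b U S)+
qed

lemma pairing_tendsto:
  fixes u :: "'a::euclidean_space \<Rightarrow> real"
  assumes "\<phi> \<in> test_functions D" "u \<in> borel_measurable borel" "\<And>x. \<bar>u x\<bar> \<le> M"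
  shows "((\<lambda>\<delta>. LBINT x. \<phi> x * gen \<delta> u x) \<longlongrightarrow> - frac_laplacian_distr \<alpha> u \<phi>) (at_right 0)"
proof (rule tendsto_at_right_sequentially[of 0 1])
  fix S :: "nat \<Rightarrow> real" assume S: "\<And>n. 0 < S n" "S \<longlonglongrightarrow> 0"
  show "(\<lambda>n. LBINT x. \<phi> x * gen (S n) u x) \<longlonglongrightarrow> - frac_laplacian_distr \<alpha> u \<phi>"
    using assms S by (intro pairing_tendsto_sequence[where U="\<lambda>_. u" and M=M and D=D]) auto
qed simp

text \<open>A bound uniform in both \<delta> and \<open>x\<close>. It prices the perturbation by a
  bump function in the strong maximum principle.\<close>

lemma gen_test_bound:
  fixes \<phi> :: "'a::euclidean_space \<Rightarrow> real"
  assumes \<phi>: "\<phi> \<in> test_functions D"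
  obtains C where "0 \<le> C" "\<And>\<delta> x. 0 < \<delta> \<Longrightarrow> \<bar>gen \<delta> \<phi> x\<bar> \<le> C"
proof -
  obtain A B R where b: "0 \<le> A" "\<And>x y. \<bar>sdiff \<phi> x y\<bar> \<le> A * (norm y)\<^sup>2" "\<And>x. \<bar>\<phi> x\<bar> \<le> B" "\<And>x. R < norm x \<Longrightarrow> \<phi> x = 0"
    "continuous_on UNIV \<phi>"
    by (rule test_function_bounds[OF \<phi>], rule that)
  have B0: "0 \<le> B" using b(3)[of 0] by linarith
  let ?I = "LBINT y. (A + 4 * B) * (min 1 ((norm y)\<^sup>2) * kern 0 (y::'a))"
  have "\<bar>gen \<delta> \<phi> x\<bar> \<le> ?I / 2" if "0 < \<delta>" for \<delta> x
  proof -
    have "(LBINT y. \<bar>sdiff \<phi> x y\<bar> * kern 0 y) \<le> ?I"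
    proof (rule integral_mono)
      show "integrable lborel (\<lambda>y. \<bar>sdiff \<phi> x y\<bar> * kern 0 y)"
        by (rule sdiff_integrable[where A=A and B=B and R=R]) (fact b)+
      show "integrable lborel (\<lambda>y::'a. (A + 4 * B) * (min 1 ((norm y)\<^sup>2) * kern 0 y))"
        by (intro integrable_mult_right kern_min_sq_integrable)
      fix y
      have "\<bar>sdiff \<phi> x y\<bar> \<le> (A + 4 * B) * min 1 ((norm y)\<^sup>2)"
      proof (cases "(norm y)\<^sup>2 \<le> 1")
        case True
        then have "A * (norm y)\<^sup>2 \<le> (A + 4 * B) * min 1 ((norm y)\<^sup>2)"
          using B0 by (auto intro!: mult_right_mono)
        then show ?thesis using b(2)[of x y] by linarith
      next
        case False
        then show ?thesis using b(1) b(3)[of "x + y"] b(3)[of "x - y"] b(3)[of x]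
          by (auto simp: sdiff_def abs_le_iff)
      qed
      then have "\<bar>sdiff \<phi> x y\<bar> * kern 0 y \<le> ((A + 4 * B) * min 1 ((norm y)\<^sup>2)) * kern 0 y"
        by (intro mult_right_mono) auto
      then show "\<bar>sdiff \<phi> x y\<bar> * kern 0 y \<le> (A + 4 * B) * (min 1 ((norm y)\<^sup>2) * kern 0 y)"
        by (simp only: mult.assoc)
    qed
    moreover have "\<bar>gen \<delta> \<phi> x\<bar> \<le> (LBINT y. \<bar>sdiff \<phi> x y\<bar> * kern 0 y) / 2"
      by (rule gen_abs_le[where A=A and B=B and R=R]) (fact b that)+
    ultimately show ?thesis by linarith
  qed
  moreover have "0 \<le> ?I" using b(1) B0 by (intro integral_nonneg_AE AE_I2 mult_nonneg_nonneg) auto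
  ultimately show thesis using that[of "?I / 2"] by simp
qed

end

section \<open>Bump functions\<close>

text \<open>The powers in the denominator make the family closed under differentiation up to linear
  combinations, so smoothness of exp(-1/t), continued by 0, follows by induction over all members at
  once.\<close>

definition flat_exp :: "nat \<Rightarrow> real \<Rightarrow> real" where
  "flat_exp n t = (if t \<le> 0 then 0 else exp (- (1 / t)) / t ^ n)"

lemma flat_exp_tendsto: "(flat_exp n \<longlongrightarrow> 0) (at_right 0)"
proof -
  have "((\<lambda>t::real. (inverse t) ^ n / exp (inverse t)) \<longlongrightarrow> 0) (at_right 0)"
    by (rule filterlim_compose[OF tendsto_power_div_exp_0 filterlim_inverse_at_top_right])
  moreover have "\<forall>\<^sub>F t in at_right 0. (inverse t) ^ n / exp (inverse t) = flat_exp n t"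
    using eventually_at_right_less[of 0]
    by eventually_elim (simp add: flat_exp_def exp_minus field_simps)
  ultimately show ?thesis by (rule Lim_transform_eventually)
qed

lemma flat_exp_deriv: "DERIV (flat_exp n) t :> flat_exp (n + 2) t - real n * flat_exp (n + 1) t"
proof -
  consider "t < 0" | "t = 0" | "0 < t" by linarith
  then show ?thesis
  proof cases
    case 1
    have "DERIV (\<lambda>_. 0 :: real) t :> 0" by simp
    then have "DERIV (flat_exp n) t :> 0"
      by (rule has_field_derivative_transform_within_open[where S="{..<0}"]) (use 1 in \<open>auto simp: flat_exp_def\<close>)
    then show ?thesis using 1 by (simp add: flat_exp_def)
  next
    case 2
    \<comment> \<open>To the right of 0 the difference quotient is the next member of the family,
      and every member tends to 0 there.\<close>
    have "((\<lambda>h. flat_exp n h / h) \<longlongrightarrow> 0) (at 0)"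
    proof (rule filterlim_split_at_real)
      have "\<forall>\<^sub>F h in at_left 0. 0 = flat_exp n h / h"
        using eventually_at_left_real[of "-1" 0] by (auto simp: flat_exp_def elim!: eventually_mono)
      then show "((\<lambda>h. flat_exp n h / h) \<longlongrightarrow> 0) (at_left 0)"
        by (rule Lim_transform_eventually[OF tendsto_const])
      have "\<forall>\<^sub>F h in at_right 0. flat_exp (n + 1) h = flat_exp n h / h"
        using eventually_at_right_less[of 0]
        by eventually_elim (simp add: flat_exp_def field_simps)
      then show "((\<lambda>h. flat_exp n h / h) \<longlongrightarrow> 0) (at_right 0)"
        by (rule Lim_transform_eventually[OF flat_exp_tendsto])
    qed
    then show ?thesis using 2 by (simp add: DERIV_def flat_exp_def)
  next
    case 3
    have "DERIV (\<lambda>t. exp (- (1 / t)) / t ^ n) t :>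
        (exp (- (1 / t)) * (1 / t\<^sup>2) * t ^ n - exp (- (1 / t)) * (real n * t ^ (n - 1))) / (t ^ n * t ^ n)"
      using 3 by (auto intro!: derivative_eq_intros simp: power2_eq_square)
    also have "(exp (- (1 / t)) * (1 / t\<^sup>2) * t ^ n - exp (- (1 / t)) * (real n * t ^ (n - 1))) / (t ^ n * t ^ n)
        = flat_exp (n + 2) t - real n * flat_exp (n + 1) t"
      using 3 by (cases n) (simp_all add: flat_exp_def field_simps power2_eq_square)
    finally have "DERIV (\<lambda>t. exp (- (1 / t)) / t ^ n) t :> flat_exp (n + 2) t - real n * flat_exp (n + 1) t" .
    then show ?thesis
      by (rule has_field_derivative_transform_within_open[where S="{0<..}"]) (use 3 in \<open>auto simp: flat_exp_def\<close>)
  qed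
qed

lemma Ck_SucI:
  assumes "\<And>x. (\<phi> has_derivative D x) (at x)" "\<And>b. b \<in> Basis \<Longrightarrow> Ck k (\<lambda>x. D x b)"
  shows "Ck (Suc k) \<phi>"
proof -
  have "frechet_derivative \<phi> (at x) = D x" for x using frechet_derivative_at[OF assms(1)] by simp
  moreover have "\<phi> differentiable_on UNIV"
    using assms(1) unfolding differentiable_on_def differentiable_def by blast
  ultimately show ?thesis using assms(2) by simp
qed

lemma Ck_SucE:
  assumes "Ck (Suc k) \<phi>"
  obtains D where "\<And>x. (\<phi> has_derivative D x) (at x)" "\<And>b. b \<in> Basis \<Longrightarrow> Ck k (\<lambda>x. D x b)"
proof -
  have "(\<phi> has_derivative frechet_derivative \<phi> (at x)) (at x)" for x
    using assms by (simp add: differentiable_on_def frechet_derivative_works[symmetric])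
  then show thesis using that[of "\<lambda>x. frechet_derivative \<phi> (at x)"] assms by simp
qed

lemma Ck_SucD: "Ck (Suc k) \<phi> \<Longrightarrow> Ck k \<phi>"
proof (induction k arbitrary: \<phi>)
  case 0
  then show ?case by (simp add: differentiable_imp_continuous_on)
next
  case (Suc k)
  then show ?case by auto
qed

lemma Ck_const: "Ck k (\<lambda>_. c)"
proof (induction k arbitrary: c)
  case (Suc k)
  then show ?case by (intro Ck_SucI[where D="\<lambda>_ _. 0"]) auto
qed simp

lemma Ck_affine: "Ck k (\<lambda>x. x \<bullet> v + d)"
proof (cases k)
  case 0
  then show ?thesis by (auto intro!: continuous_intros)
next
  case (Suc l)
  then show ?thesis
    by (auto simp del: Ck.simps intro!: Ck_SucI[where D="\<lambda>_ h. h \<bullet> v"] Ck_const derivative_eq_intros)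
qed

lemma Ck_add: "Ck k \<phi> \<Longrightarrow> Ck k \<psi> \<Longrightarrow> Ck k (\<lambda>x. \<phi> x + \<psi> x)"
proof (induction k arbitrary: \<phi> \<psi>)
  case 0
  then show ?case by (simp add: continuous_on_add)
next
  case (Suc k)
  obtain D E where D: "\<And>x. (\<phi> has_derivative D x) (at x)" "\<And>b. b \<in> Basis \<Longrightarrow> Ck k (\<lambda>x. D x b)"
    and E: "\<And>x. (\<psi> has_derivative E x) (at x)" "\<And>b. b \<in> Basis \<Longrightarrow> Ck k (\<lambda>x. E x b)"
    using Ck_SucE[OF Suc.prems(1)] Ck_SucE[OF Suc.prems(2)] by metis
  show ?case
    by (rule Ck_SucI[where D="\<lambda>x h. D x h + E x h"]) (auto intro!: has_derivative_add D E Suc.IH)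
qed

lemma Ck_mult: "Ck k \<phi> \<Longrightarrow> Ck k \<psi> \<Longrightarrow> Ck k (\<lambda>x. \<phi> x * \<psi> x)"
proof (induction k arbitrary: \<phi> \<psi>)
  case 0
  then show ?case by (simp add: continuous_on_mult)
next
  case (Suc k)
  obtain D E where D: "\<And>x. (\<phi> has_derivative D x) (at x)" "\<And>b. b \<in> Basis \<Longrightarrow> Ck k (\<lambda>x. D x b)"
    and E: "\<And>x. (\<psi> has_derivative E x) (at x)" "\<And>b. b \<in> Basis \<Longrightarrow> Ck k (\<lambda>x. E x b)"
    using Ck_SucE[OF Suc.prems(1)] Ck_SucE[OF Suc.prems(2)] by metis
  show ?case
  proof (rule Ck_SucI[where D="\<lambda>x h. \<phi> x * E x h + D x h * \<psi> x"])
    show "((\<lambda>x. \<phi> x * \<psi> x) has_derivative (\<lambda>h. \<phi> x * E x h + D x h * \<psi> x)) (at x)" for x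
      using D E by (intro has_derivative_mult)
    show "Ck k (\<lambda>x. \<phi> x * E x b + D x b * \<psi> x)" if "b \<in> Basis" for b
      by (rule Ck_add[OF Suc.IH[OF Ck_SucD[OF Suc.prems(1)] E(2)[OF that]] Suc.IH[OF D(2)[OF that] Ck_SucD[OF Suc.prems(2)]]])
  qed
qed

text \<open>The derivative involves members with larger \<open>n\<close>, so \<open>n\<close> has to
  vary in the induction on \<open>k\<close>.\<close>

lemma Ck_flat_exp:
  assumes s: "\<And>k. Ck k s"
  shows "Ck k (\<lambda>x. flat_exp n (s x))"
proof (induction k arbitrary: n)
  case 0
  have "continuous_on UNIV (flat_exp n)"
    using flat_exp_deriv by (intro continuous_at_imp_continuous_on) (auto intro: DERIV_isCont)
  then show ?case using s[of 0] continuous_on_compose2[of UNIV "flat_exp n" UNIV s] by simp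
next
  case (Suc k)
  obtain D where D: "\<And>x. (s has_derivative D x) (at x)" "\<And>b. b \<in> Basis \<Longrightarrow> Ck k (\<lambda>x. D x b)"
    using Ck_SucE[OF s[of "Suc k"]] by blast
  let ?g = "\<lambda>x. flat_exp (n + 2) (s x) + (- real n) * flat_exp (n + 1) (s x)"
  show ?case
  proof (rule Ck_SucI[where D="\<lambda>x h. ?g x * D x h"])
    show "((\<lambda>x. flat_exp n (s x)) has_derivative (\<lambda>h. ?g x * D x h)) (at x)" for x
      using has_derivative_compose[OF D(1) flat_exp_deriv[of n "s x", unfolded has_field_derivative_def]] by simp
    show "Ck k (\<lambda>x. ?g x * D x b)" if "b \<in> Basis" for b
      using D(2)[OF that] by (intro Ck_mult Ck_add Suc.IH Ck_const)
  qed
qed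

section \<open>Smooth mollifiers with compact support\<close>

definition bump :: "'a::euclidean_space \<Rightarrow> real \<Rightarrow> 'a \<Rightarrow> real" where
  "bump c r x = flat_exp 0 (1 - (norm (x - c) / r)\<^sup>2)"

lemma bump_pos_iff: "0 < r \<Longrightarrow> 0 < bump c r x \<longleftrightarrow> norm (x - c) < r"
  using abs_square_less_1[of "norm (x - c) / r"]
  by (auto simp: bump_def flat_exp_def not_le divide_less_eq simp flip: not_less)

lemma bump_nonneg: "0 \<le> bump c r x" and bump_le_1: "bump c r x \<le> 1"
  by (auto simp: bump_def flat_exp_def)

lemma bump_zero: "0 < r \<Longrightarrow> r \<le> norm (x - c) \<Longrightarrow> bump c r x = 0"
  using bump_pos_iff[of r c x] bump_nonneg[of c r x] by linarith

lemma bump_shift: "bump c r (c + x) = bump 0 r x"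
  by (simp add: bump_def)

lemma bump_scale: "0 < t \<Longrightarrow> bump c r (x /\<^sub>R t) = bump (t *\<^sub>R c) (t * r) x"
proof -
  assume t: "0 < t"
  have "x - t *\<^sub>R c = t *\<^sub>R (x /\<^sub>R t - c)" using t by (simp add: algebra_simps)
  then have "norm (x - t *\<^sub>R c) = t * norm (x /\<^sub>R t - c)" using t by simp
  then show ?thesis using t by (simp add: bump_def)
qed

lemma Ck_bump:
  fixes c :: "'a::euclidean_space"
  shows "Ck k (bump c r)"
proof -
  have "Ck k (\<lambda>x. 1 + (- 1 / r\<^sup>2) * (\<Sum>b\<in>Basis. (x \<bullet> b + - (c \<bullet> b)) * (x \<bullet> b + - (c \<bullet> b))))" for k
  proof -
    have "Ck k (\<lambda>x. \<Sum>b\<in>A. (x \<bullet> b + - (c \<bullet> b)) * (x \<bullet> b + - (c \<bullet> b)))" if "finite A" for A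
      using that by (induction A rule: finite_induct) (auto intro!: Ck_const Ck_add Ck_mult Ck_affine simp del: add_uminus_conv_diff)
    then show ?thesis by (intro Ck_add Ck_mult Ck_const) auto
  qed
  then have "Ck k (\<lambda>x. flat_exp 0 (1 + (- 1 / r\<^sup>2) * (\<Sum>b\<in>Basis. (x \<bullet> b + - (c \<bullet> b)) * (x \<bullet> b + - (c \<bullet> b)))))"
    by (rule Ck_flat_exp)
  moreover have "(norm (x - c))\<^sup>2 = (\<Sum>b\<in>Basis. (x \<bullet> b + - (c \<bullet> b)) * (x \<bullet> b + - (c \<bullet> b)))" for x
    unfolding power2_norm_eq_inner by (subst euclidean_inner) (simp add: inner_diff_left)
  ultimately show ?thesis by (simp add: bump_def[abs_def] power_divide)
qed

lemma bump_continuous: "continuous_on UNIV (bump c r)"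
  using Ck_bump[of 0] by simp

lemma bump_measurable[measurable]: "bump c r \<in> borel_measurable borel"
  using bump_continuous by (rule borel_measurable_continuous_onI)

lemma bump_test_function:
  assumes r: "0 < r" and D: "cball c r \<subseteq> D"
  shows "bump c r \<in> test_functions D"
proof -
  have "{x. bump c r x \<noteq> 0} \<subseteq> cball c r"
    using bump_zero[OF r] by (force simp: dist_norm norm_minus_commute)
  then have "closure {x. bump c r x \<noteq> 0} \<subseteq> cball c r" by (rule closure_minimal) simp
  moreover from this have "compact (closure {x. bump c r x \<noteq> 0})"
    using bounded_subset[OF bounded_cball] by (auto simp: compact_eq_bounded_closed)
  ultimately show ?thesis using D Ck_bump by (auto simp: test_functions_def)
qed

lemma bump_integrable: assumes "0 < r" shows "integrable lborel (bump c r)"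
proof (rule integrable_compact_support[where B=1 and R="norm c + r"])
  show "\<bar>bump c r x\<bar> \<le> 1" for x using bump_nonneg[of c r x] bump_le_1[of c r x] by simp
  show "bump c r x = 0" if "norm c + r < norm x" for x
    using that norm_triangle_ineq2[of x c] by (intro bump_zero assms) auto
qed simp

lemma bump_mult_integrable:
  fixes g :: "'a::euclidean_space \<Rightarrow> real"
  assumes r: "0 < r" and [measurable]: "g \<in> borel_measurable borel" and g: "\<And>x. \<bar>g x\<bar> \<le> B"
  shows "integrable lborel (\<lambda>x. bump c r x * g x)"
  by (rule integrable_mult_bounded[OF bump_integrable[OF r] _ g]) measurable

lemma bump_integral_lower:
  assumes r: "0 < r" and g: "integrable lborel (\<lambda>x. bump c r x * g x)" and le: "\<And>x. x \<in> cball c r \<Longrightarrow> B \<le> g x"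
  shows "B * (LBINT x. bump c r x) \<le> (LBINT x. bump c r x * g x)"
proof -
  have "B * (LBINT x. bump c r x) = (LBINT x. B * bump c r x)" by simp
  also have "\<dots> \<le> (LBINT x. bump c r x * g x)"
  proof (rule integral_mono[OF integrable_mult_right[OF bump_integrable[OF r]] g])
    fix x
    show "B * bump c r x \<le> bump c r x * g x"
    proof (cases "x \<in> cball c r")
      case True
      then show ?thesis using mult_right_mono[OF le[OF True] bump_nonneg[of c r x]] by (simp add: mult.commute)
    next
      case False
      then show ?thesis using bump_zero[OF r, of x c] by (simp add: dist_norm norm_minus_commute)
    qed
  qed
  finally show ?thesis .
qed

lemma bump_integral_pos:
  fixes c :: "'a::euclidean_space"
  assumes r: "0 < r"
  shows "0 < (LBINT x. bump c r x)"
proof (rule ccontr)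
  assume "\<not> ?thesis"
  moreover have "0 \<le> (LBINT x. bump c r x)" by (intro integral_nonneg_AE AE_I2 bump_nonneg)
  ultimately have "(LBINT x. bump c r x) = 0" by simp
  then have "AE x in lborel. bump c r x = 0"
    using integral_nonneg_eq_0_iff_AE[OF bump_integrable[OF r] AE_I2[OF bump_nonneg]] by blast
  then have "AE x in lborel. x \<notin> ball c r"
    by eventually_elim (use bump_pos_iff[OF r] in \<open>force simp: dist_norm norm_minus_commute\<close>)
  then have "emeasure lborel (ball c r) = 0"
    by (subst (asm) AE_iff_measurable[where N="ball c r"]) auto
  moreover have "unit_ball_vol (real DIM('a)) \<noteq> 0" using unit_ball_vol_pos[of "real DIM('a)"] by linarith
  ultimately show False using r by (simp add: emeasure_ball)
qed

lemma uniformly_continuous_compact_support: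
  fixes w :: "'a::euclidean_space \<Rightarrow> real"
  assumes cont: "continuous_on UNIV w" and supp: "\<And>x. R < norm x \<Longrightarrow> w x = 0" and e: "0 < e"
  obtains r where "0 < r" "r < 1" "\<And>x h. norm h \<le> r \<Longrightarrow> \<bar>w (x + h) - w x\<bar> \<le> e"
proof -
  have "uniformly_continuous_on (cball 0 (R + 2)) w"
    by (intro compact_uniformly_continuous continuous_on_subset[OF cont]) auto
  then obtain d where d: "0 < d" "\<And>x y. x \<in> cball 0 (R + 2) \<Longrightarrow> y \<in> cball 0 (R + 2) \<Longrightarrow> dist y x < d \<Longrightarrow> dist (w y) (w x) < e"
    using e unfolding uniformly_continuous_on_def by metis
  define r where "r = min (1 / 2) (d / 2)"
  have r: "0 < r" "r < 1" "r < d" using d(1) by (auto simp: r_def)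
  have "\<bar>w (x + h) - w x\<bar> \<le> e" if h: "norm h \<le> r" for x h
  proof (cases "norm x \<le> R + 1")
    case True
    have "norm (x + h) \<le> R + 2" using norm_triangle_ineq[of x h] True h r by linarith
    then have "x \<in> cball 0 (R + 2)" "x + h \<in> cball 0 (R + 2)" using True by auto
    moreover have "dist (x + h) x < d" using h r by (simp add: dist_norm)
    ultimately have "dist (w (x + h)) (w x) < e" by (rule d(2))
    then show ?thesis by (simp add: dist_real_def)
  next
    case False
    then have "R < norm x" "R < norm (x + h)" using norm_triangle_ineq2[of x "- h"] h r by auto
    then show ?thesis using supp e by simp
  qed
  then show thesis using that r by blast
qed

section \<open>A maximum principle for distributional subsolutions\<close>

context fractional
begin

text \<open>
  The mollification of \<open>w\<close> by a bump function of small radius attains its maximum, and at a maximum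
  point the truncated generator decreases as the truncation is removed.
\<close>

lemma distributional_max_principle:
  fixes w :: "'a::euclidean_space \<Rightarrow> real"
  assumes cont: "continuous_on UNIV w" and supp: "\<And>x. R < norm x \<Longrightarrow> w x = 0"
    and le: "\<And>x. w x \<le> M" and x0: "w x0 = M" and M: "0 < M" "m < M"
    and sub: "\<And>c r. 0 < r \<Longrightarrow> cball c r \<subseteq> {x. m < w x} \<Longrightarrow>
       \<exists>l. - e * (LBINT x. bump c r x) \<le> l \<and> ((\<lambda>\<delta>. LBINT x. bump c r x * gen \<delta> w x) \<longlongrightarrow> l) (at_right 0)"
    and \<rho>: "0 < \<rho>" and \<epsilon>: "0 < \<epsilon>"
  obtains x where "M - \<epsilon> < w x" "(LBINT y. kern \<rho> y * (M - w (x + y))) \<le> e + \<epsilon>"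
proof -
  have wm[measurable]: "w \<in> borel_measurable borel" using cont by (rule borel_measurable_continuous_onI)
  obtain B where B: "\<And>x. \<bar>w x\<bar> \<le> B" using bounded_compact_support[OF cont supp] by blast
  define \<Lambda> where "\<Lambda> = (LBINT y. kern \<rho> (y::'a))"
  have \<Lambda>: "0 \<le> \<Lambda>" unfolding \<Lambda>_def by simp
  \<comment> \<open>The mollification will be maximal at a point with
    \<open>w \<ge> M - 2 * \<epsilon>'\<close>. A ball around it loses another \<epsilon>' and must
    stay in {w > m}, hence 3 \<epsilon>' < M - m; \<epsilon>' < M makes that maximum exceed the
    value 0 taken far away; the return from \<open>v\<close> to \<open>w\<close> costs 2 \<epsilon>'
    \<Lambda> \<le> \<epsilon>.\<close>
  define \<epsilon>' where "\<epsilon>' = min (min (\<epsilon> / (2 * (1 + \<Lambda>))) (\<epsilon> / 3)) (min ((M - m) / 4) (M / 2))"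
  have \<epsilon>': "0 < \<epsilon>'" "\<epsilon>' \<le> \<epsilon> / (2 * (1 + \<Lambda>))" "2 * \<epsilon>' < \<epsilon>" "3 * \<epsilon>' < M - m" "\<epsilon>' < M"
    using \<epsilon> \<Lambda> M by (auto simp: \<epsilon>'_def min_def not_le)
  have \<epsilon>\<Lambda>: "2 * \<epsilon>' * \<Lambda> \<le> \<epsilon>"
  proof -
    have "\<epsilon>' * (2 * (1 + \<Lambda>)) \<le> \<epsilon>" using \<epsilon>'(2) \<Lambda> by (simp add: pos_le_divide_eq)
    then show ?thesis using \<epsilon>'(1) by (simp add: algebra_simps)
  qed
  obtain r where r: "0 < r" "r < 1" and unif: "\<And>x h. norm h \<le> r \<Longrightarrow> \<bar>w (x + h) - w x\<bar> \<le> \<epsilon>'"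
    using uniformly_continuous_compact_support[OF cont supp \<epsilon>'(1)] by blast
  define Z where "Z = (LBINT x. bump (0::'a) r x)"
  have Z: "0 < Z" unfolding Z_def by (rule bump_integral_pos[OF r(1)])
  define v where "v = (\<lambda>x. LBINT y. bump 0 r y * w (x + y))"
  have intw: "integrable lborel (\<lambda>y. bump 0 r y * w (x + y))" for x
    by (rule bump_mult_integrable[OF r(1), where B=B]) (use B in auto)
  have vdiff: "\<bar>v x - Z * a\<bar> \<le> Z * \<eta>" if "\<And>y. norm y < r \<Longrightarrow> \<bar>w (x + y) - a\<bar> \<le> \<eta>" for x a \<eta>
  proof -
    have "v x - Z * a = (LBINT y. bump 0 r y * w (x + y) - bump 0 r y * a)"
      using intw[of x] bump_integrable[OF r(1), of 0]
      by (subst Bochner_Integration.integral_diff) (auto simp: v_def Z_def)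
    also have "\<bar>\<dots>\<bar> \<le> (LBINT y. norm (bump 0 r y * w (x + y) - bump 0 r y * a))"
      using integral_norm_bound[of lborel "\<lambda>y. bump 0 r y * w (x + y) - bump 0 r y * a"] by simp
    also have "\<dots> \<le> (LBINT y. bump (0::'a) r y * \<eta>)"
    proof (rule integral_mono)
      show "integrable lborel (\<lambda>y. norm (bump 0 r y * w (x + y) - bump 0 r y * a))"
        by (intro integrable_norm Bochner_Integration.integrable_diff intw integrable_mult_left bump_integrable r(1))
      show "integrable lborel (\<lambda>y. bump (0::'a) r y * \<eta>)" using bump_integrable[OF r(1)] by auto
      fix y :: 'a
      show "norm (bump 0 r y * w (x + y) - bump 0 r y * a) \<le> bump 0 r y * \<eta>"
      proof (cases "norm y < r")
        case True
        have "norm (bump 0 r y * w (x + y) - bump 0 r y * a) = bump 0 r y * \<bar>w (x + y) - a\<bar>"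
          using bump_nonneg[of 0 r y] by (simp add: abs_mult flip: right_diff_distrib)
        then show ?thesis using that[OF True] bump_nonneg[of 0 r y] by (simp add: mult_left_mono)
      qed (simp add: bump_zero[OF r(1)])
    qed
    also have "\<dots> = Z * \<eta>" by (simp add: Z_def)
    finally show ?thesis .
  qed
  have vw: "\<bar>v x - Z * w x\<bar> \<le> Z * \<epsilon>'" for x by (rule vdiff) (use unif in simp)
  have vcont: "continuous_on UNIV v"
  proof (rule continuous_at_imp_continuous_on, intro ballI, unfold continuous_at_eps_delta, intro allI impI)
    fix x :: 'a and \<eta> :: real assume \<eta>: "0 < \<eta>"
    have "0 < \<eta> / (2 * Z)" using \<eta> Z by simp
    from uniformly_continuous_compact_support[OF cont supp this]
    obtain d where d: "0 < d" "\<And>x h. norm h \<le> d \<Longrightarrow> \<bar>w (x + h) - w x\<bar> \<le> \<eta> / (2 * Z)"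
      by blast
    have "dist (v x') (v x) < \<eta>" if "dist x' x < d" for x'
    proof -
      have "v x' - v x = (LBINT y. bump 0 r y * (w (x' + y) - w (x + y)))"
        using intw[of x] intw[of x'] by (simp add: v_def right_diff_distrib)
      also have "\<bar>\<dots>\<bar> \<le> (LBINT y. norm (bump 0 r y * (w (x' + y) - w (x + y))))"
        using integral_norm_bound[of lborel "\<lambda>y. bump 0 r y * (w (x' + y) - w (x + y))"] by simp
      also have "\<dots> \<le> (LBINT y. bump (0::'a) r y * (\<eta> / (2 * Z)))"
      proof (rule integral_mono)
        show "integrable lborel (\<lambda>y. norm (bump 0 r y * (w (x' + y) - w (x + y))))"
          using intw[of x] intw[of x'] by (simp add: right_diff_distrib)
        show "integrable lborel (\<lambda>y. bump (0::'a) r y * (\<eta> / (2 * Z)))"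
          by (intro integrable_mult_left bump_integrable r(1))
        fix y :: 'a
        have "\<bar>w (x' + y) - w (x + y)\<bar> \<le> \<eta> / (2 * Z)"
          using d(2)[of "x' - x" "x + y"] that by (simp add: dist_norm algebra_simps)
        then show "norm (bump 0 r y * (w (x' + y) - w (x + y))) \<le> bump 0 r y * (\<eta> / (2 * Z))"
          using bump_nonneg[of 0 r y] by (simp only: real_norm_def abs_mult abs_of_nonneg mult_left_mono)
      qed
      also have "\<dots> = \<eta> / 2" using Z by (simp add: Z_def)
      finally show ?thesis using \<eta> by (simp add: dist_real_def)
    qed
    then show "\<exists>d>0. \<forall>x'. dist x' x < d \<longrightarrow> dist (v x') (v x) < \<eta>" using d(1) by blast
  qed
  have vsupp: "v x = 0" if "R + 1 < norm x" for x
  proof -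
    have "bump 0 r y * w (x + y) = 0" for y
    proof (cases "norm y < r")
      case True
      then have "R < norm (x + y)" using norm_triangle_ineq2[of x "- y"] that r by simp
      then show ?thesis using supp by simp
    qed (simp add: bump_zero[OF r(1)])
    then show ?thesis unfolding v_def by (simp only:) simp
  qed
  have x0R: "norm x0 \<le> R" using supp[of x0] x0 M by (cases "norm x0 \<le> R") auto
  then have "x0 \<in> cball 0 (R + 1)" by simp
  then have "cball 0 (R + 1) \<noteq> ({} :: 'a set)" by blast
  from continuous_attains_sup[OF compact_cball this continuous_on_subset[OF vcont subset_UNIV]]
  obtain xm where xm: "xm \<in> cball 0 (R + 1)" "\<And>x. x \<in> cball 0 (R + 1) \<Longrightarrow> v x \<le> v xm" by blast
  have vx0: "Z * (M - \<epsilon>') \<le> v x0" using vw[of x0] x0 by (simp add: abs_le_iff algebra_simps)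
  moreover have "v x0 \<le> v xm" using x0R by (intro xm(2)) simp
  ultimately have vxm: "Z * (M - \<epsilon>') \<le> v xm" by simp
  have vmax: "v x \<le> v xm" for x
  proof (cases "x \<in> cball 0 (R + 1)")
    case False
    then have "v x = 0" by (intro vsupp) simp
    moreover have "0 \<le> Z * (M - \<epsilon>')" using Z \<epsilon>' by simp
    ultimately show ?thesis using vxm by simp
  qed (rule xm(2))
  have wxm: "M - 2 * \<epsilon>' \<le> w xm"
  proof -
    have "Z * (M - \<epsilon>') \<le> Z * (w xm + \<epsilon>')" using vxm vw[of xm] by (simp add: abs_le_iff algebra_simps)
    then show ?thesis using Z by simp
  qed
  have "cball xm r \<subseteq> {x. m < w x}"
  proof
    fix x assume "x \<in> cball xm r"
    then have "\<bar>w (xm + (x - xm)) - w xm\<bar> \<le> \<epsilon>'" by (intro unif) (simp add: dist_norm norm_minus_commute)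
    then have "w xm - \<epsilon>' \<le> w x" by (simp add: abs_le_iff)
    then show "x \<in> {x. m < w x}" using wxm \<epsilon>' by simp
  qed
  then obtain l where l: "- e * (LBINT x. bump xm r x) \<le> l"
    "((\<lambda>\<delta>. LBINT x. bump xm r x * gen \<delta> w x) \<longlongrightarrow> l) (at_right 0)"
    using sub[OF r(1)] by blast
  have Zxm: "(LBINT x. bump xm r x) = Z"
    using lborel_shift(1)[of "bump xm r" xm] by (simp add: Z_def bump_shift)
  \<comment> \<open>Testing with the bump function around \<open>xm\<close> evaluates the
    mollification, so \<open>gen_Fubini\<close> yields the truncated generator of \<open>v\<close>
    at its maximum point.\<close>
  have vsh: "(LBINT x. bump xm r x * w (x + y)) = v (xm + y)" for y
    unfolding v_def lborel_shift(1)[of "\<lambda>x. bump xm r x * w (x + y)" xm, symmetric] bump_shift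
    by (simp only: add.assoc add.commute[of y])
  have vsh0: "(LBINT x. bump xm r x * w x) = v xm" using vsh[of 0] by simp
  have F: "(LBINT x. bump xm r x * gen \<delta> w x) = (LBINT y. kern \<delta> y * (v (xm + y) - v xm))"
    "integrable lborel (\<lambda>y. kern \<delta> y * (v (xm + y) - v xm))" if "0 < \<delta>" for \<delta>
    using gen_Fubini[OF that wm B bump_integrable[OF r(1)], of xm] by (simp_all add: vsh vsh0)
  \<comment> \<open>At a maximum all increments are nonpositive, so lowering the truncation from
    \<rho> only decreases the generator: the limit is bounded by the value at \<rho>.\<close>
  have "l \<le> (LBINT y. kern \<rho> y * (v (xm + y) - v xm))"
  proof (rule tendsto_upperbound[OF l(2)])
    have "\<forall>\<^sub>F \<delta> in at_right 0. 0 < \<delta> \<and> \<delta> < \<rho>" using \<rho> by (auto simp: eventually_at_right_field)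
    then show "\<forall>\<^sub>F \<delta> in at_right 0. (LBINT x. bump xm r x * gen \<delta> w x) \<le> (LBINT y. kern \<rho> y * (v (xm + y) - v xm))"
    proof eventually_elim
      case (elim \<delta>)
      have "kern \<delta> y * (v (xm + y) - v xm) \<le> kern \<rho> y * (v (xm + y) - v xm)" for y
        using elim vmax[of "xm + y"] by (intro mult_right_mono_neg kern_antimono) auto
      then show ?case using elim \<rho> by (simp add: F integral_mono)
    qed
  qed simp
  then have "(LBINT y. kern \<rho> y * (v xm - v (xm + y))) \<le> e * Z"
    using l(1) Zxm Bochner_Integration.integral_minus[of lborel "\<lambda>y. kern \<rho> y * (v (xm + y) - v xm)"]
    by (simp add: algebra_simps)
  moreover have "Z * ((LBINT y. kern \<rho> y * (M - w (xm + y))) - 2 * \<epsilon>' * \<Lambda>) \<le> (LBINT y. kern \<rho> y * (v xm - v (xm + y)))"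
  proof -
    have i: "integrable lborel (\<lambda>y. kern \<rho> y * (M - w (xm + y)))"
      using kern_shift_integrable[OF \<rho> wm B, of xm] kern_integrable[OF \<rho>, where 'a='a] by (simp add: right_diff_distrib)
    have "Z * ((LBINT y. kern \<rho> y * (M - w (xm + y))) - 2 * \<epsilon>' * \<Lambda>)
       = (LBINT y. Z * (kern \<rho> y * (M - w (xm + y)) - 2 * \<epsilon>' * kern \<rho> y))"
      using i kern_integrable[OF \<rho>, where 'a='a] by (simp add: \<Lambda>_def)
    also have "\<dots> \<le> (LBINT y. kern \<rho> y * (v xm - v (xm + y)))"
    proof (rule integral_mono)
      show "integrable lborel (\<lambda>y. Z * (kern \<rho> y * (M - w (xm + y)) - 2 * \<epsilon>' * kern \<rho> y))"
        using i kern_integrable[OF \<rho>, where 'a='a] by auto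
      show "integrable lborel (\<lambda>y. kern \<rho> y * (v xm - v (xm + y)))"
        using Bochner_Integration.integrable_minus[OF F(2)[OF \<rho>]] by (simp add: algebra_simps)
      fix y
      have "Z * (M - w (xm + y) - 2 * \<epsilon>') \<le> v xm - v (xm + y)"
        using vxm vw[of "xm + y"] by (simp add: abs_le_iff algebra_simps)
      then have "kern \<rho> y * (Z * (M - w (xm + y) - 2 * \<epsilon>')) \<le> kern \<rho> y * (v xm - v (xm + y))"
        by (intro mult_left_mono) auto
      then show "Z * (kern \<rho> y * (M - w (xm + y)) - 2 * \<epsilon>' * kern \<rho> y) \<le> kern \<rho> y * (v xm - v (xm + y))"
        by (simp add: algebra_simps)
    qed
    finally show ?thesis .
  qed
  ultimately have "Z * ((LBINT y. kern \<rho> y * (M - w (xm + y))) - 2 * \<epsilon>' * \<Lambda>) \<le> Z * e"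
    by (simp add: mult.commute)
  then have "(LBINT y. kern \<rho> y * (M - w (xm + y))) \<le> e + 2 * \<epsilon>' * \<Lambda>" using Z by simp
  then show thesis using that[of xm] wxm \<epsilon>' \<epsilon>\<Lambda> by simp
qed

end

section \<open>Weak and strong maximum principles\<close>

lemma attains_max_compact_support:
  fixes w :: "'a::euclidean_space \<Rightarrow> real"
  assumes cont: "continuous_on UNIV w" and supp: "\<And>x. R < norm x \<Longrightarrow> w x = 0" and pos: "0 < w a"
  obtains x0 where "\<And>x. w x \<le> w x0"
proof -
  have a: "a \<in> cball 0 R" using supp[of a] pos by (cases "R < norm a") auto
  then have "cball 0 R \<noteq> ({} :: 'a set)" by blast
  from continuous_attains_sup[OF compact_cball this continuous_on_subset[OF cont subset_UNIV]]
  obtain x0 where x0: "\<And>x. x \<in> cball 0 R \<Longrightarrow> w x \<le> w x0" by blast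
  have "w x \<le> w x0" for x
  proof (cases "x \<in> cball 0 R")
    case False
    then show ?thesis using supp[of x] x0[OF a] pos by simp
  qed (rule x0)
  then show thesis using that by blast
qed

context fractional
begin

lemma integrable_mult_gen:
  fixes \<phi> u :: "'a::euclidean_space \<Rightarrow> real"
  assumes \<phi>: "integrable lborel \<phi>" and \<delta>: "0 < \<delta>" and u: "u \<in> borel_measurable borel" "\<And>x. \<bar>u x\<bar> \<le> B"
  shows "integrable lborel (\<lambda>x. \<phi> x * gen \<delta> u x)"
proof (rule integrable_mult_bounded[OF \<phi>])
  show "gen \<delta> u \<in> borel_measurable lborel" using gen_measurable[OF \<delta> u] by simp
qed (rule gen_bound[OF \<delta> u])

text \<open>The pairing of \<phi> with the negative fractional Laplacian, expressed by convergence
  of truncated pairings. Linear combinations and dilations can then be handled inside the limit,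
  without returning to \<open>frac_laplacian\<close>.\<close>

definition gen_pairing :: "('a::euclidean_space \<Rightarrow> real) \<Rightarrow> ('a \<Rightarrow> real) \<Rightarrow> real \<Rightarrow> bool" where
  "gen_pairing \<phi> u l \<longleftrightarrow> ((\<lambda>\<delta>. LBINT x. \<phi> x * gen \<delta> u x) \<longlongrightarrow> l) (at_right 0)"

lemma gen_pairing_diff:
  fixes \<phi> :: "'a::euclidean_space \<Rightarrow> real"
  assumes \<phi>: "integrable lborel \<phi>" and u: "u \<in> borel_measurable borel" "\<And>x. \<bar>u x\<bar> \<le> B"
    and v: "v \<in> borel_measurable borel" "\<And>x. \<bar>v x\<bar> \<le> B'"
    and l: "gen_pairing \<phi> u l" "gen_pairing \<phi> v l'"
  shows "gen_pairing \<phi> (\<lambda>x. u x - A * v x) (l - A * l')"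
  unfolding gen_pairing_def
proof (rule Lim_transform_eventually)
  show "((\<lambda>\<delta>. (LBINT x. \<phi> x * gen \<delta> u x) - A * (LBINT x. \<phi> x * gen \<delta> v x)) \<longlongrightarrow> l - A * l') (at_right 0)"
    using l unfolding gen_pairing_def by (intro tendsto_intros)
  show "\<forall>\<^sub>F \<delta> in at_right 0. (LBINT x. \<phi> x * gen \<delta> u x) - A * (LBINT x. \<phi> x * gen \<delta> v x)
      = (LBINT x. \<phi> x * gen \<delta> (\<lambda>x. u x - A * v x) x)"
    using eventually_at_right_less[of 0]
  proof eventually_elim
    case (elim \<delta>)
    have "(LBINT x. \<phi> x * gen \<delta> (\<lambda>x. u x - A * v x) x)
       = (LBINT x. \<phi> x * gen \<delta> u x - A * (\<phi> x * gen \<delta> v x))"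
      by (simp only: gen_diff_scaled[OF elim u v] right_diff_distrib mult.left_commute[of A])
    also have "\<dots> = (LBINT x. \<phi> x * gen \<delta> u x) - A * (LBINT x. \<phi> x * gen \<delta> v x)"
      using integrable_mult_gen[OF \<phi> elim u] integrable_mult_gen[OF \<phi> elim v] by simp
    finally show ?case by simp
  qed
qed

text \<open>A positive maximum \<open>M\<close> would, at almost maximal points, lose at least
  \<open>M * k\<close> through jumps into \<open>S\<close>, where \<open>w\<close> vanishes, whereas
  the subsolution property allows only an arbitrarily small loss.\<close>

lemma weak_maximum_principle:
  fixes w :: "'a::euclidean_space \<Rightarrow> real"
  assumes cont: "continuous_on UNIV w" and G: "bounded G" and out: "\<And>x. x \<notin> G \<Longrightarrow> w x = 0"
    and sub: "\<And>c r. 0 < r \<Longrightarrow> cball c r \<subseteq> {x. 0 < w x} \<Longrightarrow> \<exists>l\<ge>0. gen_pairing (bump c r) w l"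
    and S: "S \<in> sets borel" "S \<inter> G = {}" "0 < k"
      "\<And>x. x \<in> G \<Longrightarrow> k \<le> (LBINT y. kern 1 y * indicator S (x + y))"
  shows "w x \<le> 0"
proof (rule ccontr)
  assume "\<not> w x \<le> 0"
  then have pos: "0 < w x" by simp
  obtain R where "\<forall>x\<in>G. norm x \<le> R" using G bounded_iff by blast
  then have supp: "w x = 0" if "R < norm x" for x using that out by force
  obtain x0 where x0: "\<And>x. w x \<le> w x0" using attains_max_compact_support[OF cont supp pos] by blast
  let ?M = "w x0"
  have M: "0 < ?M" using x0[of x] pos by linarith
  \<comment> \<open>\<epsilon> \<le> M places the point \<open>z\<close> in \<open>G\<close>, where
    the killing rate is available; \<epsilon> < M k is the contradiction.\<close>
  define \<epsilon> where "\<epsilon> = min ?M (?M * k / 2)"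
  have \<epsilon>: "0 < \<epsilon>" "\<epsilon> \<le> ?M" "\<epsilon> < ?M * k" using M S(3) mult_pos_pos[OF M S(3)] by (auto simp: \<epsilon>_def min_def)
  have sub0: "\<exists>l. - 0 * integral\<^sup>L lborel (bump c r) \<le> l \<and> ((\<lambda>\<delta>. LBINT x. bump c r x * gen \<delta> w x) \<longlongrightarrow> l) (at_right 0)"
    if "0 < r" "cball c r \<subseteq> {x. 0 < w x}" for c r
    using sub[OF that] by (auto simp: gen_pairing_def)
  obtain z where z: "?M - \<epsilon> < w z" "(LBINT y. kern 1 y * (?M - w (z + y))) \<le> 0 + \<epsilon>"
    using distributional_max_principle[OF cont supp x0 refl M M sub0 zero_less_one \<epsilon>(1)] by blast
  have zG: "z \<in> G" using z(1) \<epsilon> out[of z] by force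
  have wm: "w \<in> borel_measurable borel" using cont by (rule borel_measurable_continuous_onI)
  have "?M * k \<le> ?M * (LBINT y. kern 1 y * indicator S (z + y))"
    using S(4)[OF zG] M by (intro mult_left_mono) auto
  also have "\<dots> = (LBINT y. kern 1 y * (?M * indicator S (z + y)))"
    unfolding integral_mult_right_zero[symmetric] by (simp only: mult.left_commute)
  also have "\<dots> \<le> (LBINT y. kern 1 y * (?M - w (z + y)))"
  proof (rule integral_mono)
    note S(1)[measurable] wm[measurable]
    show "integrable lborel (\<lambda>y. kern 1 y * (?M * indicator S (z + y)))"
      by (rule kern_shift_integrable[where B="?M" and u="\<lambda>y. ?M * indicator S y"]) (use M in \<open>auto split: split_indicator\<close>)
    obtain B where wb: "\<And>x. \<bar>w x\<bar> \<le> B" using bounded_compact_support[OF cont supp] by blast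
    have B: "\<bar>?M - w x\<bar> \<le> ?M + B" for x using wb[of x] M unfolding abs_le_iff by linarith
    show "integrable lborel (\<lambda>y. kern 1 y * (?M - w (z + y)))"
      by (rule kern_shift_integrable[where B="?M + B" and u="\<lambda>y. ?M - w y"]) (use B in auto)
    fix y
    have "?M * indicator S (z + y) \<le> ?M - w (z + y)"
      using out[of "z + y"] S(2) x0[of "z + y"] by (auto simp: indicator_def disjoint_iff)
    then show "kern 1 y * (?M * indicator S (z + y)) \<le> kern 1 y * (?M - w (z + y))"
      by (intro mult_left_mono) auto
  qed
  finally show False using z(2) \<epsilon>(3) by simp
qed

text \<open>
  Adding a small multiple of a bump function localises the maximum near \<open>p\<close>; the jumps into \<open>S\<close>
  then contradict the subsolution inequality.
\<close>

lemma strong_maximum_principle: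
  fixes v :: "'a::euclidean_space \<Rightarrow> real"
  assumes cont: "continuous_on UNIV v" and supp: "\<And>x. R < norm x \<Longrightarrow> v x = 0"
    and max: "\<And>x. v x \<le> v p" "0 \<le> v p" and C: "0 \<le> C" and s: "0 < s"
    and sub: "\<And>\<eta> c r. 0 < \<eta> \<Longrightarrow> \<eta> \<le> 1 \<Longrightarrow> 0 < r \<Longrightarrow> cball c r \<subseteq> {x \<in> ball p s. v p - \<eta> < v x} \<Longrightarrow>
       \<exists>l\<ge>- (C * \<eta>) * (LBINT x. bump c r x). gen_pairing (bump c r) v l"
    and S: "open S" "S \<noteq> {}" "bounded S" "p \<notin> closure S" and \<kappa>: "0 < \<kappa>" "\<And>x. x \<in> S \<Longrightarrow> v x \<le> v p - \<kappa>"
  shows False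
proof -
  obtain d0 where d0: "0 < d0" "\<And>z. z \<in> S \<Longrightarrow> d0 \<le> norm (z - p)"
  proof -
    have "open (- closure S)" by (intro open_Compl closed_closure)
    then obtain d0 where "0 < d0" "ball p d0 \<subseteq> - closure S" using S(4) open_contains_ball by blast
    moreover from this have "d0 \<le> norm (z - p)" if "z \<in> S" for z
      using that closure_subset[of S] by (force simp: dist_norm norm_minus_commute not_less)
    ultimately show thesis using that by blast
  qed
  define r where "r = min s (d0 / 2)"
  have r: "0 < r" "r \<le> s" "2 * r \<le> d0" using s d0 by (auto simp: r_def)
  \<comment> \<open>Points of \<open>ball p r\<close> are at distance at least d0/2 from
    \<open>S\<close>, so the truncation at d0/4 leaves all jumps into \<open>S\<close>
    intact.\<close>
  define \<rho> where "\<rho> = d0 / 4"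
  have \<rho>: "0 < \<rho>" using d0 by (simp add: \<rho>_def)
  have far: "\<rho> < norm (z - x)" if "z \<in> S" "x \<in> ball p r" for z x
  proof -
    have "norm (z - p) \<le> norm (z - x) + norm (x - p)" using norm_triangle_ineq[of "z - x" "x - p"] by simp
    moreover have "norm (x - p) < r" using that(2) by (simp add: dist_norm norm_minus_commute)
    ultimately show ?thesis using d0(1) d0(2)[OF that(1)] r unfolding \<rho>_def by linarith
  qed
  obtain k where k: "0 < k" "\<And>x \<delta>. x \<in> ball p r \<Longrightarrow> 0 < \<delta> \<Longrightarrow> \<delta> \<le> \<rho> \<Longrightarrow> k \<le> (LBINT y. kern \<delta> y * indicator S (x + y))"
    using kern_set_lower[OF \<rho> S(1,2) far S(3) bounded_ball] by blast
  let ?\<psi> = "bump p r"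
  have \<psi>T: "?\<psi> \<in> test_functions UNIV" by (rule bump_test_function[OF r(1)]) simp
  obtain C1 where C1: "0 \<le> C1" "\<And>\<delta> x. 0 < \<delta> \<Longrightarrow> \<bar>gen \<delta> ?\<psi> x\<bar> \<le> C1" using gen_test_bound[OF \<psi>T] by blast
  \<comment> \<open>The perturbation costs at most \<open>C1 * \<eta>\<close> through the generator
    of the bump function and \<open>C * \<eta>\<close> through \<open>sub\<close>; together less
    than half of the loss \<kappa> k into \<open>S\<close>.\<close>
  define \<eta> where "\<eta> = min 1 (\<kappa> * k / (4 * (C + C1 + 1)))"
  have \<eta>: "0 < \<eta>" "\<eta> \<le> 1" "(C + C1) * \<eta> < \<kappa> * k / 2"
  proof -
    show "0 < \<eta>" "\<eta> \<le> 1" using \<kappa> k C C1 by (auto simp: \<eta>_def)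
    have "(C + C1 + 1) * \<eta> \<le> (C + C1 + 1) * (\<kappa> * k / (4 * (C + C1 + 1)))"
      using C C1 by (intro mult_left_mono) (auto simp: \<eta>_def)
    also have "\<dots> = \<kappa> * k / 4" using C C1 by (simp add: field_simps)
    finally have "(C + C1) * \<eta> + \<eta> \<le> \<kappa> * k / 4" by (simp add: algebra_simps)
    moreover have "0 < \<kappa> * k" using \<kappa> k by simp
    ultimately show "(C + C1) * \<eta> < \<kappa> * k / 2" using \<open>0 < \<eta>\<close> by linarith
  qed
  \<comment> \<open>The double negation matches the shape of
    \<open>gen_pairing_diff\<close>.\<close>
  define w where "w = (\<lambda>x. v x - (- \<eta>) * ?\<psi> x)"
  have wcont: "continuous_on UNIV w"
    unfolding w_def by (intro continuous_intros cont bump_continuous)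
  define R' where "R' = max R (norm p + r)"
  have wsupp: "w x = 0" if "R' < norm x" for x
  proof -
    have "r \<le> norm (x - p)" using that norm_triangle_ineq2[of x p] by (simp add: R'_def)
    from bump_zero[OF r(1) this] show ?thesis using supp[of x] that by (simp add: w_def R'_def)
  qed
  have wp: "v p < w p" using \<eta> bump_pos_iff[OF r(1), of p p] r by (simp add: w_def)
  then have "0 < w p" using max by linarith
  then obtain xm where xm: "\<And>x. w x \<le> w xm" using attains_max_compact_support[OF wcont wsupp] by blast
  let ?M = "w xm"
  have M: "0 < ?M" "v p < ?M" using xm[of p] wp max(2) by linarith+
  \<comment> \<open>As \<open>v\<close> never exceeds \<open>v p\<close>, larger values of
    \<open>w\<close> are due to the bump function. They occur only near \<open>p\<close>, and
    \<open>v\<close> is within \<eta> of its maximum there, exactly where \<open>sub\<close>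
    applies.\<close>
  have loc: "x \<in> ball p r \<and> v p - \<eta> < v x" if "v p < w x" for x
  proof -
    have pos: "0 < \<eta> * ?\<psi> x" using that max(1)[of x] by (simp add: w_def)
    then have "0 < ?\<psi> x" using \<eta> by (simp add: zero_less_mult_iff)
    then have "x \<in> ball p r" using bump_pos_iff[OF r(1), of p x] by (simp add: dist_norm norm_minus_commute)
    moreover have "\<eta> * ?\<psi> x \<le> \<eta>" using \<eta> bump_le_1 bump_nonneg by (intro mult_left_le) auto
    ultimately show ?thesis using that by (simp add: w_def)
  qed
  have vm[measurable]: "v \<in> borel_measurable borel" using cont by (rule borel_measurable_continuous_onI)
  obtain B where B: "\<And>x. \<bar>v x\<bar> \<le> B" using bounded_compact_support[OF cont supp] by blast
  have \<psi>b: "\<bar>?\<psi> x\<bar> \<le> 1" for x using bump_nonneg[of p r x] bump_le_1[of p r x] by simp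
  have subw: "\<exists>l. - ((C + C1) * \<eta>) * integral\<^sup>L lborel (bump c q) \<le> l \<and>
      ((\<lambda>\<delta>. LBINT x. bump c q x * gen \<delta> w x) \<longlongrightarrow> l) (at_right 0)"
    if q: "0 < q" "cball c q \<subseteq> {x. v p < w x}" for c q
  proof -
    let ?Z = "integral\<^sup>L lborel (bump c q)"
    have "cball c q \<subseteq> {x \<in> ball p s. v p - \<eta> < v x}"
      using q(2) loc r(2) by fastforce
    then obtain l where l: "l \<ge> - (C * \<eta>) * ?Z" "gen_pairing (bump c q) v l"
      using sub[OF \<eta>(1,2) q(1)] by blast
    let ?L = "- frac_laplacian_distr \<alpha> ?\<psi> (bump c q)"
    have bT: "bump c q \<in> test_functions UNIV" by (rule bump_test_function[OF q(1)]) simp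
    have L: "gen_pairing (bump c q) ?\<psi> ?L"
      unfolding gen_pairing_def by (rule pairing_tendsto[OF bT bump_measurable \<psi>b])
    have "- C1 * ?Z \<le> ?L"
    proof (rule tendsto_lowerbound[OF L[unfolded gen_pairing_def]])
      show "\<forall>\<^sub>F \<delta> in at_right 0. - C1 * ?Z \<le> (LBINT x. bump c q x * gen \<delta> ?\<psi> x)"
        using eventually_at_right_less[of 0]
      proof eventually_elim
        case (elim \<delta>)
        have "- C1 * ?Z = (LBINT x. bump c q x * (- C1))" by simp
        also have "\<dots> \<le> (LBINT x. bump c q x * gen \<delta> ?\<psi> x)"
        proof (rule integral_mono)
          show "integrable lborel (\<lambda>x. bump c q x * - C1)" using bump_integrable[OF q(1)] by (rule integrable_mult_left)
          show "integrable lborel (\<lambda>x. bump c q x * gen \<delta> ?\<psi> x)"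
            by (rule integrable_mult_gen[OF bump_integrable[OF q(1)] elim bump_measurable \<psi>b])
          fix x
          show "bump c q x * - C1 \<le> bump c q x * gen \<delta> ?\<psi> x"
            using C1(2)[OF elim, of x] bump_nonneg[of c q x] by (intro mult_left_mono) (auto simp: abs_le_iff)
        qed
        finally show ?case .
      qed
    qed simp
    then have "\<eta> * (- C1 * ?Z) \<le> \<eta> * ?L" using \<eta> by (intro mult_left_mono) auto
    then have "- ((C + C1) * \<eta>) * ?Z \<le> l - (- \<eta>) * ?L" using l(1) by (simp add: algebra_simps)
    moreover have "gen_pairing (bump c q) w (l - (- \<eta>) * ?L)"
      unfolding w_def by (rule gen_pairing_diff[OF bump_integrable[OF q(1)] vm B bump_measurable \<psi>b l(2) L])
    ultimately show ?thesis unfolding gen_pairing_def by blast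
  qed
  \<comment> \<open>The first bound forces \<open>v p < w z\<close> and hence localises
    \<open>z\<close>; the second is the other half of the loss \<kappa> k.\<close>
  define \<epsilon> where "\<epsilon> = min (?M - v p) (\<kappa> * k / 2)"
  have \<epsilon>: "0 < \<epsilon>" "\<epsilon> \<le> ?M - v p" "\<epsilon> \<le> \<kappa> * k / 2"
  proof -
    have "0 < \<kappa> * k" using \<kappa>(1) k(1) by simp
    then show "0 < \<epsilon>" using M(2) by (simp add: \<epsilon>_def)
    show "\<epsilon> \<le> ?M - v p" "\<epsilon> \<le> \<kappa> * k / 2"
      unfolding \<epsilon>_def by (rule min.cobounded1, rule min.cobounded2)
  qed
  obtain z where z: "?M - \<epsilon> < w z" "(LBINT y. kern \<rho> y * (?M - w (z + y))) \<le> (C + C1) * \<eta> + \<epsilon>"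
    using distributional_max_principle[OF wcont wsupp xm refl M subw \<rho> \<epsilon>(1)] by blast
  have "v p < w z" using z(1) \<epsilon> by linarith
  then have zb: "z \<in> ball p r" using loc by blast
  have wS: "w y \<le> ?M - \<kappa>" if "y \<in> S" for y
  proof -
    have "r \<le> norm (y - p)" using d0(2)[OF that] r by linarith
    from bump_zero[OF r(1) this] have "w y = v y" by (simp add: w_def)
    then show ?thesis using \<kappa>(2)[OF that] M(2) by linarith
  qed
  note S(1)[THEN borel_open, measurable]
  have wm[measurable]: "w \<in> borel_measurable borel" using wcont by (rule borel_measurable_continuous_onI)
  have "\<kappa> * k \<le> \<kappa> * (LBINT y. kern \<rho> y * indicator S (z + y))"
    using k(2)[OF zb \<rho> order_refl] \<kappa> by (intro mult_left_mono) auto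
  also have "\<dots> = (LBINT y. kern \<rho> y * (\<kappa> * indicator S (z + y)))"
    unfolding integral_mult_right_zero[symmetric] by (simp only: mult.left_commute)
  also have "\<dots> \<le> (LBINT y. kern \<rho> y * (?M - w (z + y)))"
  proof (rule integral_mono)
    show "integrable lborel (\<lambda>y. kern \<rho> y * (\<kappa> * indicator S (z + y)))"
      by (rule kern_shift_integrable[where B="\<kappa>" and u="\<lambda>y. \<kappa> * indicator S y"]) (use \<kappa> \<rho> in \<open>auto split: split_indicator\<close>)
    have "\<bar>?M - w x\<bar> \<le> ?M + B + \<eta>" for x
    proof -
      have "0 \<le> \<eta> * ?\<psi> x" "\<eta> * ?\<psi> x \<le> \<eta>" using \<eta> bump_nonneg[of p r x] bump_le_1[of p r x] by (auto intro: mult_left_le)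
      then show ?thesis using B[of x] M by (simp add: w_def abs_le_iff)
    qed
    then show "integrable lborel (\<lambda>y. kern \<rho> y * (?M - w (z + y)))"
      by (intro kern_shift_integrable[where B="?M + B + \<eta>" and u="\<lambda>y. ?M - w y"]) (use \<rho> in auto)
    fix y
    have "\<kappa> * indicator S (z + y) \<le> ?M - w (z + y)"
      using wS[of "z + y"] xm[of "z + y"] by (auto simp: indicator_def)
    then show "kern \<rho> y * (\<kappa> * indicator S (z + y)) \<le> kern \<rho> y * (?M - w (z + y))"
      by (intro mult_left_mono) auto
  qed
  finally show False using z(2) \<eta>(3) \<epsilon>(3) by linarith
qed

section \<open>Dilations\<close>

lemma gen_dilate:
  assumes "0 < t"
  shows "gen \<delta> (\<lambda>x. u (t *\<^sub>R x)) x = t powr \<alpha> * gen (t * \<delta>) u (t *\<^sub>R x)"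
proof -
  have "gen (t * \<delta>) u (t *\<^sub>R x) = t powr (- \<alpha>) * gen \<delta> (\<lambda>x. u (t *\<^sub>R x)) x"
    using integral_kern_scale(1)[OF assms, of \<delta> "\<lambda>y. u (t *\<^sub>R x + y) - u (t *\<^sub>R x)"]
    by (simp add: gen_def scaleR_add_right)
  then show ?thesis using assms by (simp add: powr_minus field_simps)
qed

text \<open>Dilating the function rescales the truncation to \<open>t * \<delta>\<close>, which is
  harmless because only the limit \<delta> \<rightarrow> 0 matters. The remaining factor combines
  the scaling of the generator with the Jacobian.\<close>

lemma gen_pairing_dilate:
  fixes u :: "'a::euclidean_space \<Rightarrow> real"
  assumes t: "0 < t" and l: "gen_pairing (bump (t *\<^sub>R c) (t * r)) u l"
  shows "gen_pairing (bump c r) (\<lambda>x. u (t *\<^sub>R x)) (t powr \<alpha> / t ^ DIM('a) * l)"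
proof -
  have e: "(LBINT x. bump c r x * gen \<delta> (\<lambda>x. u (t *\<^sub>R x)) x)
      = t powr \<alpha> / t ^ DIM('a) * (LBINT x. bump (t *\<^sub>R c) (t * r) x * gen (t * \<delta>) u x)" for \<delta>
  proof -
    have b: "bump (t *\<^sub>R c) (t * r) (t *\<^sub>R x) = bump c r x" for x
      using bump_scale[OF t, of c r "t *\<^sub>R x"] t by simp
    have "(LBINT x. bump (t *\<^sub>R c) (t * r) x * gen (t * \<delta>) u x)
       = t ^ DIM('a) * (LBINT x. bump c r x * gen (t * \<delta>) u (t *\<^sub>R x))"
      using integral_lborel_affine(1)[of t "\<lambda>x. bump (t *\<^sub>R c) (t * r) x * gen (t * \<delta>) u x" 0] t by (simp add: b)
    moreover have "(LBINT x. bump c r x * gen \<delta> (\<lambda>x. u (t *\<^sub>R x)) x)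
       = t powr \<alpha> * (LBINT x. bump c r x * gen (t * \<delta>) u (t *\<^sub>R x))"
      unfolding gen_dilate[OF t] integral_mult_right_zero[symmetric] by (simp only: mult.left_commute)
    ultimately show ?thesis using t by simp
  qed
  have "filterlim (\<lambda>\<delta>. t * \<delta>) (at_right 0) (at_right 0)"
    using t by (intro filterlim_times_pos[where p=0] filterlim_ident) auto
  then have "((\<lambda>\<delta>. LBINT x. bump (t *\<^sub>R c) (t * r) x * gen (t * \<delta>) u x) \<longlongrightarrow> l) (at_right 0)"
    using l unfolding gen_pairing_def by (rule filterlim_compose[rotated])
  then show ?thesis unfolding gen_pairing_def e by (intro tendsto_intros)
qed

end

section \<open>Existence, uniqueness and shape of the solution\<close>

context ring_problem
begin

definition rhs :: "('a \<Rightarrow> real) \<Rightarrow> 'a \<Rightarrow> real" where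
  "rhs u x = indicator D x * f x (u x)"

lemma rhs_measurable: "u \<in> borel_measurable borel \<Longrightarrow> (\<And>x. u x \<in> {0..1}) \<Longrightarrow> rhs u \<in> borel_measurable borel"
  using f_comp_measurable by (simp add: rhs_def[abs_def])

lemma rhs_bounds:
  obtains F where "0 < F" "\<And>u x. (\<And>x. u x \<in> {0..1}) \<Longrightarrow> 0 \<le> rhs u x \<and> rhs u x \<le> F"
proof -
  obtain F where "0 < F" "\<And>x v. x \<in> D \<Longrightarrow> v \<in> {0..1} \<Longrightarrow> f x v \<le> F" using f_upper by blast
  then show thesis using that[of F] f_nonneg by (auto simp: rhs_def indicator_def)
qed

lemma rhs_integrable:
  assumes "0 < r" "u \<in> borel_measurable borel" "\<And>x. u x \<in> {0..1}"
  shows "integrable lborel (\<lambda>x. bump c r x * rhs u x)" "integrable lborel (\<lambda>x. bump c r x * rhs u (t *\<^sub>R x))"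
proof -
  obtain F where F: "0 < F" "\<And>u x. (\<And>x. u x \<in> {0..1}) \<Longrightarrow> 0 \<le> rhs u x \<and> rhs u x \<le> F" using rhs_bounds by blast
  have b: "\<bar>rhs u x\<bar> \<le> F" for x using F(2)[of u x] assms(3) by simp
  have m[measurable]: "rhs u \<in> borel_measurable borel" by (rule rhs_measurable[OF assms(2,3)])
  show "integrable lborel (\<lambda>x. bump c r x * rhs u x)" by (rule bump_mult_integrable[OF assms(1) m b])
  show "integrable lborel (\<lambda>x. bump c r x * rhs u (t *\<^sub>R x))"
    by (rule bump_mult_integrable[OF assms(1) _ b]) measurable
qed

lemma solution_facts:
  assumes "is_solution \<alpha> D0 D1 f u"
  shows "continuous_on UNIV u" "u \<in> borel_measurable borel" "\<And>x. u x \<in> {0..1}" "\<And>x. \<bar>u x\<bar> \<le> 1"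
    "\<And>x. x \<notin> D0 \<Longrightarrow> u x = 0" "\<And>x. x \<in> closure D1 \<Longrightarrow> u x = 1"
proof -
  show c: "continuous_on UNIV u" using assms by (simp add: is_solution_def)
  then show "u \<in> borel_measurable borel" by (rule borel_measurable_continuous_onI)
  show "u x \<in> {0..1}" "\<bar>u x\<bar> \<le> 1" for x using assms by (auto simp: is_solution_def abs_le_iff intro: order_trans[of _ 0])
qed (use assms in \<open>auto simp: is_solution_def\<close>)

text \<open>From here on the qualitative arguments use the distributional equation through bump
  functions alone.\<close>

lemma solution_pairing:
  assumes u: "is_solution \<alpha> D0 D1 f u" and r: "0 < r" and D: "cball c r \<subseteq> D"
  shows "gen_pairing (bump c r) u (LBINT x. bump c r x * rhs u x)"
proof -
  have T: "bump c r \<in> test_functions D" by (rule bump_test_function[OF r D])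
  have "- frac_laplacian_distr \<alpha> u (bump c r) = (LINT x:D|lborel. f x (u x) * bump c r x)"
    using u T by (auto simp: is_solution_def D_def)
  also have "\<dots> = (LBINT x. bump c r x * rhs u x)"
    unfolding set_lebesgue_integral_def by (simp add: rhs_def mult_ac)
  finally show ?thesis
    using pairing_tendsto[OF T solution_facts(2,4)[OF u]] by (simp add: gen_pairing_def)
qed

lemma solution_exists: "\<exists>u. is_solution \<alpha> D0 D1 f u"
proof -
  obtain \<delta> U u where \<delta>: "\<And>n. 0 < \<delta> n" "\<delta> \<longlonglongrightarrow> 0" and U: "\<And>n. is_approx (\<delta> n) (U n)"
    and lim: "\<And>x. (\<lambda>n. U n x) \<longlonglongrightarrow> u x" and cont: "continuous_on UNIV u"
    using approx_limit by blast
  have Um: "\<And>n. U n \<in> borel_measurable borel" and U01: "\<And>n x. U n x \<in> {0..1}"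
    and U0: "\<And>n x. x \<notin> D0 \<Longrightarrow> U n x = 0" and U1: "\<And>n x. x \<in> closure D1 \<Longrightarrow> U n x = 1"
    and Ug: "\<And>n x. x \<in> D \<Longrightarrow> gen (\<delta> n) (U n) x = f x (U n x)"
    using U by (auto simp: is_approx_def)
  have Ub: "\<bar>U n x\<bar> \<le> 1" for n x using U01[of n x] by auto
  have u01: "u x \<in> {0..1}" for x
  proof -
    have "0 \<le> u x" by (rule LIMSEQ_le_const[OF lim]) (use U01 in auto)
    moreover have "u x \<le> 1" by (rule LIMSEQ_le_const2[OF lim]) (use U01 in auto)
    ultimately show ?thesis by simp
  qed
  have u0: "u x = 0" if "x \<notin> D0" for x using lim[of x] U0[OF that] LIMSEQ_const_iff[of 0 "u x"] by simp
  have u1: "u x = 1" if "x \<in> closure D1" for x using lim[of x] U1[OF that] LIMSEQ_const_iff[of 1 "u x"] by simp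
  have um: "u \<in> borel_measurable borel" using cont by (rule borel_measurable_continuous_onI)
  have "- frac_laplacian_distr \<alpha> u \<phi> = (LINT x:D|lborel. f x (u x) * \<phi> x)" if \<phi>: "\<phi> \<in> test_functions D" for \<phi>
  proof -
    have out: "\<phi> x = 0" if "x \<notin> D" for x
      using \<phi> that closure_subset[of "{x. \<phi> x \<noteq> 0}"] by (auto simp: test_functions_def)
    obtain A B R where b: "0 \<le> A" "\<And>x y. \<bar>sdiff \<phi> x y\<bar> \<le> A * (norm y)\<^sup>2" "\<And>x. \<bar>\<phi> x\<bar> \<le> B" "\<And>x. R < norm x \<Longrightarrow> \<phi> x = 0"
      "continuous_on UNIV \<phi>"
      by (rule test_function_bounds[OF \<phi>], rule that)
    have \<phi>m[measurable]: "\<phi> \<in> borel_measurable borel" using b(5) by (rule borel_measurable_continuous_onI)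
    have \<phi>i: "integrable lborel \<phi>" by (rule integrable_compact_support[OF \<phi>m b(3,4)])
    obtain F where F: "0 < F" "\<And>u x. (\<And>x. u x \<in> {0..1}) \<Longrightarrow> 0 \<le> rhs u x \<and> rhs u x \<le> F" using rhs_bounds by blast
    obtain C where C: "0 < C" "\<And>x v1 v2. x \<in> D \<Longrightarrow> v1 \<in> {0..1} \<Longrightarrow> v2 \<in> {0..1} \<Longrightarrow> \<bar>f x v1 - f x v2\<bar> \<le> C * \<bar>v1 - v2\<bar>"
      using f_Lipschitz by blast
    \<comment> \<open>The left-hand side of the limit equation. The right-hand side is the limit of
      the same sequence, computed from the pointwise equations by the Lipschitz bound in the second
      argument.\<close>
    have "(\<lambda>n. LBINT x. \<phi> x * gen (\<delta> n) (U n) x) \<longlonglongrightarrow> - frac_laplacian_distr \<alpha> u \<phi>"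
      by (rule pairing_tendsto_sequence[OF \<phi> Um Ub lim \<delta>])
    moreover have "\<phi> x * gen (\<delta> n) (U n) x = \<phi> x * rhs (U n) x" for n x
      using out[of x] Ug[of x n] by (cases "x \<in> D") (auto simp: rhs_def)
    ultimately have 1: "(\<lambda>n. LBINT x. \<phi> x * rhs (U n) x) \<longlonglongrightarrow> - frac_laplacian_distr \<alpha> u \<phi>" by simp
    have "(\<lambda>n. LBINT x. \<phi> x * rhs (U n) x) \<longlonglongrightarrow> (LBINT x. \<phi> x * rhs u x)"
    proof (rule integral_dominated_convergence)
      note rhs_measurable[OF Um U01, measurable] rhs_measurable[OF um u01, measurable]
      show "integrable lborel (\<lambda>x. F * \<bar>\<phi> x\<bar>)" using \<phi>i by auto
      show "(\<lambda>x. \<phi> x * rhs u x) \<in> borel_measurable lborel" by measurable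
      show "(\<lambda>x. \<phi> x * rhs (U n) x) \<in> borel_measurable lborel" for n by measurable
      show "AE x in lborel. norm (\<phi> x * rhs (U n) x) \<le> F * \<bar>\<phi> x\<bar>" for n
      proof (rule AE_I2)
        fix x
        have "\<bar>rhs (U n) x\<bar> \<le> F" using F(2)[of "U n" x] U01 by simp
        then have "\<bar>\<phi> x\<bar> * \<bar>rhs (U n) x\<bar> \<le> \<bar>\<phi> x\<bar> * F" by (intro mult_left_mono) auto
        then show "norm (\<phi> x * rhs (U n) x) \<le> F * \<bar>\<phi> x\<bar>" by (simp only: real_norm_def abs_mult mult.commute)
      qed
      show "AE x in lborel. (\<lambda>n. \<phi> x * rhs (U n) x) \<longlonglongrightarrow> \<phi> x * rhs u x"
      proof (intro AE_I2 tendsto_mult tendsto_const)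
        fix x
        show "(\<lambda>n. rhs (U n) x) \<longlonglongrightarrow> rhs u x"
        proof (cases "x \<in> D")
          case True
          have "(\<lambda>n. C * \<bar>U n x - u x\<bar>) \<longlonglongrightarrow> C * \<bar>u x - u x\<bar>" by (intro tendsto_intros lim)
          then have l0: "(\<lambda>n. C * \<bar>U n x - u x\<bar>) \<longlonglongrightarrow> 0" by (simp only: diff_self abs_zero mult_zero_right)
          have "norm (rhs (U n) x - rhs u x) \<le> C * \<bar>U n x - u x\<bar>" for n
            using C(2)[OF True U01[of n x] u01[of x]] True by (simp add: rhs_def)
          then have "(\<lambda>n. rhs (U n) x - rhs u x) \<longlonglongrightarrow> 0"
            by (intro Lim_null_comparison[OF _ l0] always_eventually allI)
          then show ?thesis by (rule LIM_zero_cancel)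
        qed (simp add: rhs_def)
      qed
    qed
    then have "- frac_laplacian_distr \<alpha> u \<phi> = (LBINT x. \<phi> x * rhs u x)" by (rule LIMSEQ_unique[OF 1])
    also have "\<dots> = (LINT x:D|lborel. f x (u x) * \<phi> x)"
      unfolding set_lebesgue_integral_def by (simp add: rhs_def mult_ac)
    finally show ?thesis .
  qed
  then have "is_solution \<alpha> D0 D1 f u"
    using cont u01 u0 u1 unfolding is_solution_def D_def
    by (auto simp: bounded_iff intro!: exI[of _ 1])
  then show ?thesis by blast
qed

section \<open>Uniqueness\<close>

lemma solution_le:
  assumes u1: "is_solution \<alpha> D0 D1 f u1" and u2: "is_solution \<alpha> D0 D1 f u2"
  shows "u1 x \<le> u2 x"
proof -
  note s1 = solution_facts[OF u1] and s2 = solution_facts[OF u2]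
  obtain S k where S: "S \<in> sets borel" "S \<inter> D0 = {}" and k: "0 < k"
    "\<And>x \<delta>. x \<in> D0 \<Longrightarrow> 0 < \<delta> \<Longrightarrow> \<delta> \<le> 1 \<Longrightarrow> k \<le> (LBINT y. kern \<delta> y * indicator S (x + y))"
    using killing_set by blast
  have "u1 x - u2 x \<le> 0"
  proof (rule weak_maximum_principle[where w="\<lambda>x. u1 x - u2 x" and G=D0 and S=S and k=k])
    show "continuous_on UNIV (\<lambda>x. u1 x - u2 x)" by (intro continuous_intros s1 s2)
    show "\<exists>l\<ge>0. gen_pairing (bump c r) (\<lambda>x. u1 x - u2 x) l" if r: "0 < r" and c: "cball c r \<subseteq> {x. 0 < u1 x - u2 x}" for c r
    proof -
      \<comment> \<open>Off \<open>D\<close> both solutions have the same prescribed values, so a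
        strict inequality can hold only in the ring. There monotonicity of \<open>f\<close> makes
        the difference a subsolution.\<close>
      have cD: "x \<in> D" if "x \<in> cball c r" for x
      proof -
        have "u2 x < u1 x" using c that by auto
        then show ?thesis using s1(3)[of x] s2(3)[of x] s1(5)[of x] s2(6)[of x] unfolding D_def by force
      qed
      have "gen_pairing (bump c r) (\<lambda>x. u1 x - 1 * u2 x)
        ((LBINT x. bump c r x * rhs u1 x) - 1 * (LBINT x. bump c r x * rhs u2 x))"
        by (rule gen_pairing_diff[OF bump_integrable[OF r] s1(2,4) s2(2,4) solution_pairing[OF u1 r] solution_pairing[OF u2 r]])
           (use cD in auto)
      moreover have "0 \<le> (LBINT x. bump c r x * rhs u1 x) - 1 * (LBINT x. bump c r x * rhs u2 x)"
      proof -
        have i: "integrable lborel (\<lambda>x. bump c r x * rhs u1 x)" "integrable lborel (\<lambda>x. bump c r x * rhs u2 x)"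
          using rhs_integrable(1)[OF r s1(2,3)] rhs_integrable(1)[OF r s2(2,3)] by auto
        have "0 * (LBINT x. bump c r x) \<le> (LBINT x. bump c r x * (rhs u1 x - rhs u2 x))"
        proof (rule bump_integral_lower[OF r])
          show "integrable lborel (\<lambda>x. bump c r x * (rhs u1 x - rhs u2 x))" using i by (simp add: right_diff_distrib)
          fix x assume x: "x \<in> cball c r"
          then have "u2 x \<le> u1 x" using c by auto
          then show "0 \<le> rhs u1 x - rhs u2 x"
            using f_mono[OF cD[OF x] s2(3)[of x] s1(3)[of x]] cD[OF x] by (simp add: rhs_def)
        qed
        then show ?thesis using i by (simp add: right_diff_distrib)
      qed
      ultimately show ?thesis by (simp only: mult_1) blast
    qed
  qed (use S k bounded_D0 s1(5) s2(5) in auto)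
  then show ?thesis by simp
qed

section \<open>Monotonicity along rays\<close>

lemma D0_dilate: "1 \<le> t \<Longrightarrow> t *\<^sub>R x \<in> D0 \<Longrightarrow> x \<in> D0"
proof -
  assume t: "1 \<le> t" "t *\<^sub>R x \<in> D0"
  then have "inverse t *\<^sub>R (t *\<^sub>R x) \<in> D0"
    using star_D0 unfolding starshaped_def by (metis atLeastAtMost_iff image_subset_iff inverse_le_1_iff inverse_nonnegative_iff_nonnegative order_trans zero_le_one)
  then show "x \<in> D0" using t by simp
qed

lemma closure_D1_dilate: "1 \<le> t \<Longrightarrow> t *\<^sub>R x \<in> closure D1 \<Longrightarrow> x \<in> closure D1"
proof -
  assume t: "1 \<le> t" "t *\<^sub>R x \<in> closure D1"
  have "(\<lambda>x. inverse t *\<^sub>R x) ` D1 \<subseteq> D1"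
    using star_D1 t unfolding starshaped_def by (simp add: inverse_le_1_iff)
  then have "(\<lambda>x. inverse t *\<^sub>R x) ` closure D1 \<subseteq> closure D1"
    unfolding closure_scaleR by (rule closure_mono)
  then have "inverse t *\<^sub>R (t *\<^sub>R x) \<in> closure D1" using t by blast
  then show "x \<in> closure D1" using t by simp
qed

text \<open>The scaling hypothesis moves the source from \<open>t *\<^sub>R x\<close> back to
  \<open>x\<close> at the value \<open>u (t *\<^sub>R x)\<close>. Replacing this value by
  \<open>u x\<close> costs nothing where it is larger, by monotonicity, and at most
  \<open>C * \<eta>\<close> otherwise. The weak maximum principle uses \<eta> = 0; the strong one
  needs the tolerance.\<close>

lemma dilation_subsolution:
  assumes u: "is_solution \<alpha> D0 D1 f u" and t: "1 \<le> t" and \<eta>: "0 \<le> \<eta>" and C: "0 \<le> C"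
    and fL: "\<And>x v1 v2. x \<in> D \<Longrightarrow> v1 \<in> {0..1} \<Longrightarrow> v2 \<in> {0..1} \<Longrightarrow> \<bar>f x v1 - f x v2\<bar> \<le> C * \<bar>v1 - v2\<bar>"
    and r: "0 < r" and c: "\<And>x. x \<in> cball c r \<Longrightarrow> x \<in> D \<and> t *\<^sub>R x \<in> D \<and> u x - \<eta> \<le> u (t *\<^sub>R x)"
  shows "\<exists>l\<ge>- (C * \<eta>) * (LBINT x. bump c r x). gen_pairing (bump c r) (\<lambda>x. u (t *\<^sub>R x) - u x) l"
proof -
  note s = solution_facts[OF u]
  have t0: "0 < t" using t by simp
  have cb: "cball (t *\<^sub>R c) (t * r) \<subseteq> D"
  proof
    fix y assume y: "y \<in> cball (t *\<^sub>R c) (t * r)"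
    have "t *\<^sub>R c - y = t *\<^sub>R (c - inverse t *\<^sub>R y)" using t0 by (simp add: algebra_simps)
    then have "norm (t *\<^sub>R c - y) = t * norm (c - inverse t *\<^sub>R y)" using t0 by simp
    then have "inverse t *\<^sub>R y \<in> cball c r" using y t0 by (simp add: dist_norm)
    from c[OF this] show "y \<in> D" using t0 by simp
  qed
  let ?l1 = "t powr \<alpha> / t ^ DIM('a) * (LBINT x. bump (t *\<^sub>R c) (t * r) x * rhs u x)"
  let ?l2 = "LBINT x. bump c r x * rhs u x"
  have "gen_pairing (bump c r) (\<lambda>x. u (t *\<^sub>R x)) ?l1"
    by (rule gen_pairing_dilate[OF t0 solution_pairing[OF u _ cb]]) (use t0 r in simp)
  moreover have "gen_pairing (bump c r) u ?l2"
    by (rule solution_pairing[OF u r]) (use c in auto)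
  moreover have "(\<lambda>x. u (t *\<^sub>R x)) \<in> borel_measurable borel" using s(2) by measurable
  ultimately have "gen_pairing (bump c r) (\<lambda>x. u (t *\<^sub>R x) - 1 * u x) (?l1 - 1 * ?l2)"
    by (intro gen_pairing_diff[OF bump_integrable[OF r] _ s(4) s(2,4)])
  moreover have "- (C * \<eta>) * (LBINT x. bump c r x) \<le> ?l1 - 1 * ?l2"
  proof -
    have b: "bump (t *\<^sub>R c) (t * r) (t *\<^sub>R x) = bump c r x" for x
      using bump_scale[OF t0, of c r "t *\<^sub>R x"] t0 by simp
    have l1: "?l1 = t powr \<alpha> * (LBINT x. bump c r x * rhs u (t *\<^sub>R x))"
      using integral_lborel_affine(1)[of t "\<lambda>x. bump (t *\<^sub>R c) (t * r) x * rhs u x" 0] t0 by (simp add: b)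
    note i = rhs_integrable(1)[OF r s(2,3), of c] rhs_integrable(2)[OF r s(2,3), of c t]
    have e: "bump c r x * (t powr \<alpha> * rhs u (t *\<^sub>R x) - rhs u x)
        = t powr \<alpha> * (bump c r x * rhs u (t *\<^sub>R x)) - bump c r x * rhs u x" for x
      by (simp add: algebra_simps)
    have "- (C * \<eta>) * (LBINT x. bump c r x) \<le> (LBINT x. bump c r x * (t powr \<alpha> * rhs u (t *\<^sub>R x) - rhs u x))"
    proof (rule bump_integral_lower[OF r])
      show "integrable lborel (\<lambda>x. bump c r x * (t powr \<alpha> * rhs u (t *\<^sub>R x) - rhs u x))"
        unfolding e using i by (intro Bochner_Integration.integrable_diff integrable_mult_right)
      fix x assume x: "x \<in> cball c r"
      note cx = c[OF x]
      have "f x (u (t *\<^sub>R x)) \<le> t powr \<alpha> * f (t *\<^sub>R x) (u (t *\<^sub>R x))"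
        using cx s(3) by (intro f_scale t) auto
      moreover have "f x (u x) - C * \<eta> \<le> f x (u (t *\<^sub>R x))"
      proof (cases "u x \<le> u (t *\<^sub>R x)")
        case True
        then show ?thesis using f_mono[OF _ s(3)[of x] s(3)[of "t *\<^sub>R x"], of x] cx mult_nonneg_nonneg[OF C \<eta>] by linarith
      next
        case False
        have "\<bar>f x (u x) - f x (u (t *\<^sub>R x))\<bar> \<le> C * \<bar>u x - u (t *\<^sub>R x)\<bar>" using cx s(3) by (intro fL) auto
        also have "\<dots> \<le> C * \<eta>" using False cx C by (intro mult_left_mono) auto
        finally show ?thesis by linarith
      qed
      ultimately show "- (C * \<eta>) \<le> t powr \<alpha> * rhs u (t *\<^sub>R x) - rhs u x" using cx by (simp add: rhs_def)
    qed
    also have "\<dots> = ?l1 - 1 * ?l2"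
      unfolding e l1 using i by (simp add: Bochner_Integration.integral_diff)
    finally show ?thesis .
  qed
  ultimately show ?thesis by auto
qed

lemma solution_dilate_le:
  assumes u: "is_solution \<alpha> D0 D1 f u" and t: "1 \<le> t"
  shows "u (t *\<^sub>R x) \<le> u x"
proof -
  note s = solution_facts[OF u]
  obtain S k where S: "S \<in> sets borel" "S \<inter> D0 = {}" and k: "0 < k"
    "\<And>x \<delta>. x \<in> D0 \<Longrightarrow> 0 < \<delta> \<Longrightarrow> \<delta> \<le> 1 \<Longrightarrow> k \<le> (LBINT y. kern \<delta> y * indicator S (x + y))"
    using killing_set by blast
  obtain C where C: "0 < C" "\<And>x v1 v2. x \<in> D \<Longrightarrow> v1 \<in> {0..1} \<Longrightarrow> v2 \<in> {0..1} \<Longrightarrow> \<bar>f x v1 - f x v2\<bar> \<le> C * \<bar>v1 - v2\<bar>"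
    using f_Lipschitz by blast
  have "u (t *\<^sub>R x) - u x \<le> 0"
  proof (rule weak_maximum_principle[where w="\<lambda>x. u (t *\<^sub>R x) - u x" and G=D0 and S=S and k=k])
    show "continuous_on UNIV (\<lambda>x. u (t *\<^sub>R x) - u x)"
      by (intro continuous_intros s continuous_on_compose2[OF s(1)]) auto
    show "u (t *\<^sub>R x) - u x = 0" if "x \<notin> D0" for x
      using that s(5)[of x] s(5)[of "t *\<^sub>R x"] D0_dilate[OF t] by auto
    show "\<exists>l\<ge>0. gen_pairing (bump c r) (\<lambda>x. u (t *\<^sub>R x) - u x) l"
      if r: "0 < r" and c: "cball c r \<subseteq> {x. 0 < u (t *\<^sub>R x) - u x}" for c r
    proof -
      have "\<exists>l\<ge>- (C * 0) * (LBINT x. bump c r x). gen_pairing (bump c r) (\<lambda>x. u (t *\<^sub>R x) - u x) l"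
      proof (rule dilation_subsolution[OF u t order_refl _ C(2) r])
        fix x assume "x \<in> cball c r"
        then have lt: "u x < u (t *\<^sub>R x)" using c by auto
        \<comment> \<open>The strict inequality excludes the extreme values 1 at \<open>x\<close>
          and 0 at \<open>t *\<^sub>R x\<close>. Starshapedness transfers each exclusion to the
          other point, so both lie in the ring.\<close>
        have "x \<notin> closure D1" using lt s(3)[of "t *\<^sub>R x"] s(6)[of x] by auto
        moreover have "t *\<^sub>R x \<in> D0" using lt s(3)[of x] s(5)[of "t *\<^sub>R x"] by force
        ultimately show "x \<in> D \<and> t *\<^sub>R x \<in> D \<and> u x - 0 \<le> u (t *\<^sub>R x)"
          using lt D0_dilate[OF t] closure_D1_dilate[OF t] by (auto simp: D_def)
      qed (use C in auto)
      then show ?thesis by simp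
    qed
  qed (use S k bounded_D0 in auto)
  then show ?thesis by simp
qed

section \<open>Strict inequalities\<close>

lemma D0_supp: obtains R where "\<And>x. R < norm x \<Longrightarrow> x \<notin> D0"
  using bounded_D0 unfolding bounded_iff by (metis not_le)

text \<open>The source is nonnegative, so \<open>u\<close> is a subsolution without error, and a
  ball outside \<open>D0\<close> provides the set where \<open>u\<close> falls short of 1 by a full
  unit.\<close>

lemma solution_less_1:
  assumes u: "is_solution \<alpha> D0 D1 f u" and x0: "x0 \<in> D"
  shows "u x0 < 1"
proof (rule ccontr)
  assume "\<not> u x0 < 1"
  note s = solution_facts[OF u]
  have ux0: "u x0 = 1" using \<open>\<not> u x0 < 1\<close> s(3)[of x0] by auto
  obtain R where R: "\<And>x. R < norm x \<Longrightarrow> x \<notin> D0" using D0_supp by blast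
  obtain r0 where r0: "0 < r0" "ball x0 r0 \<subseteq> D" using open_D x0 open_contains_ball by blast
  obtain b :: 'a where b: "b \<in> Basis" using nonempty_Basis by blast
  let ?S = "ball ((\<bar>R\<bar> + 3) *\<^sub>R b) 1"
  have S: "z \<notin> D0" if "z \<in> ?S" for z
    using that norm_triangle_ineq2[of "(\<bar>R\<bar> + 3) *\<^sub>R b" z] b by (intro R) (auto simp: dist_norm)
  show False
  proof (rule strong_maximum_principle[OF s(1), where R=R and p=x0 and C=0 and S="?S" and \<kappa>=1])
    show "u x \<le> u x0" for x using ux0 s(3)[of x] by simp
    show "x0 \<notin> closure ?S"
    proof -
      have "D0 \<inter> closure ?S = {}"
        using S open_D0 by (subst open_Int_closure_eq_empty) auto
      then show ?thesis using x0 by (auto simp: D_def)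
    qed
    show "\<exists>l\<ge>- (0 * \<eta>) * integral\<^sup>L lborel (bump c r). gen_pairing (bump c r) u l"
      if "0 < r" "cball c r \<subseteq> {x \<in> ball x0 r0. u x0 - \<eta> < u x}" for \<eta> c r
    proof -
      have "cball c r \<subseteq> ball x0 r0" using that(2) by blast
      then have "cball c r \<subseteq> D" using r0(2) by (rule order_trans)
      then have "gen_pairing (bump c r) u (LBINT x. bump c r x * rhs u x)" by (rule solution_pairing[OF u that(1)])
      moreover have "0 * (LBINT x. bump c r x) \<le> (LBINT x. bump c r x * rhs u x)"
        using rhs_integrable(1)[OF that(1) s(2,3)] f_nonneg s(3)
        by (intro bump_integral_lower that) (auto simp: rhs_def indicator_def)
      ultimately show ?thesis by auto
    qed
  qed (use ux0 r0 R s(5) S in auto)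
qed

text \<open>Applied to \<open>- u\<close>, with \<open>D1\<close> as the set of lower values. Since
  \<open>f x 0 = 0\<close>, the Lipschitz bound gives \<open>f x (u x) \<le> C * u x\<close>, so the
  source is at most \<open>C * \<eta>\<close> where \<open>u\<close> is below \<eta>, which is the
  admissible error.\<close>

lemma solution_pos:
  assumes u: "is_solution \<alpha> D0 D1 f u" and x0: "x0 \<in> D"
  shows "0 < u x0"
proof (rule ccontr)
  assume "\<not> 0 < u x0"
  note s = solution_facts[OF u]
  have ux0: "u x0 = 0" using \<open>\<not> 0 < u x0\<close> s(3)[of x0] by auto
  obtain R where R: "\<And>x. R < norm x \<Longrightarrow> x \<notin> D0" using D0_supp by blast
  obtain r0 where r0: "0 < r0" "ball x0 r0 \<subseteq> D" using open_D x0 open_contains_ball by blast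
  obtain C where C: "0 < C" "\<And>x v1 v2. x \<in> D \<Longrightarrow> v1 \<in> {0..1} \<Longrightarrow> v2 \<in> {0..1} \<Longrightarrow> \<bar>f x v1 - f x v2\<bar> \<le> C * \<bar>v1 - v2\<bar>"
    using f_Lipschitz by blast
  show False
  proof (rule strong_maximum_principle[where v="\<lambda>x. - u x" and R=R and p=x0 and C=C and S=D1 and \<kappa>=1])
    show "continuous_on UNIV (\<lambda>x. - u x)" by (intro continuous_intros s)
    show "- u x \<le> - u x0" for x using ux0 s(3)[of x] by simp
    show "- u x \<le> - u x0 - 1" if "x \<in> D1" for x using ux0 s(6)[of x] that closure_subset by fastforce
    show "bounded D1" using bounded_subset[OF bounded_D0] closure_D1 closure_subset[of D1] by blast
    show "x0 \<notin> closure D1" using x0 by (simp add: D_def)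
    show "D1 \<noteq> {}" using zero_D1 by blast
    show "\<exists>l\<ge>- (C * \<eta>) * integral\<^sup>L lborel (bump c r). gen_pairing (bump c r) (\<lambda>x. - u x) l"
      if \<eta>: "0 < \<eta>" and r: "0 < r" and c: "cball c r \<subseteq> {x \<in> ball x0 r0. - u x0 - \<eta> < - u x}" for \<eta> c r
    proof -
      have "cball c r \<subseteq> ball x0 r0" using c by blast
      then have cD: "cball c r \<subseteq> D" using r0(2) by (rule order_trans)
      have z: "gen_pairing (bump c r) (\<lambda>_. 0) 0" by (simp add: gen_pairing_def gen_def)
      have "gen_pairing (bump c r) (\<lambda>x. 0 - 1 * u x) (0 - 1 * (LBINT x. bump c r x * rhs u x))"
        by (rule gen_pairing_diff[OF bump_integrable[OF r] _ _ s(2,4) z solution_pairing[OF u r cD], where B=1]) auto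
      moreover have "- (C * \<eta>) * (LBINT x. bump c r x) \<le> (LBINT x. bump c r x * (- rhs u x))"
      proof (rule bump_integral_lower[OF r])
        show "integrable lborel (\<lambda>x. bump c r x * - rhs u x)" using rhs_integrable(1)[OF r s(2,3)] by simp
        fix x assume x: "x \<in> cball c r"
        then have xD: "x \<in> D" and "u x < \<eta>" using cD c ux0 by auto
        have "f x (u x) \<le> C * u x" using C(2)[OF xD s(3)[of x], of 0] f_zero[OF xD] s(3)[of x] by simp
        also have "\<dots> \<le> C * \<eta>" using C(1) \<open>u x < \<eta>\<close> by (intro mult_left_mono) auto
        finally show "- (C * \<eta>) \<le> - rhs u x" using xD by (simp add: rhs_def)
      qed
      ultimately show ?thesis by (intro exI[of _ "- (LBINT x. bump c r x * rhs u x)"]) simp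
    qed
  qed (use ux0 r0 R s(5) C open_D1 in auto)
qed

lemma solution_dilate_less:
  assumes u: "is_solution \<alpha> D0 D1 f u" and x0: "x0 \<in> D" and t: "1 < t"
  shows "u (t *\<^sub>R x0) < u x0"
proof (rule ccontr)
  assume "\<not> u (t *\<^sub>R x0) < u x0"
  note s = solution_facts[OF u]
  have t1: "1 \<le> t" using t by simp
  have eq: "u (t *\<^sub>R x0) = u x0" using \<open>\<not> u (t *\<^sub>R x0) < u x0\<close> solution_dilate_le[OF u t1, of x0] by linarith
  \<comment> \<open>The common value lies strictly between 0 and 1, so the dilated point cannot be
    outside \<open>D0\<close> or in \<open>closure D1\<close>.\<close>
  have tx0: "t *\<^sub>R x0 \<in> D"
    using eq solution_pos[OF u x0] solution_less_1[OF u x0] s(5)[of "t *\<^sub>R x0"] s(6)[of "t *\<^sub>R x0"] by (auto simp: D_def)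
  let ?v = "\<lambda>x. u (t *\<^sub>R x) - u x"
  have vcont: "continuous_on UNIV ?v"
    by (intro continuous_intros s continuous_on_compose2[OF s(1)]) auto
  obtain R where R: "\<And>x. R < norm x \<Longrightarrow> x \<notin> D0" using D0_supp by blast
  have "open (D \<inter> (\<lambda>x. t *\<^sub>R x) -` D)"
    by (intro open_Int open_vimage open_D continuous_intros)
  then obtain r0 where r0: "0 < r0" "ball x0 r0 \<subseteq> D \<inter> (\<lambda>x. t *\<^sub>R x) -` D"
    using x0 tx0 open_contains_ball by blast
  obtain C where C: "0 < C" "\<And>x v1 v2. x \<in> D \<Longrightarrow> v1 \<in> {0..1} \<Longrightarrow> v2 \<in> {0..1} \<Longrightarrow> \<bar>f x v1 - f x v2\<bar> \<le> C * \<bar>v1 - v2\<bar>"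
    using f_Lipschitz by blast
  \<comment> \<open>Dilation pushes a point near the farthest point \<open>p\<close> of
    \<open>closure D1\<close> out of that set: closeness within \<open>norm p * (1 - 1 / t)\<close>
    gives \<open>norm p < norm (t *\<^sub>R q)\<close>. That \<open>p\<close> is not 0 follows from
    a ball around 0 in \<open>D1\<close>.\<close>
  obtain q where q: "q \<in> D1" "t *\<^sub>R q \<notin> closure D1"
  proof -
    have "compact (closure D1)"
      using bounded_subset[OF bounded_D0 closure_D1] by (simp add: compact_eq_bounded_closed)
    moreover have "closure D1 \<noteq> {}" using zero_D1 closure_subset by blast
    ultimately obtain p where p: "p \<in> closure D1" "\<And>x. x \<in> closure D1 \<Longrightarrow> norm x \<le> norm p"
      using continuous_attains_sup[of "closure D1" norm] continuous_on_norm_id by blast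
    obtain e where e: "0 < e" "ball 0 e \<subseteq> D1" using open_D1 zero_D1 open_contains_ball by blast
    obtain b :: 'a where b: "b \<in> Basis" using nonempty_Basis by blast
    have "(e / 2) *\<^sub>R b \<in> ball 0 e" using e b by simp
    then have "(e / 2) *\<^sub>R b \<in> closure D1" using e closure_subset by blast
    from p(2)[OF this] have "e / 2 \<le> norm p" using e b by simp
    then have pp: "0 < norm p" using e(1) by linarith
    have "0 < norm p * (1 - 1 / t)" using pp t by simp
    then obtain q where q: "q \<in> D1" "dist q p < norm p * (1 - 1 / t)"
      using p(1) unfolding closure_approachable by blast
    have "norm p / t < norm q"
      using q(2) norm_triangle_ineq2[of p q] by (simp add: dist_norm norm_minus_commute algebra_simps)
    then have "norm p < norm (t *\<^sub>R q)" using t by (simp add: field_simps)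
    then have "t *\<^sub>R q \<notin> closure D1" using p(2) by force
    then show thesis using that q(1) by blast
  qed
  have vq: "?v q < 0"
  proof -
    have "u (t *\<^sub>R q) < 1"
    proof (cases "t *\<^sub>R q \<in> D0")
      case True
      then show ?thesis using q(2) by (intro solution_less_1[OF u]) (simp add: D_def)
    qed (simp add: s(5))
    moreover have "u q = 1" using q(1) closure_subset by (intro s(6)) blast
    ultimately show ?thesis by simp
  qed
  \<comment> \<open>Half the drop at \<open>q\<close>, so that by continuity the drop exceeds
    \<kappa> on an open set containing \<open>q\<close>. Intersecting with \<open>D1\<close> keeps
    this set away from \<open>x0\<close>.\<close>
  define \<kappa> where "\<kappa> = (u q - u (t *\<^sub>R q)) / 2"
  have "0 < \<kappa>" using vq by (simp add: \<kappa>_def)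
  moreover have "?v q < - \<kappa>" using vq by (simp add: \<kappa>_def field_simps)
  ultimately have \<kappa>: "0 < \<kappa>" "?v q < - \<kappa>" .
  let ?S = "D1 \<inter> {x. ?v x < - \<kappa>}"
  show False
  proof (rule strong_maximum_principle[OF vcont, where R=R and p=x0 and C=C and S="?S" and \<kappa>=\<kappa>])
    show "?v x = 0" if "R < norm x" for x
    proof -
      have "norm x \<le> norm (t *\<^sub>R x)" using t by (simp add: mult_le_cancel_right1)
      then show ?thesis using R[of x] R[of "t *\<^sub>R x"] that s(5) by simp
    qed
    show "?v x \<le> ?v x0" for x using solution_dilate_le[OF u t1, of x] eq by simp
    show "open ?S" by (intro open_Int open_D1 open_Collect_less vcont continuous_intros)
    show "bounded ?S" using bounded_subset[OF bounded_D0] closure_D1 closure_subset[of D1] by blast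
    show "x0 \<notin> closure ?S" using x0 closure_mono[of ?S D1] by (auto simp: D_def)
    show "?S \<noteq> {}" using q \<kappa> by blast
    show "?v x \<le> ?v x0 - \<kappa>" if "x \<in> ?S" for x using that eq by simp
    show "\<exists>l\<ge>- (C * \<eta>) * integral\<^sup>L lborel (bump c r). gen_pairing (bump c r) ?v l"
      if \<eta>: "0 < \<eta>" and r: "0 < r" and c: "cball c r \<subseteq> {x \<in> ball x0 r0. ?v x0 - \<eta> < ?v x}" for \<eta> c r
    proof (rule dilation_subsolution[OF u t1 _ _ C(2) r])
      fix x assume "x \<in> cball c r"
      then have "x \<in> ball x0 r0" "?v x0 - \<eta> < ?v x" using c by auto
      then show "x \<in> D \<and> t *\<^sub>R x \<in> D \<and> u x - \<eta> \<le> u (t *\<^sub>R x)" using r0(2) eq by auto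
    qed (use C \<eta> in auto)
  qed (use eq r0 C \<kappa> in auto)
qed

section \<open>Shape of the superlevel sets\<close>

lemma superlevel_starshaped:
  assumes u: "is_solution \<alpha> D0 D1 f u" and l: "0 < l" "l < 1"
  shows "starshaped (superlevel u l)"
  unfolding starshaped_def
proof (intro ballI subsetI)
  fix s :: real and y assume s: "s \<in> {0..1}" and "y \<in> (\<lambda>x. s *\<^sub>R x) ` superlevel u l"
  then obtain x where x: "l \<le> u x" "y = s *\<^sub>R x" by (auto simp: superlevel_def)
  show "y \<in> superlevel u l"
  proof (cases "s = 0")
    case True
    then have "u y = 1" using x zero_D1 closure_subset by (intro solution_facts(6)[OF u]) auto
    then show ?thesis using l by (simp add: superlevel_def)
  next
    case False
    then have "u (inverse s *\<^sub>R y) \<le> u y" using s by (intro solution_dilate_le[OF u]) (auto simp: one_le_inverse_iff)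
    then show ?thesis using x False by (simp add: superlevel_def)
  qed
qed

lemma superlevel_strictly_starshaped:
  assumes u: "is_solution \<alpha> D0 D1 f u" and l: "0 < l" "l < 1"
  shows "strictly_starshaped (superlevel u l)"
  unfolding strictly_starshaped_def
proof (intro conjI allI impI)
  note s = solution_facts[OF u]
  let ?U = "superlevel u l"
  have closed: "closed ?U" unfolding superlevel_def by (intro closed_Collect_le s continuous_intros)
  have D1U: "D1 \<subseteq> ?U" using s(6) closure_subset[of D1] l by (auto simp: superlevel_def)
  then show "0 \<in> interior ?U" using zero_D1 open_D1 by (meson interior_maximal subsetD)
  have fr: "u p = l" if "p \<in> frontier ?U" for p
  proof -
    have "p \<in> ?U" using that closed frontier_subset_closed by blast
    moreover have "{x. l < u x} \<subseteq> interior ?U"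
      by (rule interior_maximal) (auto simp: superlevel_def intro!: open_Collect_less s continuous_intros)
    then have "\<not> l < u p" using that by (auto simp: frontier_def)
    ultimately show ?thesis by (simp add: superlevel_def)
  qed
  fix v :: 'a assume v: "v \<noteq> 0"
  obtain R where R: "\<And>x. R < norm x \<Longrightarrow> x \<notin> D0" using D0_supp by blast
  \<comment> \<open>Far enough along the ray to be outside \<open>D0\<close>, hence outside the
    superlevel set; the segment from 0 must then meet the frontier.\<close>
  define T where "T = (\<bar>R\<bar> + 1) / norm v"
  have T: "0 \<le> T" "norm (T *\<^sub>R v) = \<bar>R\<bar> + 1" using v by (auto simp: T_def)
  then have "T *\<^sub>R v \<notin> D0" by (intro R) simp
  then have "T *\<^sub>R v \<notin> ?U" using s(5) l by (simp add: superlevel_def)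
  moreover have "0 \<in> ?U" using D1U zero_D1 by blast
  ultimately obtain z where z: "z \<in> frontier ?U" "z \<in> closed_segment 0 (T *\<^sub>R v)"
    using connected_Int_frontier[of "closed_segment 0 (T *\<^sub>R v)" ?U] by auto
  have "z \<in> ray v" using z(2) T(1) by (auto simp: ray_def in_segment)
  moreover have "p = z" if p: "p \<in> ray v" "p \<in> frontier ?U" for p
  proof -
    have aux: "False" if ab: "0 \<le> a" "a < b" and fp: "a *\<^sub>R v \<in> frontier ?U" "b *\<^sub>R v \<in> frontier ?U" for a b
    proof -
      have ul: "u (a *\<^sub>R v) = l" "u (b *\<^sub>R v) = l" using fr fp by auto
      have "u 0 = 1" using zero_D1 closure_subset by (intro s(6)) blast
      \<comment> \<open>The origin has value 1 > l, so it is not a frontier point; this permits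
        writing the second point as a dilation of the first by \<open>b / a\<close>.\<close>
      then have a: "0 < a" using ab(1) ul l by (cases "a = 0") auto
      have "a *\<^sub>R v \<in> D" using ul(1) l s(5)[of "a *\<^sub>R v"] s(6)[of "a *\<^sub>R v"] by (auto simp: D_def)
      moreover have "1 < b / a" using a ab by simp
      ultimately have "u ((b / a) *\<^sub>R (a *\<^sub>R v)) < u (a *\<^sub>R v)" by (rule solution_dilate_less[OF u])
      then show False using ul a by simp
    qed
    obtain a b where ab: "0 \<le> a" "p = a *\<^sub>R v" "0 \<le> b" "z = b *\<^sub>R v"
      using p(1) \<open>z \<in> ray v\<close> by (auto simp: ray_def)
    then show ?thesis using aux[of a b] aux[of b a] p(2) z(1) by (metis linorder_neqE)
  qed
  ultimately show "\<exists>!p. p \<in> ray v \<and> p \<in> frontier ?U" using z(1) by blast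
qed

end

theorem theorem1p2:
  fixes \<alpha> :: real
    and D0 D1 :: "'a::euclidean_space set"
    and f :: "'a \<Rightarrow> real \<Rightarrow> real"
  defines "D \<equiv> D0 - closure D1"
  assumes "0 < \<alpha>" and "\<alpha> < 2"
    and "open D0" and "bounded D0" and "starshaped D0"
    and "open D1" and "bounded D1" and "starshaped D1"
    and "0 \<in> D1" and "closure D1 \<subseteq> D0"
    and "uniform_exterior_cone_condition D"
    and "C11_domain D"
    and "\<forall>t\<ge>1. \<forall>x\<in>D. \<forall>v\<in>{0..1}. t *\<^sub>R x \<in> D \<longrightarrow> t powr \<alpha> * f (t *\<^sub>R x) v \<ge> f x v"
    and "\<exists>C>0. \<forall>x\<in>D. \<forall>v1\<in>{0..1}. \<forall>v2\<in>{0..1}. \<bar>f x v1 - f x v2\<bar> \<le> C * \<bar>v1 - v2\<bar>"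
    and "\<forall>x\<in>D. \<forall>v1\<in>{0..1}. \<forall>v2\<in>{0..1}. v1 < v2 \<longrightarrow> f x v1 \<le> f x v2"
    and "bounded ((\<lambda>(x, v). f x v) ` (D \<times> {0..1}))"
    and "continuous_on (D \<times> {0..1}) (\<lambda>(x, v). f x v)"
    and "\<forall>x\<in>D. f x 0 = 0"
  shows "(\<exists>!u. is_solution \<alpha> D0 D1 f u) \<and>
         (\<forall>u. is_solution \<alpha> D0 D1 f u \<longrightarrow>
           (\<forall>x\<in>D. 0 < u x \<and> u x < 1) \<and>
           (\<forall>l\<in>{0<..<1}. starshaped (superlevel u l)) \<and>
           (strictly_starshaped D0 \<and> strictly_starshaped D1 \<longrightarrow>
              (\<forall>l\<in>{0<..<1}. strictly_starshaped (superlevel u l))))"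
proof -
  interpret ring_problem \<alpha> D0 D1 D f
  proof unfold_locales
    fix x v1 v2 assume "x \<in> D" "v1 \<in> {0..1::real}" "v2 \<in> {0..1::real}" "v1 \<le> v2"
    then show "f x v1 \<le> f x v2" using assms(16) by (cases "v1 = v2") auto
  qed (use assms in auto)
  have "\<exists>!u. is_solution \<alpha> D0 D1 f u"
    using solution_exists solution_le by (metis antisym ext)
  then show ?thesis
    using solution_pos solution_less_1 superlevel_starshaped superlevel_strictly_starshaped by auto
qed

end
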